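(* Let $M^n(P,\lambda)$ be a small cover over $P=\prod_{j=1}^m\Delta^{n_j}$. If $n_j=2^{r_j-1}$ for $j=1,2,\dots,m$, where the $r_j$ are positive integers, then $$\mathrm{TC}(M^n(P,\lambda))\ge 2n-m+1.$$
   Context: Here $n=n_1+\dots+n_m$ and $\Delta^{n_j}$ is the $n_j$-simplex. A small cover over an $n$-dimensional simple polytope $P$ is a closed connected smooth $n$-manifold with a locally standard $\mathbb{Z}_2^n$-action (locally modelled, up to automorphisms of $\mathbb{Z}_2^n$, on the action on $\mathbb{R}^n$ by reflections in coordinate hyperplanes) with orbit space $P$. A characteristic function $\lambda$ assigns to each facet of $P$ a vector in $\mathbb{Z}_2^n$ so that the vectors of any collection of facets with nonempty intersection are linearly independent over $\mathbb{Z}_2$; $M^n(P,\lambda)=(P\times\mathbb{Z}_2^n)/\sim$, where $(p,g)\sim(q,h)$ iff $p=q$ and $g^{-1}h$ lies in the subgroup generated by the $\lambda(F)$ with $F$ a facet containing $p$. $\mathrm{TC}(X)$ (unreduced topological complexity) is the smallest $k$ such that $X\times X$ has an open cover by $k$ sets on each of which the path fibration $\gamma\mapsto(\gamma(0),\gamma(1))$ from the space of all paths in $X$ to $X\times X$ has a continuous section. *)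

theory Defs
  imports "HOL-Analysis.Analysis" "HOL-Library.Z2" "HOL-Library.Extended_Nat"
begin

text \<open>The vector space \<open>\<int>\<^sub>2\<^sup>n\<close> is \<open>bit ^ 'n\<close> with \<open>CARD('n) = n\<close>. The vectors of a collection of facets
  are required to be independent as a family, hence injectivity of \<open>lam\<close> on the collection.\<close>

definition characteristic_function ::
    "'a::euclidean_space set \<Rightarrow> ('a set \<Rightarrow> (bit ^ 'n)) \<Rightarrow> bool" where
  "characteristic_function P lam \<longleftrightarrow>
     (\<forall>\<F>. \<F> \<subseteq> {F. F facet_of P} \<and> \<Inter>\<F> \<noteq> {} \<longrightarrow>
        inj_on lam \<F> \<and> vec.independent (lam ` \<F>))"

definition generated_subgroup :: "'a::ab_group_add set \<Rightarrow> 'a set" where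
  "generated_subgroup S =
     \<Inter>{H. S \<subseteq> H \<and> 0 \<in> H \<and> (\<forall>x\<in>H. \<forall>y\<in>H. x + y \<in> H) \<and> (\<forall>x\<in>H. - x \<in> H)}"

definition small_cover_rel ::
    "'a::euclidean_space set \<Rightarrow> ('a set \<Rightarrow> (bit ^ 'n)) \<Rightarrow> (('a \<times> (bit ^ 'n)) \<times> ('a \<times> (bit ^ 'n))) set" where
  "small_cover_rel P lam =
     {((p, g), (q, h)). p \<in> P \<and> p = q \<and>
        - g + h \<in> generated_subgroup {lam F |F. F facet_of P \<and> p \<in> F}}"

text \<open>For an equivalence relation \<open>R\<close> on \<open>topspace X\<close>, the finest topology on the set of equivalence
  classes making the canonical projection continuous.\<close>

definition quotient_topology :: "'a topology \<Rightarrow> ('a \<times> 'a) set \<Rightarrow> 'a set topology" where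
  "quotient_topology X R =
     topology (\<lambda>U. U \<subseteq> topspace X // R \<and> openin X {x \<in> topspace X. R `` {x} \<in> U})"

lemma openin_quotient_topology:
  "openin (quotient_topology X R) U \<longleftrightarrow>
     U \<subseteq> topspace X // R \<and> openin X {x \<in> topspace X. R `` {x} \<in> U}"
proof -
  let ?pre = "\<lambda>U. {x \<in> topspace X. R `` {x} \<in> U}"
  have "istopology (\<lambda>U. U \<subseteq> topspace X // R \<and> openin X (?pre U))"
    unfolding istopology_def
  proof (intro conjI allI impI)
    fix S T
    assume S: "S \<subseteq> topspace X // R \<and> openin X (?pre S)"
      and T: "T \<subseteq> topspace X // R \<and> openin X (?pre T)"
    have "?pre (S \<inter> T) = ?pre S \<inter> ?pre T" by auto
    then show "openin X (?pre (S \<inter> T))" using S T by (simp only: openin_Int)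
    show "S \<inter> T \<subseteq> topspace X // R" using S by blast
  next
    fix \<K>
    assume K: "\<forall>K\<in>\<K>. K \<subseteq> topspace X // R \<and> openin X (?pre K)"
    have "?pre (\<Union>\<K>) = (\<Union>K\<in>\<K>. ?pre K)" by auto
    moreover have "openin X (\<Union>K\<in>\<K>. ?pre K)" using K by blast
    ultimately show "openin X (?pre (\<Union>\<K>))" by simp
    show "\<Union>\<K> \<subseteq> topspace X // R" using K by blast
  qed
  then show ?thesis
    unfolding quotient_topology_def by (simp add: topology_inverse')
qed

lemma topspace_quotient_topology: "topspace (quotient_topology X R) = topspace X // R"
proof -
  have "{x \<in> topspace X. R `` {x} \<in> topspace X // R} = topspace X"
    by (blast intro: quotientI)
  then have "openin (quotient_topology X R) (topspace X // R)"
    by (simp add: openin_quotient_topology)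
  then have "topspace X // R \<subseteq> topspace (quotient_topology X R)"
    by (rule openin_subset)
  moreover have "topspace (quotient_topology X R) \<subseteq> topspace X // R"
    using openin_topspace [of "quotient_topology X R"]
    by (simp only: openin_quotient_topology)
  ultimately show ?thesis
    by (simp only: subset_antisym)
qed

definition small_cover ::
    "'a::euclidean_space set \<Rightarrow> ('a set \<Rightarrow> (bit ^ 'n)) \<Rightarrow> ('a \<times> (bit ^ 'n)) set topology" where
  "small_cover P lam =
     quotient_topology (prod_topology (top_of_set P) (discrete_topology UNIV))
       (small_cover_rel P lam)"

text \<open>Functions are taken to be \<open>undefined\<close> off \<open>topspace X\<close>, so that an element of the mapping space is
  determined by its values on \<open>topspace X\<close>.\<close>

definition compact_open_topology :: "'a topology \<Rightarrow> 'b topology \<Rightarrow> ('a \<Rightarrow> 'b) topology" where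
  "compact_open_topology X Y =
     topology_generated_by
       {{f \<in> extensional (topspace X). continuous_map X Y f \<and> f ` K \<subseteq> U} |K U.
          compactin X K \<and> openin Y U}"

definition path_space :: "'a topology \<Rightarrow> (real \<Rightarrow> 'a) topology" where
  "path_space X = compact_open_topology (top_of_set {0..1}) X"

definition path_fibration :: "(real \<Rightarrow> 'a) \<Rightarrow> 'a \<times> 'a" where
  "path_fibration \<gamma> = (\<gamma> 0, \<gamma> 1)"

definition has_motion_planner :: "'a topology \<Rightarrow> ('a \<times> 'a) set \<Rightarrow> bool" where
  "has_motion_planner X U \<longleftrightarrow>
     (\<exists>s. continuous_map (subtopology (prod_topology X X) U) (path_space X) s \<and>
          (\<forall>z\<in>U. path_fibration (s z) = z))"

text \<open>The infimum of the empty set is \<open>\<infinity>\<close>.\<close>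

definition TC :: "'a topology \<Rightarrow> enat" where
  "TC X = Inf {enat k |k. \<exists>U :: nat \<Rightarrow> ('a \<times> 'a) set.
      (\<forall>i<k. openin (prod_topology X X) (U i) \<and> has_motion_planner X (U i)) \<and>
      (\<Union>i<k. U i) = topspace (prod_topology X X)}"

end

theory Submission
  imports Defs
begin

text \<open>The small cover is \<open>X / K\<close>, where \<open>X\<close> is a product of spheres and \<open>K\<close> the group of sign changes
  killed by the characteristic vectors. Over the domain \<open>U\<close> of a motion planner, lifting the planned path
  from \<open>[x]\<close> to \<open>[y]\<close> gives a locally constant \<open>\<kappa>(x, y) \<in> K\<close> with
  \<open>\<kappa>(\<alpha>x, \<beta>y) = \<kappa>(x, y) + \<alpha> + \<beta>\<close>, so all the classes \<open>x\<^sub>j \<otimes> 1 + 1 \<otimes> x\<^sub>j\<close> vanish on \<open>U\<close>, and a product of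
  \<open>2 n - m\<close> of them would vanish if \<open>2 n - m\<close> such domains sufficed. But
  \<open>\<Prod>\<^sub>j (x\<^sub>j \<otimes> 1 + 1 \<otimes> x\<^sub>j)\<^bsup>2 n\<^sub>j - 1\<^esup>\<close> is nonzero: in a triangular order of the blocks it evaluates to
  \<open>\<Prod>\<^sub>j (2 n\<^sub>j - 1 choose n\<^sub>j)\<close>, an odd number, on the \<open>\<int>\<^sub>2\<close>-cycle covered by
  \<open>\<Prod>\<^sub>j S\<^bsup>n\<^sub>j - 1\<^esup> \<times> S\<^bsup>n\<^sub>j\<^esup>\<close>. Cohomology is replaced by cochains on a fine equivariant triangulation: a class in
  \<open>H\<^sup>1\<close> is the coboundary of an equivariant \<open>\<int>\<^sub>2\<close>-valued function on the vertices upstairs, and the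
  evaluation of a cup product depends only on the characters of these functions.\<close>

text \<open>The powers of two enter only through \<open>2 * n j - 1 = 2 ^ r j - 1\<close>: every
  entry of that row of Pascal's triangle is odd. The dimensions \<open>n j - 1\<close> and
  \<open>n j\<close> of the two copies of block j add up to the number of factors belonging to j, so
  the whole product has top degree on the cycle and its value is a count of flags modulo 2. The
  obstacle is that the blocks are twisted together: a sign change in one block may act on another
  one, and the small cover is in general no product of projective spaces. The triangular order
  restores a one-way dependence, so that the blocks can be worked off one after another. No
  cohomology ring is built. One and the same sum over flags is computed twice, with different
  cochains of the same characters. For cochains taken from the planners, the i-th factor from the
  i-th domain, each small flag lies in one domain and so has a vanishing factor. For leading signs
  the sum counts lattice paths. That both give the same value rests on a single property of the
  triangulation: each vertex of a flag can be exchanged in exactly one way.\<close>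

text \<open>These default rules rewrite the ring operations of \<open>bit\<close> to bit operations.\<close>

declare add_bit_eq_xor [simp del] mult_bit_eq_and [simp del]

lemma bit_add_self [simp]: "x + x = (0::bit)"
  by (cases x) auto

lemma bit_add_eq_0_iff: "x + y = 0 \<longleftrightarrow> x = (y::bit)"
  by (cases x; cases y) auto

text \<open>The simplicial coface map: \<open>skip j l\<close> is the l-th vertex of the face
  opposite to vertex j.\<close>

abbreviation (input) skip :: "nat \<Rightarrow> nat \<Rightarrow> nat" where
  "skip j l \<equiv> (if l < j then l else Suc l)"

section \<open>Cup products of coboundaries on a simplex\<close>

text \<open>A cup product of 1-cocycles is a cocycle, evaluated on one simplex of dimension
  \<open>Suc M\<close>. In the induction the last factor is split off: it is the same edge for all
  faces but the last two, and these two agree in all other factors.\<close>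

lemma sum_skip_prod_coboundaries:
  fixes c :: "nat \<Rightarrow> nat \<Rightarrow> bit"
  shows "(\<Sum>j\<le>Suc M. \<Prod>l<M. c l (skip j l) + c l (skip j (Suc l))) = 0"
proof (induction M)
  case 0
  then show ?case by simp
next
  case (Suc M)
  define P where "P j = (\<Prod>l<M. c l (skip j l) + c l (skip j (Suc l)))" for j
  define e where "e = c M (Suc M) + c M (Suc (Suc M))"
  have PP: "P (Suc (Suc M)) = P (Suc M)"
    unfolding P_def by (intro prod.cong) auto
  have IH: "(\<Sum>j\<le>M. P j) = P (Suc M)"
    using Suc.IH by (simp add: P_def[symmetric] bit_add_eq_0_iff)
  have "(\<Sum>j\<le>Suc (Suc M). \<Prod>l<Suc M. c l (skip j l) + c l (skip j (Suc l)))
      = (\<Sum>j\<le>Suc (Suc M). P j * (c M (skip j M) + c M (skip j (Suc M))))"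
    by (simp add: P_def)
  also have "\<dots> = (\<Sum>j\<le>M. P j * e) + P (Suc M) * (c M M + c M (Suc (Suc M)))
      + P (Suc M) * (c M M + c M (Suc M))"
    by (simp add: PP) (simp add: e_def)
  also have "\<dots> = P (Suc M) * e + P (Suc M) * e"
    unfolding sum_distrib_right[symmetric] IH by (simp add: e_def algebra_simps)
  also have "\<dots> = 0" by simp
  finally show ?case .
qed

text \<open>The Leibniz rule for the cochain \<open>a\<^sub>0 \<union> \<dots> \<union> d \<union> \<dots> \<union> a\<^sub>N\<^sub>-\<^sub>1\<close> on an \<open>N\<close>-simplex, with the
  cocycles \<open>a\<^sub>l = \<delta> (c l)\<close> and the \<open>0\<close>-cochain \<open>d\<close> in position \<open>i\<close>.\<close>

lemma sum_skip_cup_product: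
  fixes c :: "nat \<Rightarrow> nat \<Rightarrow> bit"
  assumes i: "i < N"
  shows "(\<Sum>k\<le>N. (\<Prod>l<i. c l (skip k l) + c l (skip k (Suc l))) * d (skip k i) *
           (\<Prod>l=i..<N - 1. c (Suc l) (skip k l) + c (Suc l) (skip k (Suc l))))
       = (\<Prod>l<i. c l l + c l (Suc l)) * (d i + d (Suc i)) * (\<Prod>l=Suc i..<N. c l l + c l (Suc l))"
    (is "(\<Sum>k\<le>N. ?A k * d (skip k i) * ?B k) = ?L * _ * ?R")
proof -
  \<comment> \<open>The front simplex on the vertices 0 to \<open>Suc i\<close>: its faces sum to 0,
    and the face opposite to \<open>Suc i\<close> gives \<open>?L\<close>.\<close>
  have A: "(\<Sum>k\<le>i. ?A k) = ?L"
  proof -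
    have "?A (Suc i) = ?L"
      by (intro prod.cong) auto
    then show ?thesis
      using sum_skip_prod_coboundaries[of c i] by (simp add: bit_add_eq_0_iff)
  qed
  define M where "M = N - 1 - i"
  have N: "N = Suc (i + M)" using i by (simp add: M_def)
  have Bshift: "?B (i + j) = (\<Prod>l<M. c (Suc (i+l)) (i + skip j l) + c (Suc (i+l)) (i + skip j (Suc l)))" for j
  proof -
    have "?B (i + j) = (\<Prod>l\<in>(+) i ` {0..<M}. c (Suc l) (skip (i+j) l) + c (Suc l) (skip (i+j) (Suc l)))"
      by (simp add: N image_add_atLeastLessThan add.commute)
    also have "\<dots> = (\<Prod>l<M. c (Suc (i+l)) (i + skip j l) + c (Suc (i+l)) (i + skip j (Suc l)))"
      by (subst prod.reindex) (auto simp: lessThan_atLeast0 intro!: prod.cong)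
    finally show ?thesis .
  qed
  have R: "?B k = ?R" if "k \<le> i" for k
  proof -
    have "?B k = (\<Prod>l=i..<N-1. c (Suc l) (Suc l) + c (Suc l) (Suc (Suc l)))"
      using that by (intro prod.cong) auto
    also have "\<dots> = ?R"
      using prod.shift_bounds_Suc_ivl[of "\<lambda>l. c l l + c l (Suc l)" i "i + M"]
      by (simp add: N del: prod.op_ivl_Suc)
    finally show ?thesis .
  qed
  \<comment> \<open>Likewise for the back simplex on the vertices i to N, whose face opposite to i
    gives \<open>?R\<close>.\<close>
  have "(\<Sum>j\<le>Suc M. ?B (i + j)) = 0"
    unfolding Bshift
    using sum_skip_prod_coboundaries[of "\<lambda>l m. c (Suc (i + l)) (i + m)" M] by simp
  moreover have "(\<Sum>j\<le>Suc M. ?B (i + j)) = ?B i + (\<Sum>j\<le>M. ?B (i + Suc j))"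
    by (subst sum.atMost_Suc_shift) (simp only: add_0_right)
  moreover have "(\<Sum>j\<le>M. ?B (i + Suc j)) = (\<Sum>k=Suc i..N. ?B k)"
  proof -
    have "(\<Sum>k=Suc i..N. ?B k) = (\<Sum>k\<in>(\<lambda>j. i + Suc j) ` {..M}. ?B k)"
    proof (rule sum.cong)
      have "k \<in> (\<lambda>j. i + Suc j) ` {..M}" if "Suc i \<le> k" "k \<le> N" for k
        using that N by (intro image_eqI[of _ _ "k - Suc i"]) auto
      then show "{Suc i..N} = (\<lambda>j. i + Suc j) ` {..M}" by (auto simp: N)
    qed simp
    also have "\<dots> = (\<Sum>j\<le>M. ?B (i + Suc j))"
      by (subst sum.reindex) (auto simp: inj_on_def)
    finally show ?thesis by simp
  qed
  ultimately have B: "(\<Sum>k=Suc i..N. ?B k) = ?R"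
    using R[of i] by (simp add: bit_add_eq_0_iff)
  have "{..N} = {..i} \<union> {Suc i..N}" using i by auto
  then have "(\<Sum>k\<le>N. ?A k * d (skip k i) * ?B k)
      = (\<Sum>k\<le>i. ?A k * d (skip k i) * ?B k) + (\<Sum>k=Suc i..N. ?A k * d (skip k i) * ?B k)"
    by (simp only:) (subst sum.union_disjoint, auto)
  also have "(\<Sum>k\<le>i. ?A k * d (skip k i) * ?B k) = (\<Sum>k\<le>i. ?A k * d (Suc i) * ?R)"
  proof (intro sum.cong refl)
    fix k assume "k \<in> {..i}"
    then have "?B k = ?R" "\<not> i < k" using R by auto
    then show "?A k * d (skip k i) * ?B k = ?A k * d (Suc i) * ?R" by (simp only: if_False)
  qed
  also have "\<dots> = ?L * d (Suc i) * ?R"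
    by (simp only: sum_distrib_right[symmetric] A)
  also have "(\<Sum>k=Suc i..N. ?A k * d (skip k i) * ?B k) = (\<Sum>k=Suc i..N. ?L * d i * ?B k)"
  proof (intro sum.cong refl)
    fix k assume k: "k \<in> {Suc i..N}"
    then have "?A k = ?L" "i < k" by (auto intro: prod.cong)
    then show "?A k * d (skip k i) * ?B k = ?L * d i * ?B k" by (simp only: if_True)
  qed
  also have "\<dots> = ?L * d i * ?R"
    by (simp only: sum_distrib_left[symmetric] B)
  finally show ?thesis by (simp add: algebra_simps)
qed

lemma sum_fixpoint_free_involution:
  fixes h :: "'a \<Rightarrow> bit"
  assumes "finite S" "\<And>x. x \<in> S \<Longrightarrow> \<tau> x \<in> S \<and> \<tau> (\<tau> x) = x \<and> \<tau> x \<noteq> x \<and> h (\<tau> x) = h x"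
  shows "sum h S = 0"
  using assms
proof (induction S rule: finite_psubset_induct)
  case (psubset S)
  show ?case
  proof (cases "S = {}")
    case False
    then obtain x where x: "x \<in> S" by auto
    have *: "\<tau> x \<in> S" "\<tau> (\<tau> x) = x" "\<tau> x \<noteq> x" "h (\<tau> x) = h x" using psubset.prems[OF x] by auto
    have "sum h (S - {x, \<tau> x}) = 0"
    proof (rule psubset.IH)
      show "S - {x, \<tau> x} \<subset> S" using x by auto
      fix y assume y: "y \<in> S - {x, \<tau> x}"
      then have "\<tau> y \<in> S" "\<tau> (\<tau> y) = y" "\<tau> y \<noteq> y" "h (\<tau> y) = h y" using psubset.prems by auto
      then show "\<tau> y \<in> S - {x, \<tau> x} \<and> \<tau> (\<tau> y) = y \<and> \<tau> y \<noteq> y \<and> h (\<tau> y) = h y"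
        using y * by auto
    qed
    moreover have "sum h S = sum h (S - {x, \<tau> x}) + sum h {x, \<tau> x}"
      using x * psubset.hyps by (intro sum.subset_diff) auto
    ultimately show ?thesis using * by simp
  qed simp
qed

section \<open>Sign changes on products of cube boundaries\<close>

definition block_idx :: "('m \<Rightarrow> nat) \<Rightarrow> ('m \<times> nat) set" where
  "block_idx n = {(j, i). i \<le> n j}"

lemma finite_block_idx [simp]: "finite (block_idx n)" for n :: "'m::finite \<Rightarrow> nat"
proof -
  have "block_idx n = (SIGMA j:UNIV. {..n j})" by (auto simp: block_idx_def)
  then show ?thesis by simp
qed

text \<open>A group of sign changes that restricts isomorphically to any choice of one coordinate from each
  block, which makes it act freely on products of spheres.\<close>

locale sign_group =
  fixes n :: "'m::finite \<Rightarrow> nat" and K :: "('m \<times> nat \<Rightarrow> bit) set"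
  assumes K_add: "\<alpha> \<in> K \<Longrightarrow> \<beta> \<in> K \<Longrightarrow> (\<lambda>p. \<alpha> p + \<beta> p) \<in> K"
    and K_dual: "(\<And>j. \<iota> j \<le> n j) \<Longrightarrow> \<exists>!\<alpha>. \<alpha> \<in> K \<and> (\<forall>j. \<alpha> (j, \<iota> j) = T j)"
begin

lemma zero_in_K: "(\<lambda>p. 0) \<in> K"
proof -
  obtain \<gamma> where "\<gamma> \<in> K" using K_dual[of "\<lambda>b. 0" "\<lambda>b. 0"] by auto
  then show ?thesis using K_add[of \<gamma> \<gamma>] by simp
qed

lemma K_eqI:
  assumes "\<alpha> \<in> K" "\<beta> \<in> K" "\<And>j. \<iota> j \<le> n j" "\<And>j. \<alpha> (j, \<iota> j) = \<beta> (j, \<iota> j)"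
  shows "\<alpha> = \<beta>"
  using K_dual[of \<iota> "\<lambda>j. \<alpha> (j, \<iota> j)"] assms by metis

end

declare split_paired_All [simp del] split_paired_Ex [simp del]

type_synonym 'b grid = "'b \<times> nat \<Rightarrow> int"

definition act :: "('i \<Rightarrow> bit) \<Rightarrow> ('i \<Rightarrow> int) \<Rightarrow> 'i \<Rightarrow> int" where
  "act \<gamma> v = (\<lambda>p. if \<gamma> p = 1 then - v p else v p)"

lemma act_act: "act \<gamma> (act \<delta> v) = act (\<lambda>p. \<gamma> p + \<delta> p) v"
proof
  fix p show "act \<gamma> (act \<delta> v) p = act (\<lambda>p. \<gamma> p + \<delta> p) v p"
    by (cases "\<gamma> p"; cases "\<delta> p") (auto simp: act_def)
qed

lemma act_zero [simp]: "act (\<lambda>p. 0) v = v"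
  by (simp add: act_def)

lemma act_involutive [simp]: "act \<gamma> (act \<gamma> v) = v"
  by (simp add: act_act)

lemma even_act [simp]: "even (act \<gamma> v p) \<longleftrightarrow> even (v p)"
  by (simp add: act_def)

lemma abs_act [simp]: "\<bar>act \<gamma> v p\<bar> = \<bar>v p\<bar>"
  by (simp add: act_def)

lemma act_eq_0_iff [simp]: "act \<gamma> v p = 0 \<longleftrightarrow> v p = 0"
  by (simp add: act_def)

text \<open>The cube complex of side \<open>2\<close> on \<open>\<Prod>\<^sub>b \<partial>[-L,L]\<^bsup>d b + 1\<^esup>\<close>, subdivided barycentrically: a face is
  identified with its barycentre, an integer point whose odd coordinates are the directions of the
  face. The top simplices are the flags.\<close>

locale cube_spheres = sign_group d G
  for d :: "'b::finite \<Rightarrow> nat" and G :: "('b \<times> nat \<Rightarrow> bit) set" +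
  fixes L :: int
  assumes L: "even L" "L > 0"
begin

abbreviation idx :: "('b \<times> nat) set" where "idx \<equiv> block_idx d"

definition N :: nat where
  "N = (\<Sum>b\<in>UNIV. d b)"

text \<open>All integer points occur, because each is the barycentre of exactly one face. As L is
  even, a coordinate of modulus L is never a direction of the face, so the whole face lies in the
  boundary.\<close>

definition V :: "'b grid set" where
  "V = {v. (\<forall>p. p \<notin> idx \<longrightarrow> v p = 0) \<and> (\<forall>p. \<bar>v p\<bar> \<le> L) \<and> (\<forall>b. \<exists>i\<le>d b. \<bar>v (b, i)\<bar> = L)}"

text \<open>The face v is a facet of w: one fixed coordinate of v becomes a direction, on the side
  s.\<close>

definition step :: "'b grid \<Rightarrow> 'b grid \<Rightarrow> bool" where
  "step v w \<longleftrightarrow> (\<exists>p\<in>idx. \<exists>s\<in>{1, -1}. even (v p) \<and> w = v(p := v p + s))"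

definition flag :: "'b grid list \<Rightarrow> bool" where
  "flag fs \<longleftrightarrow> length fs = Suc N \<and> set fs \<subseteq> V \<and> (\<forall>k<N. step (fs ! k) (fs ! Suc k)) \<and>
     (\<forall>p. even ((fs ! 0) p))"

definition lead :: "'b grid \<Rightarrow> 'b \<Rightarrow> nat" where
  "lead v b = (LEAST i. v (b, i) \<noteq> 0)"

text \<open>The element of G that makes the leading coordinate of v positive in every block. It is a
  G-valued equivariant function, so \<open>\<kappa> v = 0\<close> selects a fundamental domain and
  its coordinates are cochains for the basic characters.\<close>

definition \<kappa> :: "'b grid \<Rightarrow> 'b \<times> nat \<Rightarrow> bit" where
  "\<kappa> v = (THE \<gamma>. \<gamma> \<in> G \<and> (\<forall>b. \<gamma> (b, lead v b) = of_bool (v (b, lead v b) < 0)))"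

lemma card_idx: "card idx = N + CARD('b)"
proof -
  have "idx = (SIGMA b:UNIV. {..d b})" by (auto simp: block_idx_def)
  then have "card idx = (\<Sum>b\<in>UNIV. Suc (d b))" by simp
  also have "\<dots> = N + CARD('b)"
    by (simp add: N_def sum.distrib Suc_eq_plus1 del: add_Suc_right One_nat_def)
  finally show ?thesis .
qed

lemma V_out: "v \<in> V \<Longrightarrow> p \<notin> idx \<Longrightarrow> v p = 0"
  and V_bound: "v \<in> V \<Longrightarrow> \<bar>v p\<bar> \<le> L"
  and V_max: "v \<in> V \<Longrightarrow> \<exists>i\<le>d b. \<bar>v (b, i)\<bar> = L"
  unfolding V_def by blast+

lemma stepE:
  assumes "step v w"
  obtains p s where "p \<in> idx" "s \<in> {1, -1}" "even (v p)" "w = v(p := v p + s)"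
  using assms unfolding step_def by blast

lemma finite_V: "finite V"
proof (rule finite_subset)
  show "V \<subseteq> {v. \<forall>p. (p \<in> idx \<longrightarrow> v p \<in> {-L..L}) \<and> (p \<notin> idx \<longrightarrow> v p = 0)}"
  proof (intro subsetI CollectI conjI ballI allI impI)
    fix v p assume "v \<in> V" 
    then have "\<bar>v p\<bar> \<le> L" by (rule V_bound)
    then show "v p \<in> {-L..L}" by (simp add: abs_le_iff)
  qed (simp add: V_out)
  show "finite \<dots>"
    by (intro finite_set_of_finite_funs finite_block_idx) auto
qed

lemma finite_flags: "finite {fs. flag fs}"
proof (rule finite_subset)
  show "{fs. flag fs} \<subseteq> {fs. set fs \<subseteq> V \<and> length fs = Suc N}" by (auto simp: flag_def)
qed (rule finite_lists_length_eq[OF finite_V])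

lemma lead_le: "v \<in> V \<Longrightarrow> lead v b \<le> d b"
  and lead_nz: "v \<in> V \<Longrightarrow> v (b, lead v b) \<noteq> 0"
  and lead_less: "i < lead v b \<Longrightarrow> v (b, i) = 0"
proof -
  show "lead v b \<le> d b" "v (b, lead v b) \<noteq> 0" if v: "v \<in> V"
  proof -
    obtain i where i: "i \<le> d b" "\<bar>v (b, i)\<bar> = L" using V_max[OF v] by blast
    then have nz: "v (b, i) \<noteq> 0" using L by auto
    show "lead v b \<le> d b"
      unfolding lead_def using i nz by (meson Least_le order_trans)
    show "v (b, lead v b) \<noteq> 0" unfolding lead_def by (rule LeastI[of _ i]) (rule nz)
  qed
  show "i < lead v b \<Longrightarrow> v (b, i) = 0"
    unfolding lead_def using not_less_Least by blast
qed

lemma lead_eqI: "v (b, i) \<noteq> 0 \<Longrightarrow> (\<And>k. k < i \<Longrightarrow> v (b, k) = 0) \<Longrightarrow> lead v b = i"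
  unfolding lead_def by (rule Least_equality) (metis not_less)+

lemma \<kappa>: assumes "v \<in> V" shows "\<kappa> v \<in> G" "\<kappa> v (b, lead v b) = of_bool (v (b, lead v b) < 0)"
  using theI'[OF K_dual[of "lead v" "\<lambda>b. of_bool (v (b, lead v b) < 0)", OF lead_le[OF assms]]]
  unfolding \<kappa>_def by auto

lemma act_in_V: "v \<in> V \<Longrightarrow> act \<gamma> v \<in> V"
  by (auto simp: V_def)

lemma lead_act [simp]: "lead (act \<gamma> v) = lead v"
  by (simp add: lead_def fun_eq_iff)

lemma \<kappa>_act:
  assumes "v \<in> V" "\<gamma> \<in> G"
  shows "\<kappa> (act \<gamma> v) = (\<lambda>p. \<kappa> v p + \<gamma> p)"
proof (rule K_eqI[of _ _ "lead v"])
  show "\<kappa> (act \<gamma> v) (b, lead v b) = \<kappa> v (b, lead v b) + \<gamma> (b, lead v b)" for b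
  proof -
    have "\<kappa> (act \<gamma> v) (b, lead v b) = of_bool (act \<gamma> v (b, lead v b) < 0)"
      using \<kappa>(2)[OF act_in_V[OF assms(1)], of \<gamma> b] by simp
    moreover have "\<kappa> v (b, lead v b) = of_bool (v (b, lead v b) < 0)"
      using \<kappa>(2)[OF assms(1)] .
    ultimately show ?thesis using lead_nz[OF assms(1), of b]
      by (cases "\<gamma> (b, lead v b)") (auto simp: act_def[abs_def])
  qed
qed (use assms \<kappa> act_in_V K_add lead_le in auto)

lemma act_free:
  assumes "v \<in> V" "\<gamma> \<in> G" "act \<gamma> v = v"
  shows "\<gamma> = (\<lambda>p. 0)"
proof -
  have "\<kappa> v p = \<kappa> v p + \<gamma> p" for p :: "'b \<times> nat" using \<kappa>_act[OF assms(1,2)] assms(3) by (metis (no_types))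
  then show ?thesis by (auto simp: fun_eq_iff)
qed

lemma step_act: "step v w \<Longrightarrow> step (act \<gamma> v) (act \<gamma> w)"
proof -
  assume "step v w"
  then obtain p s where *: "p \<in> idx" "s \<in> {1,-1}" "even (v p)" "w = v(p := v p + s)"
    by (rule stepE)
  have "act \<gamma> w = (act \<gamma> v)(p := act \<gamma> v p + (if \<gamma> p = 1 then - s else s))"
    by (auto simp: act_def *)
  then show ?thesis using * unfolding step_def
    by (intro bexI[of _ p] bexI[of _ "if \<gamma> p = 1 then - s else s"]) auto
qed

lemma flag_map_act: "flag fs \<Longrightarrow> flag (map (act \<gamma>) fs)"
  by (auto simp: flag_def step_act act_in_V subset_iff)

lemma flag_nth: "flag fs \<Longrightarrow> k \<le> N \<Longrightarrow> fs ! k \<in> V"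
  by (auto simp: flag_def subset_iff)

text \<open>Parity does all the work: the coordinate that changes is odd in w, hence not the one of
  modulus L that places w in the boundary, and being even in x it cannot have modulus L + 1.\<close>

lemma step_down:
  assumes "step x w" "w \<in> V"
  shows "x \<in> V"
proof -
  obtain p s where *: "p \<in> idx" "s \<in> {1,-1}" "even (x p)" "w = x(p := x p + s)"
    using assms(1) by (rule stepE)
  have "\<bar>w p\<bar> \<le> L" using assms(2) by (rule V_bound)
  then have "\<bar>x p\<bar> \<le> L + 1" using * by auto
  moreover have "\<bar>x p\<bar> \<noteq> L + 1"
  proof
    assume "\<bar>x p\<bar> = L + 1"
    moreover have "even \<bar>x p\<bar>" using * by simp
    ultimately show False using L by simp
  qed
  ultimately have p: "\<bar>x p\<bar> \<le> L" by linarith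
  have "odd (w p)" using * by auto
  then have wp: "\<bar>w p\<bar> \<noteq> L" using L by auto
  have eq: "x q = w q" if "q \<noteq> p" for q using * that by simp
  show ?thesis
    unfolding V_def
  proof (intro CollectI conjI allI impI)
    show "q \<notin> idx \<Longrightarrow> x q = 0" for q using eq[of q] *(1) V_out[OF assms(2), of q] by (cases "q = p") auto
    show "\<bar>x q\<bar> \<le> L" for q using p eq[of q] V_bound[OF assms(2)] by (cases "q = p") auto
    show "\<exists>i\<le>d b. \<bar>x (b, i)\<bar> = L" for b using V_max[OF assms(2), of b] wp eq by metis
  qed
qed

lemma flag_update_iff:
  assumes f: "flag fs" and k: "k \<le> N"
  shows "flag (fs[k := x]) \<longleftrightarrow> x \<in> V \<and> (0 < k \<longrightarrow> step (fs ! (k - 1)) x) \<and>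
    (k < N \<longrightarrow> step x (fs ! Suc k)) \<and> (k = 0 \<longrightarrow> (\<forall>p. even (x p)))"
proof -
  have len: "length fs = Suc N" using f by (simp add: flag_def)
  have "set (fs[k := x]) \<subseteq> V \<longleftrightarrow> x \<in> V"
  proof
    show "x \<in> V" if "set (fs[k := x]) \<subseteq> V"
      using that set_update_memI[of k fs x] k len by auto
    show "set (fs[k := x]) \<subseteq> V" if "x \<in> V"
      using that set_update_subset_insert[of fs k x] f by (auto simp: flag_def)
  qed
  moreover have "(\<forall>l<N. step (fs[k:=x] ! l) (fs[k:=x] ! Suc l)) \<longleftrightarrow>
    (0 < k \<longrightarrow> step (fs ! (k - 1)) x) \<and> (k < N \<longrightarrow> step x (fs ! Suc k))" (is "?l = ?r")
  proof
    assume l: ?l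
    show ?r
    proof (intro conjI impI)
      assume "0 < k"
      then obtain m where "k = Suc m" by (cases k) auto
      then show "step (fs ! (k - 1)) x" using l[rule_format, of m] k len by simp
    next
      assume "k < N"
      then show "step x (fs ! Suc k)" using l[rule_format, of k] len by simp
    qed
  next
    assume r: ?r
    have fl: "step (fs ! l) (fs ! Suc l)" if "l < N" for l using f that by (auto simp: flag_def)
    show ?l
    proof (intro allI impI)
      fix l assume l: "l < N"
      show "step (fs[k := x] ! l) (fs[k := x] ! Suc l)"
      proof (cases "Suc l = k")
        case True
        then have "l = k - 1" "0 < k" by auto
        then show ?thesis using r len l True by simp
      next
        case False
        then show ?thesis using r len l k fl by (cases "l = k") auto
      qed
    qed
  qed
  moreover have "(\<forall>p. even ((fs[k := x] ! 0) p)) \<longleftrightarrow> (k = 0 \<longrightarrow> (\<forall>p. even (x p)))"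
    using f len k by (auto simp: flag_def nth_list_update)
  ultimately show ?thesis using len unfolding flag_def by simp
qed

section \<open>Exchanging one vertex of a flag\<close>

definition odds :: "'b grid \<Rightarrow> ('b \<times> nat) set" where
  "odds v = {p \<in> idx. odd (v p)}"

lemma step_iff:
  "step v w \<longleftrightarrow> (\<exists>p\<in>idx. even (v p) \<and> (w = v(p := v p + 1) \<or> w = v(p := v p - 1)))"
  by (auto simp: step_def)

lemma card_odds_step: assumes "step v w" shows "card (odds w) = Suc (card (odds v))"
proof -
  obtain p where *: "p \<in> idx" "even (v p)" "w = v(p := v p + 1) \<or> w = v(p := v p - 1)"
    using assms unfolding step_iff by blast
  then have "odds w = insert p (odds v)" by (auto simp: odds_def split: if_splits)
  moreover have "p \<notin> odds v" "finite (odds v)" using * finite_block_idx by (auto simp: odds_def)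
  ultimately show ?thesis by simp
qed

lemma card_odds: "flag fs \<Longrightarrow> k \<le> N \<Longrightarrow> card (odds (fs ! k)) = k"
proof (induction k)
  case 0
  then have "odds (fs ! 0) = {}" by (auto simp: odds_def flag_def)
  then show ?case by simp
next
  case (Suc k)
  then show ?case using card_odds_step[of "fs ! k" "fs ! Suc k"] by (auto simp: flag_def)
qed

lemma V_updI:
  assumes "u \<in> V" "q \<in> idx" "\<bar>c\<bar> \<le> L" "\<And>b. \<exists>i\<le>d b. (b, i) \<noteq> q \<and> \<bar>u (b, i)\<bar> = L"
  shows "u(q := c) \<in> V"
  unfolding V_def
proof (intro CollectI conjI allI impI)
  show "p \<notin> idx \<Longrightarrow> (u(q := c)) p = 0" for p using assms(2) V_out[OF assms(1)] by auto
  show "\<bar>(u(q := c)) p\<bar> \<le> L" for p using assms(3) V_bound[OF assms(1), of p] by auto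
  show "\<exists>i\<le>d b. \<bar>(u(q := c)) (b, i)\<bar> = L" for b using assms(4)[of b] by auto
qed

text \<open>An edge of the cube complex has two ends, on the two sides of its midpoint w.\<close>

lemma thin_first:
  assumes "step v w" "w \<in> V" "\<And>p. even (v p)"
  shows "\<exists>!x. x \<noteq> v \<and> x \<in> V \<and> step x w \<and> (\<forall>p. even (x p))"
proof -
  obtain p s where *: "p \<in> idx" "s \<in> {1, -1}" "even (v p)" "w = v(p := v p + s)"
    using assms(1) by (rule stepE)
  show ?thesis
  proof (rule ex1I[of _ "w(p := w p + s)"])
    have "step (w(p := w p + s)) w"
      unfolding step_def using * by (intro bexI[of _ p] bexI[of _ "-s"]) (auto simp: fun_eq_iff)
    moreover have "w(p := w p + s) \<noteq> v" using * by (auto simp: fun_eq_iff intro!: exI[of _ p])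
    moreover have "even ((w(p := w p + s)) q)" for q using * assms(3)[of q] by auto
    ultimately show "w(p := w p + s) \<noteq> v \<and> w(p := w p + s) \<in> V \<and> step (w(p := w p + s)) w \<and>
        (\<forall>q. even ((w(p := w p + s)) q))"
      using step_down assms(2) by blast
  next
    fix x assume x: "x \<noteq> v \<and> x \<in> V \<and> step x w \<and> (\<forall>p. even (x p))"
    then obtain q t where q: "q \<in> idx" "t \<in> {1, -1}" "even (x q)" "w = x(q := x q + t)"
      using stepE by metis
    have "odd (w q)" using q by auto
    then have qp: "q = p" using * assms(3)[of q] by (auto split: if_splits)
    have xw: "x = w(p := w p - t)" using q qp by (auto simp: fun_eq_iff)
    have "v = w(p := w p - s)" using * by (auto simp: fun_eq_iff)
    then have "t = - s" using xw x * q by auto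
    then show "x = w(p := w p + s)" using xw by simp
  qed
qed

text \<open>From u to w two directions are opened, and this can be done in either order.\<close>

lemma thin_middle:
  assumes "step u v" "step v w" "w \<in> V"
  shows "\<exists>!x. x \<noteq> v \<and> x \<in> V \<and> step u x \<and> step x w"
proof -
  obtain p s where p: "p \<in> idx" "s \<in> {1, -1}" "even (u p)" "v = u(p := u p + s)"
    using assms(1) by (rule stepE)
  obtain p' s' where p': "p' \<in> idx" "s' \<in> {1, -1}" "even (v p')" "w = v(p' := v p' + s')"
    using assms(2) by (rule stepE)
  have "odd (v p)" using p by auto
  then have ne: "p \<noteq> p'" using p' by auto
  have w: "w = u(p := u p + s, p' := u p' + s')" using p p' ne by (auto simp: fun_eq_iff)
  have evp': "even (u p')" using p p' ne by auto
  define y where "y = u(p' := u p' + s')"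
  show ?thesis
  proof (rule ex1I[of _ y])
    have "step u y" unfolding step_def y_def using p' evp' by blast
    moreover have "step y w" unfolding step_def
      using p ne w by (intro bexI[of _ p] bexI[of _ s]) (auto simp: y_def fun_eq_iff)
    moreover have "y \<noteq> v" using p p' ne by (auto simp: y_def fun_eq_iff intro!: exI[of _ p])
    ultimately show "y \<noteq> v \<and> y \<in> V \<and> step u y \<and> step y w" using step_down assms(3) by blast
  next
    fix x assume x: "x \<noteq> v \<and> x \<in> V \<and> step u x \<and> step x w"
    obtain q t where q: "q \<in> idx" "t \<in> {1, -1}" "even (u q)" "x = u(q := u q + t)"
      using x stepE by metis
    obtain q' t' where q': "q' \<in> idx" "t' \<in> {1, -1}" "even (x q')" "w = x(q' := x q' + t')"
      using x stepE by metis
    have "odd (x q)" using q by auto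
    then have neq: "q \<noteq> q'" using q' by auto
    have wq: "w q = u q + t" using q q' neq by auto
    moreover have "t \<noteq> 0" using q by auto
    ultimately have "q = p \<or> q = p'" using w by (auto split: if_splits)
    moreover have "q \<noteq> p"
    proof
      assume "q = p"
      moreover then have "t = s" using wq w ne by auto
      ultimately show False using x q p by auto
    qed
    ultimately have "q = p'" by auto
    moreover then have "t = s'" using wq w by auto
    ultimately show "x = y" using q by (simp add: y_def)
  qed
qed

text \<open>A ridge u lies in two top cells. If it is interior to a side of its cube, they lie on
  both sides of it in the same direction; if it lies on a corner where two sides of block
  \<open>b0\<close> meet, the second cell continues around the corner.\<close>

lemma thin_last:
  assumes u: "step u w" and wV: "w \<in> V" and card: "card (odds w) = N"
  shows "\<exists>!x. x \<noteq> w \<and> x \<in> V \<and> step u x"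
proof -
  obtain b0 i0 s where p: "(b0, i0) \<in> idx" "s \<in> {1, -1}" "even (u (b0, i0))"
      and w: "w = u((b0, i0) := u (b0, i0) + s)"
    using u by (metis stepE surj_pair)
  have uV: "u \<in> V" using u wV by (rule step_down)
  have "\<forall>b. \<exists>i. i \<le> d b \<and> \<bar>w (b, i)\<bar> = L" using V_max[OF wV] by blast
  then obtain e where e: "\<And>b. e b \<le> d b" "\<And>b. \<bar>w (b, e b)\<bar> = L" by metis
  have evL: "even (x q)" if "\<bar>x q\<bar> = L" for x :: "'b grid" and q
    using that L by (metis dvd_abs_iff)
  \<comment> \<open>A top cell has N odd coordinates, which leaves one even coordinate per block; it
    must be the coordinate \<open>e b\<close> of modulus L.\<close>
  define E where "E = idx - odds w"
  have "card E = CARD('b)"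
    unfolding E_def using card card_idx finite_block_idx
    by (subst card_Diff_subset) (auto simp: odds_def intro: finite_subset)
  moreover have "(\<lambda>b. (b, e b)) ` UNIV \<subseteq> E" using e evL[of w] by (auto simp: E_def odds_def block_idx_def)
  moreover have "card ((\<lambda>b. (b, e b)) ` UNIV) = CARD('b)" by (intro card_image) (auto simp: inj_on_def)
  moreover have "finite E" using finite_block_idx by (simp add: E_def)
  ultimately have E: "(\<lambda>b. (b, e b)) ` UNIV = E" by (metis card_subset_eq)
  have eq_e: "i = e b" if "i \<le> d b" "even (w (b, i))" for b i
  proof -
    have "(b, i) \<in> E" using that by (simp add: E_def odds_def block_idx_def)
    then show ?thesis using E by auto
  qed
  have "odd (w (b0, i0))" using p w by auto
  then have ne: "i0 \<noteq> e b0" using e(2)[of b0] evL[of w] by auto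
  have ue: "\<bar>u (b, e b)\<bar> = L" for b using e(2)[of b] w ne by (auto split: if_splits)
  \<comment> \<open>At a corner the coordinate \<open>e b0\<close> is opened instead, inwards;
    otherwise the same coordinate is opened on the other side.\<close>
  define y where "y = (if \<bar>u (b0, i0)\<bar> = L then u((b0, e b0) := u (b0, e b0) - sgn (u (b0, e b0)))
     else u((b0, i0) := u (b0, i0) - s))"
  show ?thesis
  proof (rule ex1I[of _ y])
    have "y \<noteq> w \<and> y \<in> V \<and> step u y"
    proof (cases "\<bar>u (b0, i0)\<bar> = L")
      case True
      have "y \<noteq> w" using p w ne True by (auto simp: y_def fun_eq_iff intro!: exI[of _ "(b0, i0)"])
      moreover have "y \<in> V"
        unfolding y_def if_P[OF True]
      proof (rule V_updI[OF uV])
        show "(b0, e b0) \<in> idx" using e by (simp add: block_idx_def)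
        show "\<bar>u (b0, e b0) - sgn (u (b0, e b0))\<bar> \<le> L"
          using ue[of b0] L by (auto simp: sgn_if)
        show "\<exists>i\<le>d b. (b, i) \<noteq> (b0, e b0) \<and> \<bar>u (b, i)\<bar> = L" for b
        proof (cases "b = b0")
          case True
          then show ?thesis using \<open>\<bar>u (b0, i0)\<bar> = L\<close> p ne by (intro exI[of _ i0]) (auto simp: block_idx_def)
        qed (use ue e in auto)
      qed
      moreover have "step u y"
        unfolding step_def y_def using True e ue[of b0] L evL[of u]
        by (intro bexI[of _ "(b0, e b0)"] bexI[of _ "- sgn (u (b0, e b0))"]) (auto simp: sgn_if block_idx_def)
      ultimately show ?thesis by simp
    next
      case False
      have "y \<noteq> w" using p w False by (auto simp: y_def fun_eq_iff intro!: exI[of _ "(b0, i0)"])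
      moreover have "y \<in> V"
        unfolding y_def if_not_P[OF False]
      proof (rule V_updI[OF uV p(1)])
        show "\<bar>u (b0, i0) - s\<bar> \<le> L"
          using V_bound[OF uV, of "(b0, i0)"] False p by auto
        show "\<exists>i\<le>d b. (b, i) \<noteq> (b0, i0) \<and> \<bar>u (b, i)\<bar> = L" for b
          using ue e ne by (intro exI[of _ "e b"]) auto
      qed
      moreover have "step u y"
        unfolding step_def y_def using False p
        by (intro bexI[of _ "(b0, i0)"] bexI[of _ "- s"]) auto
      ultimately show ?thesis by simp
    qed
    then show "y \<noteq> w \<and> y \<in> V \<and> step u y" .
  next
    fix x assume x: "x \<noteq> w \<and> x \<in> V \<and> step u x"
    obtain b i t where q: "(b, i) \<in> idx" "t \<in> {1, -1}" "even (u (b, i))"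
        and xu: "x = u((b, i) := u (b, i) + t)"
      using x by (metis stepE surj_pair)
    have xb: "\<bar>u (b, i) + t\<bar> \<le> L" using V_bound[of x "(b, i)"] x xu by auto
    obtain k where k: "k \<le> d b" "\<bar>x (b, k)\<bar> = L" using V_max[of x b] x by blast
    have "odd (x (b, i))" using q xu by auto
    then have ki: "k \<noteq> i" using evL[of x, OF k(2)] by auto
    then have uk: "\<bar>u (b, k)\<bar> = L" using k xu by auto
    show "x = y"
    proof (cases "(b, i) = (b0, i0)")
      case True
      then have "t = - s" using x xu w q p by auto
      then show ?thesis
        using True xu xb V_bound[OF wV, of "(b0, i0)"] w p by (auto simp: y_def abs_if split: if_splits)
    next
      case False
      then have "even (w (b, i))" using q w by auto
      then have i: "i = e b" using eq_e q by (simp add: block_idx_def)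
      have bk: "(b, k) = (b0, i0)"
      proof (rule ccontr)
        assume "(b, k) \<noteq> (b0, i0)"
        then have "even (w (b, k))" using w evL[of u, OF uk] by auto
        then show False using eq_e k i ki by auto
      qed
      then have "t = - sgn (u (b0, e b0))"
        using xb ue[of b0] i q L by (auto simp: sgn_if abs_if split: if_splits)
      then show ?thesis using xu i bk uk by (auto simp: y_def)
    qed
  qed
qed

lemma thin:
  assumes f: "flag fs" and k: "k \<le> N" and N: "0 < N"
  shows "\<exists>!x. x \<noteq> fs ! k \<and> flag (fs[k := x])"
proof -
  have st: "step (fs ! l) (fs ! Suc l)" if "l < N" for l using f that by (simp add: flag_def)
  consider "k = 0" | "0 < k" "k < N" | "k = N" using k by linarith
  then show ?thesis
  proof cases
    case 1
    then show ?thesis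
      using thin_first[OF st[of 0] flag_nth[OF f]] f N unfolding flag_update_iff[OF f k]
      by (auto simp: flag_def)
  next
    case 2
    then have "step (fs ! (k - 1)) (fs ! k)" using st[of "k - 1"] by simp
    then show ?thesis
      using thin_middle[OF _ st[of k] flag_nth[OF f]] 2 unfolding flag_update_iff[OF f k] by auto
  next
    case 3
    then have "step (fs ! (k - 1)) (fs ! k)" using st[of "k - 1"] N by simp
    then show ?thesis
      using thin_last[OF _ flag_nth[OF f]] 3 N card_odds[OF f] unfolding flag_update_iff[OF f k] by auto
  qed
qed

section \<open>The cup product pairing\<close>

text \<open>One flag from each G-orbit, as \<open>\<kappa>\<close> is equivariant and G acts freely
  on first vertices.\<close>

definition flags0 :: "'b grid list set" where
  "flags0 = {fs. flag fs \<and> \<kappa> (fs ! 0) = (\<lambda>p. 0)}"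

lemma finite_flags0: "finite flags0"
  by (rule finite_subset[OF _ finite_flags]) (auto simp: flags0_def)

text \<open>The cup product of the coboundaries of the \<open>c i\<close>, evaluated on the
  fundamental cycle modulo 2 of the quotient by G. For equivariant \<open>c i\<close> the summand
  does not depend on the flag chosen in its orbit.\<close>

definition cup :: "(nat \<Rightarrow> 'b grid \<Rightarrow> bit) \<Rightarrow> bit" where
  "cup c = (\<Sum>fs\<in>flags0. \<Prod>i<N. c i (fs ! i) + c i (fs ! Suc i))"

definition equivariant :: "(('b \<times> nat \<Rightarrow> bit) \<Rightarrow> bit) \<Rightarrow> ('b grid \<Rightarrow> bit) \<Rightarrow> bool" where
  "equivariant \<xi> c \<longleftrightarrow> (\<forall>\<gamma>\<in>G. \<forall>v\<in>V. c (act \<gamma> v) = c v + \<xi> \<gamma>)"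

lemma act_list_free:
  assumes "flag fs" "\<gamma> \<in> G" "l \<le> N" "map (act \<gamma>) fs ! l = fs ! l"
  shows "\<gamma> = (\<lambda>p. 0)"
  using act_free[OF flag_nth[OF assms(1,3)] assms(2)] assms(1,3,4) by (simp add: flag_def)

text \<open>Every flag missing one vertex has exactly two completions, also modulo \<open>G\<close>.\<close>

lemma sum_flags0_eq_0:
  fixes h :: "'b grid list \<Rightarrow> bit"
  assumes N: "0 < N" and k: "k \<le> N"
    and h_act: "\<And>fs \<gamma>. flag fs \<Longrightarrow> \<gamma> \<in> G \<Longrightarrow> h (map (act \<gamma>) fs) = h fs"
    and h_upd: "\<And>fs x. flag fs \<Longrightarrow> flag (fs[k := x]) \<Longrightarrow> h (fs[k := x]) = h fs"
  shows "(\<Sum>fs\<in>flags0. h fs) = 0"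
proof -
  \<comment> \<open>\<open>\<sigma>\<close> exchanges vertex k and may leave \<open>flags0\<close>;
    \<open>\<nu>\<close> translates the result back. Their composition is the involution that pairs
    off the terms.\<close>
  define \<sigma> where "\<sigma> fs = fs[k := (THE x. x \<noteq> fs ! k \<and> flag (fs[k := x]))]" for fs
  define \<nu> where "\<nu> fs = map (act (\<kappa> (fs ! 0))) fs" for fs :: "'b grid list"
  have len: "length fs = Suc N" if "flag fs" for fs using that by (simp add: flag_def)
  have \<sigma>: "flag (\<sigma> fs)" "\<sigma> fs \<noteq> fs" and \<sigma>x: "\<exists>x. x \<noteq> fs ! k \<and> \<sigma> fs = fs[k := x]" if "flag fs" for fs
  proof -
    have *: "(THE x. x \<noteq> fs ! k \<and> flag (fs[k := x])) \<noteq> fs ! k \<and>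
          flag (fs[k := (THE x. x \<noteq> fs ! k \<and> flag (fs[k := x]))])"
      by (rule theI'[OF thin[OF that k N]])
    then show "flag (\<sigma> fs)" "\<exists>x. x \<noteq> fs ! k \<and> \<sigma> fs = fs[k := x]" by (auto simp: \<sigma>_def)
    then have "\<sigma> fs ! k \<noteq> fs ! k" using len[OF that] k by auto
    then show "\<sigma> fs \<noteq> fs" by auto
  qed
  have \<sigma>_eqI: "\<sigma> fs = fs[k := x]" if "flag fs" "x \<noteq> fs ! k" "flag (fs[k := x])" for fs x
    using the1_equality[OF thin[OF that(1) k N], of x] that by (simp add: \<sigma>_def)
  have \<sigma>\<sigma>: "\<sigma> (\<sigma> fs) = fs" if "flag fs" for fs
  proof -
    from \<sigma>x[OF that] obtain x where x: "x \<noteq> fs ! k" "\<sigma> fs = fs[k := x]" by blast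
    have "\<sigma> (fs[k := x]) = fs[k := x, k := fs ! k]"
      using x \<sigma>(1)[OF that] that len[OF that] k by (intro \<sigma>_eqI) auto
    then show ?thesis using x by simp
  qed
  have \<sigma>_act: "\<sigma> (map (act \<gamma>) fs) = map (act \<gamma>) (\<sigma> fs)" if "flag fs" for fs \<gamma>
  proof -
    from \<sigma>x[OF that] obtain x where x: "x \<noteq> fs ! k" "\<sigma> fs = fs[k := x]" by blast
    have "act \<gamma> x \<noteq> act \<gamma> (fs ! k)" using x by (metis act_involutive)
    then have "\<sigma> (map (act \<gamma>) fs) = (map (act \<gamma>) fs)[k := act \<gamma> x]"
      using x flag_map_act[OF \<sigma>(1)[OF that], of \<gamma>] flag_map_act[OF that, of \<gamma>] len[OF that] k
      by (intro \<sigma>_eqI) (auto simp: map_update)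
    then show ?thesis using x by (simp add: map_update)
  qed
  have hd: "fs ! 0 \<in> V" if "flag fs" for fs using flag_nth[OF that] by simp
  have \<nu>: "\<nu> fs \<in> flags0" if "flag fs" for fs
    using flag_map_act[OF that] \<kappa>_act[OF hd[OF that] \<kappa>(1)[OF hd[OF that]]] len[OF that]
    by (simp add: flags0_def \<nu>_def)
  show ?thesis
  proof (rule sum_fixpoint_free_involution[OF finite_flags0, of "\<lambda>fs. \<nu> (\<sigma> fs)"])
    fix fs assume "fs \<in> flags0"
    then have f: "flag fs" and \<kappa>0: "\<kappa> (fs ! 0) = (\<lambda>p. 0)" by (auto simp: flags0_def)
    define \<gamma> where "\<gamma> = \<kappa> (\<sigma> fs ! 0)"
    have \<gamma>: "\<gamma> \<in> G" unfolding \<gamma>_def using \<kappa>(1) hd \<sigma>(1) f by blast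
    have \<nu>\<sigma>: "\<nu> (\<sigma> fs) = map (act \<gamma>) (\<sigma> fs)" by (simp add: \<nu>_def \<gamma>_def)
    have "\<nu> (\<sigma> (\<nu> (\<sigma> fs))) = \<nu> (map (act \<gamma>) fs)"
      by (simp add: \<nu>\<sigma> \<sigma>_act[OF \<sigma>(1)[OF f]] \<sigma>\<sigma>[OF f])
    also have "\<dots> = fs"
    proof -
      have "\<kappa> (map (act \<gamma>) fs ! 0) = \<gamma>" using \<kappa>_act[OF hd[OF f] \<gamma>] \<kappa>0 len[OF f] by simp
      then show ?thesis by (simp add: \<nu>_def map_idI)
    qed
    finally have 1: "\<nu> (\<sigma> (\<nu> (\<sigma> fs))) = fs" .
    have 2: "\<nu> (\<sigma> fs) \<noteq> fs"
    proof
      assume eq: "\<nu> (\<sigma> fs) = fs"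
      obtain x where x: "x \<noteq> fs ! k" "\<sigma> fs = fs[k := x]" using \<sigma>x[OF f] by blast
      \<comment> \<open>A position that \<open>\<sigma>\<close> leaves alone. A flag fixed by the
        involution would have this vertex fixed by \<open>\<gamma>\<close>, so
        \<open>\<gamma>\<close> would be trivial by freeness and \<open>\<sigma>\<close> would fix
        the flag.\<close>
      define l where "l = (if k = 0 then 1 else 0 :: nat)"
      have l: "l \<le> N" "l \<noteq> k" using N by (auto simp: l_def)
      have "map (act \<gamma>) fs ! l = map (act \<gamma>) (\<sigma> fs) ! l" using x l len[OF f] by simp
      also have "\<dots> = fs ! l" using eq \<nu>\<sigma> by simp
      finally have "\<gamma> = (\<lambda>p. 0)" by (rule act_list_free[OF f \<gamma> l(1)])
      then have "\<sigma> fs = fs" using eq \<nu>\<sigma> by (simp add: map_idI)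
      then show False using \<sigma>(2)[OF f] by simp
    qed
    have "h (\<nu> (\<sigma> fs)) = h (\<sigma> fs)" unfolding \<nu>\<sigma> by (rule h_act[OF \<sigma>(1)[OF f] \<gamma>])
    also have "\<dots> = h fs" using h_upd[OF f] \<sigma>(1)[OF f] \<sigma>x[OF f] by metis
    finally show "\<nu> (\<sigma> fs) \<in> flags0 \<and> \<nu> (\<sigma> (\<nu> (\<sigma> fs))) = fs \<and> \<nu> (\<sigma> fs) \<noteq> fs \<and> h (\<nu> (\<sigma> fs)) = h fs"
      using 1 2 \<nu>[OF \<sigma>(1)[OF f]] by simp
  qed
qed

lemma equivariant_diff_act:
  assumes "equivariant \<xi> c" "\<gamma> \<in> G" "v \<in> V" "w \<in> V"
  shows "c (act \<gamma> v) + c (act \<gamma> w) = c v + c w"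
  using assms unfolding equivariant_def by (cases "\<xi> \<gamma>") (auto simp: algebra_simps)

text \<open>The difference \<open>d\<close> of two functions with the same character is invariant,
  hence a 0-cochain on the quotient. So the two cup products differ by a coboundary, and a
  coboundary sums to 0 over a closed pseudomanifold, face number by face number.\<close>

lemma cup_update:
  assumes N: "0 < N" and i: "i < N"
    and c: "\<And>l. l < N \<Longrightarrow> equivariant (\<xi> l) (c l)" and e: "equivariant (\<xi> i) e"
  shows "cup (c(i := e)) = cup c"
proof -
  define d where "d v = c i v + e v" for v
  have d: "d (act \<gamma> v) = d v" if "\<gamma> \<in> G" "v \<in> V" for \<gamma> v
    using c[OF i] e that unfolding equivariant_def d_def by (simp add: algebra_simps)
  define U where "U k fs = (\<Prod>l<i. c l (fs ! skip k l) + c l (fs ! skip k (Suc l))) * d (fs ! skip k i) *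
      (\<Prod>l=i..<N - 1. c (Suc l) (fs ! skip k l) + c (Suc l) (fs ! skip k (Suc l)))"
    for k and fs :: "'b grid list"
  have U0: "(\<Sum>fs\<in>flags0. U k fs) = 0" if k: "k \<le> N" for k
  proof (rule sum_flags0_eq_0[OF N k])
    fix fs \<gamma> assume f: "flag fs" and \<gamma>: "\<gamma> \<in> G"
    have n: "map (act \<gamma>) fs ! l = act \<gamma> (fs ! l)" if "l \<le> N" for l
      using that f by (simp add: flag_def)
    have cc: "c m (map (act \<gamma>) fs ! l) + c m (map (act \<gamma>) fs ! l') = c m (fs ! l) + c m (fs ! l')"
      if "l \<le> N" "l' \<le> N" "m < N" for m l l'
      unfolding n[OF that(1)] n[OF that(2)]
      by (rule equivariant_diff_act[OF c[OF that(3)] \<gamma>]) (use that f flag_nth in auto)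
    have dd: "d (map (act \<gamma>) fs ! l) = d (fs ! l)" if "l \<le> N" for l
      unfolding n[OF that] by (rule d[OF \<gamma>]) (use that f flag_nth in auto)
    show "U k (map (act \<gamma>) fs) = U k fs"
      unfolding U_def
      by (intro arg_cong2[where f="(*)"] prod.cong refl cc dd) (use i in auto)
  next
    fix fs x assume "flag fs"
    have n: "fs[k := x] ! skip k l = fs ! skip k l" for l by simp
    show "U k (fs[k := x]) = U k fs" unfolding U_def n ..
  qed
  have "cup c + cup (c(i := e)) = (\<Sum>fs\<in>flags0. \<Sum>k\<le>N. U k fs)"
    unfolding cup_def sum.distrib[symmetric]
  proof (intro sum.cong refl)
    fix fs :: "'b grid list"
    let ?p = "\<lambda>c :: nat \<Rightarrow> 'b grid \<Rightarrow> bit. \<Prod>i<N. c i (fs ! i) + c i (fs ! Suc i)"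
    have split: "?p c = (\<Prod>l<i. c l (fs ! l) + c l (fs ! Suc l)) * (c i (fs ! i) + c i (fs ! Suc i)) *
        (\<Prod>l=Suc i..<N. c l (fs ! l) + c l (fs ! Suc l))" for c :: "nat \<Rightarrow> 'b grid \<Rightarrow> bit"
    proof -
      let ?f = "\<lambda>l. c l (fs ! l) + c l (fs ! Suc l)"
      have "prod ?f {0..<i} * prod ?f {i..<N} = prod ?f {0..<N}"
        using i by (intro prod.atLeastLessThan_concat) auto
      moreover have "prod ?f {i..<N} = ?f i * prod ?f {Suc i..<N}"
        by (rule prod.atLeast_Suc_lessThan[OF i])
      ultimately show ?thesis by (simp only: lessThan_atLeast0 mult.assoc)
    qed
    have "(\<Sum>k\<le>N. U k fs) = (\<Prod>l<i. c l (fs ! l) + c l (fs ! Suc l)) * (d (fs ! i) + d (fs ! Suc i)) *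
        (\<Prod>l=Suc i..<N. c l (fs ! l) + c l (fs ! Suc l))"
      unfolding U_def using sum_skip_cup_product[OF i, of "\<lambda>l m. c l (fs ! m)" "\<lambda>m. d (fs ! m)"] by simp
    moreover have "?p (c(i := e)) = (\<Prod>l<i. c l (fs ! l) + c l (fs ! Suc l)) * (e (fs ! i) + e (fs ! Suc i)) *
        (\<Prod>l=Suc i..<N. c l (fs ! l) + c l (fs ! Suc l))"
      unfolding split[of "c(i := e)"] by (intro arg_cong2[where f="(*)"] prod.cong refl) auto
    ultimately show "?p c + ?p (c(i := e)) = (\<Sum>k\<le>N. U k fs)"
      unfolding split[of c] by (simp add: d_def algebra_simps)
  qed
  also have "\<dots> = (\<Sum>k\<le>N. \<Sum>fs\<in>flags0. U k fs)" by (rule sum.swap)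
  also have "\<dots> = 0" using U0 by simp
  finally show ?thesis by (simp add: bit_add_eq_0_iff)
qed

theorem cup_cong:
  assumes N: "0 < N"
    and c: "\<And>l. l < N \<Longrightarrow> equivariant (\<xi> l) (c l)" and c': "\<And>l. l < N \<Longrightarrow> equivariant (\<xi> l) (c' l)"
  shows "cup c = cup c'"
proof -
  have "cup (\<lambda>l. if l < j then c' l else c l) = cup c" if "j \<le> N" for j
    using that
  proof (induction j)
    case (Suc j)
    have "(\<lambda>l. if l < Suc j then c' l else c l) = (\<lambda>l. if l < j then c' l else c l)(j := c' j)"
      by (auto simp: fun_eq_iff)
    moreover have "cup ((\<lambda>l. if l < j then c' l else c l)(j := c' j)) = cup (\<lambda>l. if l < j then c' l else c l)"
      using Suc.prems c c' by (intro cup_update[OF N, of _ \<xi>]) auto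
    ultimately show ?case using Suc by simp
  qed simp
  from this[of N] have "cup (\<lambda>l. if l < N then c' l else c l) = cup c" by simp
  moreover have "cup (\<lambda>l. if l < N then c' l else c l) = cup c'"
    unfolding cup_def by (intro sum.cong prod.cong refl) auto
  ultimately show ?thesis by simp
qed

text \<open>The bridge between the two computations: \<open>c\<close> is the family that can be
  evaluated, \<open>c'\<close> the one that vanishes somewhere on every flag.\<close>

corollary cup_eq_0:
  assumes "0 < N" "\<And>l. l < N \<Longrightarrow> equivariant (\<xi> l) (c l)"
    and "\<And>l. l < N \<Longrightarrow> equivariant (\<xi> l) (c' l)"
    and "\<And>fs. flag fs \<Longrightarrow> \<exists>i<N. c' i (fs ! i) = c' i (fs ! Suc i)"
  shows "cup c = 0"
proof -
  have "cup c' = 0"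
    unfolding cup_def
  proof (rule sum.neutral, rule ballI)
    fix fs assume "fs \<in> flags0"
    then obtain i where "i < N" "c' i (fs ! i) = c' i (fs ! Suc i)"
      using assms(4) by (auto simp: flags0_def)
    then show "(\<Prod>i<N. c' i (fs ! i) + c' i (fs ! Suc i)) = 0" by (intro prod_zero bexI[of _ i]) auto
  qed
  then show ?thesis using cup_cong[OF assms(1,2,3)] by simp
qed

end

section \<open>Evaluation on leading signs\<close>

lemma of_nat_eq_1_bit_iff: "of_nat m = (1::bit) \<longleftrightarrow> odd m"
  by (induction m) auto

context cube_spheres
begin

text \<open>The part of the cup product carried by the chains ascending from v, in a form that
  allows induction on the list of factors.\<close>

fun weight :: "('b grid \<Rightarrow> bit) list \<Rightarrow> 'b grid \<Rightarrow> bit" where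
  "weight [] v = 1"
| "weight (c # cs) v = (\<Sum>w | w \<in> V \<and> step v w. (c v + c w) * weight cs w)"

definition paths :: "nat \<Rightarrow> 'b grid \<Rightarrow> 'b grid list set" where
  "paths k v = {fs. length fs = Suc k \<and> fs ! 0 = v \<and> set fs \<subseteq> V \<and> (\<forall>l<k. step (fs ! l) (fs ! Suc l))}"

lemma finite_paths: "finite (paths k v)"
  by (rule finite_subset[OF _ finite_lists_length_eq[OF finite_V, of "Suc k"]]) (auto simp: paths_def)

lemma paths_Suc:
  assumes "v \<in> V"
  shows "paths (Suc k) v = (\<Union>w\<in>{w. w \<in> V \<and> step v w}. (#) v ` paths k w)"
proof (intro equalityI subsetI)
  fix fs assume fs: "fs \<in> paths (Suc k) v"
  then obtain u gs where gs: "fs = u # gs" "length gs = Suc k" by (auto simp: paths_def length_Suc_conv)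
  have "gs ! 0 \<in> V" "step v (gs ! 0)" using fs gs unfolding paths_def by (auto simp: subset_iff)
  moreover have "gs \<in> paths k (gs ! 0)" using fs gs unfolding paths_def by fastforce
  ultimately show "fs \<in> (\<Union>w\<in>{w. w \<in> V \<and> step v w}. (#) v ` paths k w)"
    using fs gs by (auto simp: paths_def)
next
  fix fs assume "fs \<in> (\<Union>w\<in>{w. w \<in> V \<and> step v w}. (#) v ` paths k w)"
  then obtain w gs where *: "w \<in> V" "step v w" "gs \<in> paths k w" "fs = v # gs" by auto
  have "step (fs ! l) (fs ! Suc l)" if "l < Suc k" for l
    using * that by (cases l) (auto simp: paths_def)
  then show "fs \<in> paths (Suc k) v" using * assms by (auto simp: paths_def)
qed

lemma sum_paths:
  assumes "v \<in> V"
  shows "(\<Sum>fs\<in>paths (length cs) v. \<Prod>i<length cs. (cs ! i) (fs ! i) + (cs ! i) (fs ! Suc i)) = weight cs v"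
  using assms
proof (induction cs arbitrary: v)
  case Nil
  have "paths 0 v = {[v]}" using Nil by (auto simp: paths_def length_Suc_conv)
  then show ?case by simp
next
  case (Cons c cs)
  let ?p = "\<lambda>cs fs. \<Prod>i<length cs. (cs ! i) (fs ! i) + (cs ! i) (fs ! Suc i)"
  have fin: "finite {w. w \<in> V \<and> step v w}" using finite_V by simp
  have "(\<Sum>fs\<in>paths (length (c # cs)) v. ?p (c # cs) fs)
      = (\<Sum>w | w \<in> V \<and> step v w. \<Sum>fs\<in>(#) v ` paths (length cs) w. ?p (c # cs) fs)"
    unfolding length_Cons paths_Suc[OF Cons.prems]
    by (rule sum.UNION_disjoint) (use fin finite_paths in \<open>auto simp: paths_def\<close>)
  also have "\<dots> = (\<Sum>w | w \<in> V \<and> step v w. (c v + c w) * weight cs w)"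
  proof (rule sum.cong[OF refl])
    fix w assume w: "w \<in> {w. w \<in> V \<and> step v w}"
    have "(\<Sum>fs\<in>(#) v ` paths (length cs) w. ?p (c # cs) fs) = (\<Sum>fs\<in>paths (length cs) w. ?p (c # cs) (v # fs))"
      by (subst sum.reindex) (auto simp: inj_on_def)
    also have "\<dots> = (\<Sum>fs\<in>paths (length cs) w. (c v + c w) * ?p cs fs)"
    proof (rule sum.cong[OF refl])
      fix fs assume "fs \<in> paths (length cs) w"
      then show "?p (c # cs) (v # fs) = (c v + c w) * ?p cs fs"
        by (simp add: prod.lessThan_Suc_shift paths_def del: prod.lessThan_Suc)
    qed
    also have "\<dots> = (c v + c w) * weight cs w"
      using Cons.IH[of w] w by (simp add: sum_distrib_left[symmetric])
    finally show "(\<Sum>fs\<in>(#) v ` paths (length cs) w. ?p (c # cs) fs) = (c v + c w) * weight cs w" .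
  qed
  finally show ?case by simp
qed

lemma cup_eq_sum_weight:
  assumes cs: "length cs = N"
  shows "cup (\<lambda>i. cs ! i) = (\<Sum>v | v \<in> V \<and> (\<forall>p. even (v p)) \<and> \<kappa> v = (\<lambda>p. 0). weight cs v)"
    (is "_ = sum _ ?S")
proof -
  have fin: "finite ?S" using finite_V by simp
  have "flags0 = (\<Union>v\<in>?S. paths N v)"
  proof (intro equalityI subsetI)
    fix fs assume "fs \<in> flags0"
    then show "fs \<in> (\<Union>v\<in>?S. paths N v)"
      using flag_nth[of fs 0] by (auto simp: flags0_def flag_def paths_def)
  qed (auto simp: flags0_def flag_def paths_def)
  then have "cup (\<lambda>i. cs ! i) = (\<Sum>v\<in>?S. \<Sum>fs\<in>paths N v. \<Prod>i<N. (cs ! i) (fs ! i) + (cs ! i) (fs ! Suc i))"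
    unfolding cup_def by (simp only:) (rule sum.UNION_disjoint, use fin finite_paths in \<open>auto simp: paths_def\<close>)
  also have "\<dots> = sum (weight cs) ?S"
    by (intro sum.cong refl) (use sum_paths[of _ cs, unfolded cs] in blast)
  finally show ?thesis .
qed

text \<open>A step can change \<open>\<kappa>\<close> only by giving a sign to a coordinate in front of the leading one.\<close>

lemma step_lead:
  assumes "step v w" "v \<in> V" "w \<in> V" and ne: "\<kappa> v \<noteq> \<kappa> w"
  obtains b i s where "i < lead v b" "s \<in> {1, -1}" "w = v((b, i) := s)" "lead w = (lead v)(b := i)"
proof -
  obtain b i s where p: "(b, i) \<in> idx" "s \<in> {1, -1}" "even (v (b, i))" "w = v((b, i) := v (b, i) + s)"
    using assms(1) by (metis stepE surj_pair)
  have "odd (w (b, i))" using p by auto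
  then have wnz: "w (b, i) \<noteq> 0" by auto
  have other: "lead w b' = lead v b'" if "b' \<noteq> b" for b'
    using p that by (simp add: lead_def)
  have "i < lead v b"
  proof (rule ccontr)
    assume i: "\<not> i < lead v b"
    have "lead w b = lead v b"
    proof (rule lead_eqI)
      show "w (b, lead v b) \<noteq> 0" using lead_nz[OF assms(2), of b] wnz p by (cases "i = lead v b") auto
      show "w (b, k) = 0" if "k < lead v b" for k using lead_less[OF that] p i that by auto
    qed
    then have l: "lead w = lead v" using other by (metis ext)
    have sgn: "w (b', lead v b') < 0 \<longleftrightarrow> v (b', lead v b') < 0" for b'
    proof (cases "(b', lead v b') = (b, i)")
      case True
      then have "v (b, i) \<noteq> 0" using lead_nz[OF assms(2), of b] by auto
      \<comment> \<open>A nonzero even coordinate has modulus at least 2, so a change by 1 keeps its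
        sign.\<close>
      then have "v (b, i) \<ge> 2 \<or> v (b, i) \<le> - 2" using p(3) by presburger
      then show ?thesis using True p by auto
    qed (use p in auto)
    have "\<kappa> v = \<kappa> w"
      by (rule K_eqI[of _ _ "lead v"])
        (use \<kappa>[OF assms(2)] \<kappa>[OF assms(3)] lead_le[OF assms(2)] sgn l in auto)
    then show False using ne by simp
  qed
  then have v0: "v (b, i) = 0" by (rule lead_less)
  have "lead w b = i"
    by (rule lead_eqI) (use \<open>i < lead v b\<close> wnz p lead_less[of _ v b] in auto)
  then have "lead w = (lead v)(b := i)" using other by (auto simp: fun_eq_iff)
  then show thesis using that[OF \<open>i < lead v b\<close> p(2)] p v0 by simp
qed

text \<open>Each nonzero factor needs a change of \<open>\<kappa>\<close>, which lowers a leading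
  index; so the sum of the leading indices bounds the number of nonzero factors.\<close>

lemma weight_eq_0:
  assumes "v \<in> V" and inv: "\<And>c x y. c \<in> set cs \<Longrightarrow> x \<in> V \<Longrightarrow> y \<in> V \<Longrightarrow> \<kappa> x = \<kappa> y \<Longrightarrow> c x = c y"
    and "(\<Sum>b\<in>UNIV. lead v b) < length cs"
  shows "weight cs v = 0"
  using assms
proof (induction cs arbitrary: v)
  case (Cons c cs)
  have "(c v + c w) * weight cs w = 0" if w: "w \<in> V" "step v w" for w
  proof (cases "\<kappa> v = \<kappa> w")
    case True
    then have "c v = c w" using Cons.prems(2)[of c v w] Cons.prems(1) w by simp
    then show ?thesis by simp
  next
    case False
    obtain b i s where *: "i < lead v b" "lead w = (lead v)(b := i)"
      using step_lead[OF w(2) Cons.prems(1) w(1) False] by metis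
    have "(\<Sum>b\<in>UNIV. lead w b) < (\<Sum>b\<in>UNIV. lead v b)"
      by (rule sum_strict_mono_ex1) (use * in \<open>auto intro!: bexI[of _ b]\<close>)
    then have "weight cs w = 0" using Cons.IH[OF w(1)] Cons.prems by auto
    then show ?thesis by simp
  qed
  then show ?case by (simp add: sum.neutral)
qed simp

end

section \<open>The cycle for the two factors of the product\<close>

locale paired_cube_spheres =
  fixes n \<rho> :: "'m::finite \<Rightarrow> nat" and G :: "((bool \<times> 'm) \<times> nat \<Rightarrow> bit) set" and L :: int
    and d :: "bool \<times> 'm \<Rightarrow> nat"
  defines "d \<equiv> (\<lambda>b. if fst b then n (snd b) else n (snd b) - 1)"
  assumes cs: "cube_spheres d G L"
    and n_pos: "\<And>j. 0 < n j" and inj_\<rho>: "inj \<rho>"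
    and triangular: "\<And>\<gamma> s j i. \<gamma> \<in> G \<Longrightarrow> i \<le> d (s, j) \<Longrightarrow>
      (\<And>j'. \<rho> j' < \<rho> j \<Longrightarrow> \<gamma> ((s, j'), 0) = 0) \<Longrightarrow> \<gamma> ((s, j), i) = \<gamma> ((s, j), 0)"
begin

sublocale cube_spheres d G L by (rule cs)

lemma d_simps [simp]: "d (True, j) = n j" "d (False, j) = n j - 1"
  by (simp_all add: d_def)

text \<open>The leading-sign representative of the class
  \<open>x_j \<otimes> 1 + 1 \<otimes> x_j\<close>; \<open>False\<close> and \<open>True\<close>
  mark the first and the second factor.\<close>

definition cbar :: "'m \<Rightarrow> (bool \<times> 'm) grid \<Rightarrow> bit" where
  "cbar j v = \<kappa> v ((False, j), 0) + \<kappa> v ((True, j), 0)"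

lemma equivariant_cbar: "equivariant (\<lambda>\<gamma>. \<gamma> ((False, j), 0) + \<gamma> ((True, j), 0)) (cbar j)"
  unfolding equivariant_def cbar_def by (simp add: \<kappa>_act algebra_simps)

text \<open>Once the earlier blocks are settled, \<open>\<gamma>\<close> is constant on the index
  range of the block, so one zero there is as good as another.\<close>

lemma triangular_zero:
  assumes \<gamma>: "\<gamma> \<in> G" and \<iota>: "\<And>b. \<iota> b \<le> d b"
    and 0: "\<And>j'. \<rho> j' \<le> \<rho> j \<Longrightarrow> \<gamma> ((s, j'), \<iota> (s, j')) = 0"
  shows "\<gamma> ((s, j), 0) = 0"
  using 0
proof (induction "\<rho> j" arbitrary: j rule: less_induct)
  case less
  have "\<gamma> ((s, j'), 0) = 0" if "\<rho> j' < \<rho> j" for j'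
    using less.hyps[OF that] less.prems that by force
  then show ?case
    using triangular[OF \<gamma> \<iota>[of "(s, j)"]] less.prems[of j] by auto
qed

text \<open>The sum \<open>A\<close> of the two \<open>\<kappa>\<close> values lies in G and
  vanishes at the leading index of every block other than \<open>(s, j)\<close>. Triangularity makes
  it trivial at index 0 in the other copy and in the earlier blocks, and constant on
  \<open>(s, j)\<close>. Hence just one of the two signs \<open>e\<close> changes
  \<open>cbar j\<close>.\<close>

lemma cbar_step:
  assumes v: "v \<in> V" and w: "w \<in> V" "w = v(((s, j), i) := e)" "i < lead v (s, j)" "e \<in> {1, -1}"
    and l: "lead w = (lead v)((s, j) := i)"
  shows "\<rho> j' < \<rho> j \<Longrightarrow> cbar j' v = cbar j' w"
    and "cbar j v + cbar j w = \<kappa> v ((s, j), i) + of_bool (e < 0)"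
proof -
  define A where "A p = \<kappa> v p + \<kappa> w p" for p
  have A: "A \<in> G" unfolding A_def[abs_def] using \<kappa>(1)[OF v] \<kappa>(1)[OF w(1)] by (rule K_add)
  have 0: "A (b, lead w b) = 0" if "b \<noteq> (s, j)" for b
    using \<kappa>(2)[OF v, of b] \<kappa>(2)[OF w(1), of b] that l w(2) by (simp add: A_def)
  note le = lead_le[OF w(1)]
  have low: "A ((s', j'), 0) = 0" if "s' \<noteq> s \<or> \<rho> j' < \<rho> j" for s' j'
  proof (rule triangular_zero[OF A le])
    fix j'' assume "\<rho> j'' \<le> \<rho> j'"
    then have "(s', j'') \<noteq> (s, j)" using that by auto
    then show "A ((s', j''), lead w (s', j'')) = 0" by (rule 0)
  qed
  have cA: "cbar j' v + cbar j' w = A ((False, j'), 0) + A ((True, j'), 0)" for j'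
    by (simp add: cbar_def A_def algebra_simps)
  show "cbar j' v = cbar j' w" if "\<rho> j' < \<rho> j"
    using cA[of j'] low[of _ j'] that by (simp add: bit_add_eq_0_iff)
  have "A ((s, j), i) = A ((s, j), 0)"
    by (rule triangular[OF A]) (use low le[of "(s, j)"] l in auto)
  moreover have "cbar j v + cbar j w = A ((s, j), 0)"
    using cA[of j] low[of "\<not> s" j] by (cases s) auto
  moreover have "A ((s, j), i) = \<kappa> v ((s, j), i) + of_bool (e < 0)"
    using \<kappa>(2)[OF w(1), of "(s, j)"] l w(2) by (simp add: A_def)
  ultimately show "cbar j v + cbar j w = \<kappa> v ((s, j), i) + of_bool (e < 0)" by simp
qed

lemma cbar_\<kappa>: "\<kappa> x = \<kappa> y \<Longrightarrow> cbar j x = cbar j y"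
  by (simp add: cbar_def)

lemma set_sign_in_V:
  assumes v: "v \<in> V" "i < lead v b" "e \<in> {1, -1}"
  shows "v((b, i) := e) \<in> V" "step v (v((b, i) := e))" "lead (v((b, i) := e)) = (lead v)(b := i)"
proof -
  have v0: "v (b, i) = 0" using assms by (simp add: lead_less)
  have i: "(b, i) \<in> idx" using lead_le[OF v(1), of b] v(2) by (simp add: block_idx_def)
  show "v((b, i) := e) \<in> V"
  proof (rule V_updI[OF v(1) i])
    show "\<bar>e\<bar> \<le> L" using v(3) L by auto
    show "\<exists>k\<le>d b'. (b', k) \<noteq> (b, i) \<and> \<bar>v (b', k)\<bar> = L" for b'
    proof -
      obtain k where "k \<le> d b'" "\<bar>v (b', k)\<bar> = L" using V_max[OF v(1)] by blast
      then show ?thesis using v0 L by (intro exI[of _ k]) auto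
    qed
  qed
  show "step v (v((b, i) := e))"
    unfolding step_def using i v(3) v0 by (intro bexI[of _ "(b, i)"] bexI[of _ e]) auto
  have "lead (v((b, i) := e)) b = i"
    by (rule lead_eqI) (use v lead_less[of _ v b] in auto)
  then show "lead (v((b, i) := e)) = (lead v)(b := i)"
    by (auto simp: fun_eq_iff lead_def)
qed

text \<open>When the leading indices add up to the number of remaining steps, each step has to lower one
  of them by exactly one; the labels then leave only a choice between the two copies of \<open>j\<close>.\<close>

lemma weight_step:
  assumes v: "v \<in> V"
    and sum: "(\<Sum>b\<in>UNIV. lead v b) = Suc (length js)"
    and zero: "\<And>s j'. j' \<noteq> j \<Longrightarrow> \<not> \<rho> j < \<rho> j' \<Longrightarrow> lead v (s, j') = 0"
  shows "\<exists>w. (\<forall>s. 0 < lead v (s, j) \<longrightarrow> w s \<in> V \<and> lead (w s) = (lead v)((s, j) := lead v (s, j) - 1)) \<and>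
    weight (map cbar (j # js)) v = (\<Sum>s | 0 < lead v (s, j). weight (map cbar js) (w s))"
proof -
  \<comment> \<open>In each copy, the one sign for which \<open>cbar j\<close> changes.\<close>
  define e :: "bool \<Rightarrow> int" where "e s = (if \<kappa> v ((s, j), lead v (s, j) - 1) = 0 then - 1 else 1)" for s
  define w where "w s = v(((s, j), lead v (s, j) - 1) := e s)" for s
  have e: "e s \<in> {1, -1}" for s by (simp add: e_def)
  have w: "w s \<in> V" "step v (w s)" "lead (w s) = (lead v)((s, j) := lead v (s, j) - 1)"
    if "0 < lead v (s, j)" for s
    unfolding w_def using set_sign_in_V[OF v _ e, of "lead v (s, j) - 1" "(s, j)"] that by auto
  have cw: "cbar j v + cbar j (w s) = 1" if "0 < lead v (s, j)" for s
    using cbar_step(2)[OF v w(1)[OF that] w_def _ e w(3)[OF that]] that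
    by (auto simp: e_def)
  have zero': "(cbar j v + cbar j u) * weight (map cbar js) u = 0"
    if u: "u \<in> V" "step v u" "u \<notin> w ` {s. 0 < lead v (s, j)}" for u
  proof (rule ccontr)
    assume "(cbar j v + cbar j u) * weight (map cbar js) u \<noteq> 0"
    then have nz: "cbar j v \<noteq> cbar j u" "weight (map cbar js) u \<noteq> 0"
      by (auto simp: bit_add_eq_0_iff)
    then have "\<kappa> v \<noteq> \<kappa> u" using cbar_\<kappa> by blast
    then obtain s j' i t where *: "i < lead v (s, j')" "t \<in> {1, -1}" "u = v(((s, j'), i) := t)"
        "lead u = (lead v)((s, j') := i)"
      using step_lead[OF u(2) v u(1)] by (metis surj_pair)
    have "length js \<le> (\<Sum>b\<in>UNIV. lead u b)"
    proof (rule ccontr)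
      assume "\<not> ?thesis"
      then have "weight (map cbar js) u = 0"
        by (intro weight_eq_0[OF u(1)]) (auto simp: cbar_def)
      then show False using nz(2) by simp
    qed
    moreover have "(\<Sum>b\<in>UNIV. lead v b) = lead v (s, j') + (\<Sum>b\<in>UNIV - {(s, j')}. lead v b)"
      by (rule sum.remove) auto
    moreover have "(\<Sum>b\<in>UNIV. lead u b) = i + (\<Sum>b\<in>UNIV - {(s, j')}. lead v b)"
      using *(4) by (subst sum.remove[of _ "(s, j')"]) auto
    ultimately have i: "i = lead v (s, j') - 1" using sum *(1) by linarith
    \<comment> \<open>In block j only the sign \<open>e s\<close> changes \<open>cbar j\<close>; a
      move in a later block leaves \<open>cbar j\<close> unchanged.\<close>
    show False
    proof (cases "j' = j")
      case True
      then have "t \<noteq> e s"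
        using u(3) * i by (auto simp: w_def)
      then have "cbar j v + cbar j u = 0"
        using cbar_step(2)[OF v u(1) *(3,1,2,4)] True i *(2) by (auto simp: e_def split: if_splits)
      then show False using nz by (simp add: bit_add_eq_0_iff)
    next
      case False
      then have "\<rho> j < \<rho> j'" using zero[OF False, of s] *(1) by auto
      then show False using cbar_step(1)[OF v u(1) *(3,1,2,4)] nz by blast
    qed
  qed
  have inj: "inj_on w {s. 0 < lead v (s, j)}"
  proof (rule inj_onI)
    fix s t assume st: "s \<in> {s. 0 < lead v (s, j)}" "t \<in> {s. 0 < lead v (s, j)}" "w s = w t"
    show "s = t"
    proof (rule ccontr)
      assume "s \<noteq> t"
      then have "lead (w t) (s, j) = lead v (s, j)" using w(3)[of t] st(2) by simp
      moreover have "lead (w s) (s, j) = lead v (s, j) - 1" using w(3)[of s] st(1) by simp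
      ultimately show False using st by simp
    qed
  qed
  have "weight (map cbar (j # js)) v = (\<Sum>u\<in>w ` {s. 0 < lead v (s, j)}. (cbar j v + cbar j u) * weight (map cbar js) u)"
    unfolding list.map weight.simps
    by (rule sum.mono_neutral_right) (use finite_V w zero' in auto)
  also have "\<dots> = (\<Sum>s | 0 < lead v (s, j). weight (map cbar js) (w s))"
    by (subst sum.reindex[OF inj]) (auto simp: cw intro!: sum.cong)
  finally show ?thesis using w by blast
qed

text \<open>The order of the factors in the cup product: all those of one block together, so that
  with \<open>js\<close> increasing in \<open>\<rho>\<close> the leading indices of a block are
  exhausted before the next one starts.\<close>

definition stages :: "'m list \<Rightarrow> 'm list" where
  "stages js = concat (map (\<lambda>j. replicate (2 * n j - 1) j) js)"

lemma length_stages: "distinct js \<Longrightarrow> length (stages js) = (\<Sum>j\<in>set js. 2 * n j - 1)"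
  by (simp add: stages_def length_concat comp_def sum_list_distinct_conv_sum_set)

lemma sum_bool_times: "(\<Sum>b\<in>UNIV. f b) = (\<Sum>j\<in>UNIV. f (False, j) + f (True, j))"
  for f :: "bool \<times> 'm \<Rightarrow> nat"
proof -
  have "(\<Sum>b\<in>UNIV. f b) = (\<Sum>s\<in>UNIV. \<Sum>j\<in>UNIV. f (s, j))"
    by (simp add: sum.cartesian_product UNIV_Times_UNIV[symmetric] del: UNIV_Times_UNIV)
  then show ?thesis by (simp add: UNIV_bool sum.distrib)
qed

lemma sum_lead_stage:
  assumes "distinct (j # rest)"
    and full: "\<And>s j'. j' \<in> set rest \<Longrightarrow> lead v (s, j') = d (s, j')"
    and zero: "\<And>s j'. j' \<notin> set (j # rest) \<Longrightarrow> lead v (s, j') = 0"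
  shows "(\<Sum>b\<in>UNIV. lead v b) = lead v (False, j) + lead v (True, j) + length (stages rest)"
proof -
  have "(\<Sum>b\<in>UNIV. lead v b) = (\<Sum>j'\<in>set (j # rest). lead v (False, j') + lead v (True, j'))"
    unfolding sum_bool_times by (rule sum.mono_neutral_right) (use zero in auto)
  also have "\<dots> = lead v (False, j) + lead v (True, j) + (\<Sum>j'\<in>set rest. lead v (False, j') + lead v (True, j'))"
    using assms(1) by simp
  also have "(\<Sum>j'\<in>set rest. lead v (False, j') + lead v (True, j')) = (\<Sum>j'\<in>set rest. 2 * n j' - 1)"
    using full n_pos by (intro sum.cong) auto
  finally show ?thesis using assms(1) by (simp add: length_stages)
qed

lemma distinct_if_sorted: "sorted_wrt (\<lambda>j j'. \<rho> j < \<rho> j') js \<Longrightarrow> distinct js"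
  by (induction js) auto

text \<open>Every factor of block j lowers the leading index of one of its two copies, which is
  Pascal's rule. When both are 0, the next block starts afresh and contributes an odd binomial
  coefficient, that is 1.\<close>

lemma weight_stages:
  assumes odd_choose: "\<And>j. odd ((2 * n j - 1) choose n j)"
    and "v \<in> V" "sorted_wrt (\<lambda>j j'. \<rho> j < \<rho> j') (j # rest)"
    and "\<And>s j'. j' \<in> set rest \<Longrightarrow> lead v (s, j') = d (s, j')"
    and "\<And>s j'. j' \<notin> set (j # rest) \<Longrightarrow> lead v (s, j') = 0"
    and "m = lead v (False, j) + lead v (True, j)" and "K = m + length (stages rest) + length rest"
  shows "weight (map cbar (replicate m j @ stages rest)) v = of_nat (m choose lead v (True, j))"
  using assms(2-)
\<comment> \<open>The passage to the next block keeps the number of remaining factors; the summand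
  \<open>length rest\<close> makes \<open>K\<close> decrease there.\<close>
proof (induction K arbitrary: m j rest v rule: less_induct)
  case (less K)
  note v = less.prems(1) and sorted = less.prems(2) and full = less.prems(3) and zero = less.prems(4)
    and m = less.prems(5) and K = less.prems(6)
  have dist: "distinct (j # rest)"
    using sorted by (rule distinct_if_sorted)
  show ?case
  proof (cases m)
    case 0
    show ?thesis
    proof (cases rest)
      case Nil
      then show ?thesis using 0 m by (simp add: stages_def)
    next
      case (Cons j1 rest')
      have eq: "replicate m j @ stages rest = replicate (2 * n j1 - 1) j1 @ stages rest'"
        using 0 Cons by (simp add: stages_def)
      have l1: "lead v (False, j1) = n j1 - 1" "lead v (True, j1) = n j1"
        using full[of j1] Cons by auto
      have "weight (map cbar (replicate (2 * n j1 - 1) j1 @ stages rest')) v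
          = of_nat ((2 * n j1 - 1) choose lead v (True, j1))"
      proof (rule less.IH[OF _ _ _ _ _ _ refl])
        show "2 * n j1 - 1 + length (stages rest') + length rest' < K"
          using Cons K by (simp add: stages_def)
        show "lead v (s, j') = 0" if "j' \<notin> set (j1 # rest')" for s j'
          using zero[of j' s] that Cons 0 m by (cases "j' = j"; cases s) auto
        show "2 * n j1 - 1 = lead v (False, j1) + lead v (True, j1)"
          using l1 n_pos[of j1] by simp
      qed (use v sorted full Cons in auto)
      also have "\<dots> = (1 :: bit)" using odd_choose[of j1] l1 by (simp add: of_nat_eq_1_bit_iff)
      finally show ?thesis using eq 0 m by simp
    qed
  next
    case (Suc k)
    have sum: "(\<Sum>b\<in>UNIV. lead v b) = Suc (length (replicate k j @ stages rest))"
      using sum_lead_stage[OF dist full zero] Suc m by simp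
    have zero': "lead v (s, j') = 0" if "j' \<noteq> j" "\<not> \<rho> j < \<rho> j'" for s j'
      using zero[of j' s] that sorted by auto
    obtain w where w: "\<And>s. 0 < lead v (s, j) \<Longrightarrow> w s \<in> V"
        "\<And>s. 0 < lead v (s, j) \<Longrightarrow> lead (w s) = (lead v)((s, j) := lead v (s, j) - 1)"
        and wt: "weight (map cbar (j # replicate k j @ stages rest)) v
          = (\<Sum>s | 0 < lead v (s, j). weight (map cbar (replicate k j @ stages rest)) (w s))"
      using weight_step[of v "replicate k j @ stages rest" j, OF v sum zero'] by blast
    have IH: "weight (map cbar (replicate k j @ stages rest)) (w s) = of_nat (k choose lead (w s) (True, j))"
      if s: "0 < lead v (s, j)" for s
    proof (rule less.IH[OF _ _ _ _ _ _ refl])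
      show "k + length (stages rest) + length rest < K" using K Suc by simp
      have j: "j \<notin> set rest" using dist by simp
      show "lead (w s) (s', j') = d (s', j')" if "j' \<in> set rest" for s' j'
        using that j full[of j' s'] w(2)[OF s] by auto
      show "lead (w s) (s', j') = 0" if "j' \<notin> set (j # rest)" for s' j'
        using that zero[of j' s'] w(2)[OF s] by auto
      show "k = lead (w s) (False, j) + lead (w s) (True, j)"
        using w(2)[OF s] s Suc m by (cases s) auto
    qed (use Suc w(1)[OF s] sorted in auto)
    have "weight (map cbar (replicate m j @ stages rest)) v
        = (\<Sum>s | 0 < lead v (s, j). of_nat (k choose lead (w s) (True, j)))"
      using wt IH Suc by simp
    also have "\<dots> = of_nat (m choose lead v (True, j))"
    proof (cases "lead v (False, j)")
      case F0: 0
      then have "{s. 0 < lead v (s, j)} = {True}"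
        using Suc m unfolding set_eq_iff all_bool_eq by simp
      then show ?thesis using F0 Suc m w(2)[of True] by auto
    next
      case FS: (Suc p)
      show ?thesis
      proof (cases "lead v (True, j)")
        case T0: 0
        then have "{s. 0 < lead v (s, j)} = {False}"
          using FS unfolding set_eq_iff all_bool_eq by simp
        then show ?thesis using T0 FS w(2)[of False] by auto
      next
        case TS: (Suc q)
        then have "{s. 0 < lead v (s, j)} = {False, True}"
          using FS unfolding set_eq_iff all_bool_eq by simp
        moreover have "lead (w False) (True, j) = Suc q" "lead (w True) (True, j) = q"
          using w(2)[of False] w(2)[of True] FS TS by auto
        ultimately show ?thesis using TS Suc by (simp add: algebra_simps)
      qed
    qed
    finally show ?thesis .
  qed
qed

text \<open>N nonzero factors require every leading index of the initial vertex to be maximal, and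
  \<open>\<kappa> = 0\<close> fixes the signs; only the initial vertex \<open>top\<close>
  survives.\<close>

theorem cup_cbar_ne_0:
  assumes odd_choose: "\<And>j. odd ((2 * n j - 1) choose n j)"
  obtains lab where "cup (\<lambda>i. cbar (lab i)) = 1"
proof -
  define js where "js = map (inv \<rho>) (sorted_list_of_set (range \<rho>))"
  have sorted: "sorted_wrt (\<lambda>j j'. \<rho> j < \<rho> j') js"
    unfolding js_def sorted_wrt_map
    by (rule sorted_wrt_mono_rel[OF _ strict_sorted_list_of_set]) (auto simp: inv_f_f[OF inj_\<rho>])
  have set: "set js = UNIV"
    by (simp add: js_def image_image inv_f_f[OF inj_\<rho>])
  have dist: "distinct js" using sorted by (rule distinct_if_sorted)
  have N: "N = (\<Sum>j\<in>UNIV. 2 * n j - 1)"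
    unfolding N_def sum_bool_times using n_pos by (intro sum.cong) auto
  have len: "length (stages js) = N" using length_stages[OF dist] set N by simp
  obtain j rest where js: "js = j # rest" using set by (cases js) auto
  define top :: "(bool \<times> 'm) grid" where "top p = (if snd p = d (fst p) then L else 0)" for p
  let ?S = "{v. v \<in> V \<and> (\<forall>p. even (v p)) \<and> \<kappa> v = (\<lambda>p. 0)}"
  have lead_top: "lead top b = d b" for b
    by (rule lead_eqI) (use L in \<open>auto simp: top_def\<close>)
  have topV: "top \<in> V"
    using L by (auto simp: V_def top_def block_idx_def)
  have \<kappa>top: "\<kappa> top = (\<lambda>p. 0)"
    by (rule K_eqI[of _ _ d]) (use \<kappa>[OF topV] zero_in_K lead_top L in \<open>auto simp: top_def\<close>)
  have top: "top \<in> ?S" using topV \<kappa>top L by (auto simp: top_def)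
  have other: "weight (map cbar (stages js)) v = 0" if v: "v \<in> ?S" "v \<noteq> top" for v
  proof (rule ccontr)
    assume "weight (map cbar (stages js)) v \<noteq> 0"
    moreover have "weight (map cbar (stages js)) v = 0"
      if "(\<Sum>b\<in>UNIV. lead v b) < length (map cbar (stages js))"
      by (rule weight_eq_0[OF _ _ that]) (use v in \<open>auto simp: cbar_def\<close>)
    ultimately have "\<not> (\<Sum>b\<in>UNIV. lead v b) < length (map cbar (stages js))" by blast
    then have "N \<le> (\<Sum>b\<in>UNIV. lead v b)" using len by simp
    have lead: "lead v b = d b" for b
    proof (rule ccontr)
      assume "lead v b \<noteq> d b"
      then have "lead v b < d b" using lead_le[of v b] v by auto
      then have "(\<Sum>b\<in>UNIV. lead v b) < (\<Sum>b\<in>UNIV. d b)"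
        using lead_le[of v] v by (intro sum_strict_mono_ex1) auto
      then show False using \<open>N \<le> _\<close> by (simp add: N_def)
    qed
    have "v p = top p" for p
    proof (cases p)
      case (Pair b i)
      consider "i < d b" | "i = d b" | "i > d b" by linarith
      then show ?thesis
      proof cases
        case 1
        then show ?thesis using lead_less[of i v b] lead Pair by (simp add: top_def)
      next
        case 2
        obtain k where k: "k \<le> d b" "\<bar>v (b, k)\<bar> = L" using V_max[of v b] v by blast
        then have "k = d b" using lead_less[of k v b] lead[of b] L by force
        moreover have "\<not> v (b, d b) < 0" using \<kappa>(2)[of v b] v lead[of b] by auto
        ultimately show ?thesis using k Pair 2 by (simp add: top_def)
      next
        case 3
        then show ?thesis using V_out[of v p] v Pair by (simp add: top_def block_idx_def)
      qed
    qed
    then show False using v by auto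
  qed
  have "cup (\<lambda>i. cbar (stages js ! i)) = cup (\<lambda>i. map cbar (stages js) ! i)"
    unfolding cup_def by (intro sum.cong prod.cong refl) (simp add: len)
  also have "\<dots> = (\<Sum>v\<in>?S. weight (map cbar (stages js)) v)"
    by (rule cup_eq_sum_weight) (simp add: len)
  also have "\<dots> = (\<Sum>v\<in>{top}. weight (map cbar (stages js)) v)"
    by (rule sum.mono_neutral_right) (use finite_V top other in auto)
  also have "\<dots> = weight (map cbar (replicate (2 * n j - 1) j @ stages rest)) top"
    by (simp add: js stages_def)
  also have "\<dots> = of_nat ((2 * n j - 1) choose lead top (True, j))"
  proof (rule weight_stages[OF odd_choose topV _ _ _ _ refl])
    show "sorted_wrt (\<lambda>j j'. \<rho> j < \<rho> j') (j # rest)" using sorted js by simp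
    show "2 * n j - 1 = lead top (False, j) + lead top (True, j)"
      using n_pos[of j] by (simp add: lead_top)
  qed (use set js lead_top in auto)
  also have "\<dots> = 1" using odd_choose[of j] by (simp add: lead_top of_nat_eq_1_bit_iff)
  finally show thesis by (rule that)
qed

end

section \<open>Parity of a row of Pascal's triangle\<close>

lemma odd_choose_pow2_minus_1:
  assumes "i \<le> 2 ^ k - 1"
  shows "odd ((2 ^ k - 1) choose i)"
  using assms
proof (induction i)
  case (Suc i)
  have "Suc (2 ^ k - 1) = (2::nat) ^ k" by simp
  then have "(2 ^ k) choose (Suc i) = ((2 ^ k - 1) choose i) + ((2 ^ k - 1) choose Suc i)"
    by (metis binomial_Suc_Suc)
  \<comment> \<open>Neighbours in row \<open>2 ^ k - 1\<close> add up to an entry in the interior of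
    row \<open>2 ^ k\<close>. Were it odd, absorption would make \<open>2 ^ k\<close> divide the
    smaller number \<open>Suc i\<close>.\<close>
  moreover have "even ((2 ^ k) choose (Suc i))"
  proof (rule ccontr)
    assume "odd ((2 ^ k) choose (Suc i))"
    then have "coprime ((2::nat) ^ k) ((2 ^ k) choose (Suc i))" by simp
    moreover have "2 ^ k dvd Suc i * ((2 ^ k) choose (Suc i))"
      by (simp only: binomial_absorption dvd_triv_left)
    ultimately have "2 ^ k dvd Suc i" by (simp only: coprime_dvd_mult_left_iff)
    then show False using Suc.prems by (auto dest: dvd_imp_le)
  qed
  ultimately show ?case using Suc by auto
qed simp

section \<open>Triangular form of the sign group\<close>

context sign_group
begin

lemma K_sum: "finite S \<Longrightarrow> (\<And>l. l \<in> S \<Longrightarrow> f l \<in> K) \<Longrightarrow> (\<lambda>p. \<Sum>l\<in>S. f l p) \<in> K"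
proof (induction S rule: finite_induct)
  case (insert x S)
  then show ?case using K_add[of "f x" "\<lambda>p. \<Sum>l\<in>S. f l p"] by simp
qed (simp add: zero_in_K)

text \<open>The basis of K dual to the evaluations at index 0 of the blocks.\<close>

definition E :: "'m \<Rightarrow> 'm \<times> nat \<Rightarrow> bit" where
  "E l = (THE \<alpha>. \<alpha> \<in> K \<and> (\<forall>j. \<alpha> (j, 0) = of_bool (j = l)))"

lemma E: "E l \<in> K" "E l (j, 0) = of_bool (j = l)"
proof -
  have "E l \<in> K \<and> (\<forall>j. E l (j, 0) = of_bool (j = l))"
    unfolding E_def by (rule theI'[OF K_dual[of "\<lambda>j. 0" "\<lambda>j. of_bool (j = l)"]]) simp
  then show "E l \<in> K" "E l (j, 0) = of_bool (j = l)" by auto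
qed

text \<open>If \<open>E j\<close> vanished at i in its own block, it would vanish on a choice of one
  index per block, namely i in block j and 0 elsewhere.\<close>

lemma E_diag: "i \<le> n j \<Longrightarrow> E j (j, i) = 1"
proof (rule ccontr)
  assume i: "i \<le> n j" and "E j (j, i) \<noteq> 1"
  then have "E j = (\<lambda>p. 0)"
    by (intro K_eqI[of _ _ "\<lambda>j'. if j' = j then i else 0"]) (auto simp: E zero_in_K)
  then show False using E(2)[of j j] by simp
qed

text \<open>Block j is twisted by the basis element of block l. Acyclicity of this graph is what a
  triangular order needs.\<close>

definition edge :: "'m \<Rightarrow> 'm \<Rightarrow> bool" where
  "edge j l \<longleftrightarrow> j \<noteq> l \<and> (\<exists>i\<le>n j. E l (j, i) = 1)"

text \<open>A minimal set without a sink would be a chordless cycle, and the sum of its dual basis elements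
  would vanish on a suitable choice of one index from each block.\<close>

lemma sink_exists: "T \<noteq> {} \<Longrightarrow> \<exists>j\<in>T. \<forall>l\<in>T. \<not> edge j l"
proof (induction "card T" arbitrary: T rule: less_induct)
  case less
  show ?case
  proof (rule ccontr)
    assume "\<not> ?thesis"
    then have "\<forall>j\<in>T. \<exists>l\<in>T. edge j l" by blast
    then obtain f where f: "\<And>j. j \<in> T \<Longrightarrow> f j \<in> T \<and> edge j (f j)" by metis
    \<comment> \<open>A proper image would be a smaller set without a sink, against the minimality
      of T.\<close>
    have onto: "g ` T = T" if g: "\<And>j. j \<in> T \<Longrightarrow> g j \<in> T \<and> edge j (g j)" for g
    proof (rule ccontr)
      assume "g ` T \<noteq> T"
      then have "g ` T \<subset> T" using g by auto
      then have "card (g ` T) < card T" by (simp add: psubset_card_mono)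
      then obtain j where "j \<in> g ` T" "\<forall>l\<in>g ` T. \<not> edge j l" using less by blast
      then show False using g \<open>g ` T \<subset> T\<close> by blast
    qed
    have inj: "inj_on f T" using onto[of f] f by (intro eq_card_imp_inj_on) auto
    \<comment> \<open>Redirecting \<open>f\<close> at j to a second target l gives another successor
      map, which must be onto as well; since \<open>f\<close> is injective, it would miss
      \<open>f j\<close>.\<close>
    have only: "l = f j" if "j \<in> T" "l \<in> T" "edge j l" for j l
    proof (rule ccontr)
      assume "l \<noteq> f j"
      have "(f(j := l)) ` T = T" using f that by (intro onto) auto
      moreover have "f j \<in> T" using f that by blast
      ultimately obtain j' where j': "j' \<in> T" "(f(j := l)) j' = f j" by (metis imageE)
      then have "j' \<noteq> j" using \<open>l \<noteq> f j\<close> by auto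
      then show False using j' inj that(1) by (auto simp: inj_on_def)
    qed
    obtain i where i: "\<And>j. j \<in> T \<Longrightarrow> i j \<le> n j \<and> E (f j) (j, i j) = 1"
      using f unfolding edge_def by metis
    define \<alpha> where "\<alpha> p = (\<Sum>l\<in>T. E l p)" for p
    have \<alpha>K: "\<alpha> \<in> K" unfolding \<alpha>_def[abs_def] by (rule K_sum) (auto simp: E)
    have "\<alpha> = (\<lambda>p. 0)"
    proof (rule K_eqI[OF \<alpha>K zero_in_K, of "\<lambda>j. if j \<in> T then i j else 0"])
      show "(if j \<in> T then i j else 0) \<le> n j" for j using i by auto
      show "\<alpha> (j, if j \<in> T then i j else 0) = 0" for j
      proof (cases "j \<in> T")
        case True
        have ne: "f j \<noteq> j" using f[OF True] by (auto simp: edge_def)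
        \<comment> \<open>At this index only the terms for j and \<open>f j\<close> survive, and
          both are 1.\<close>
        have "\<alpha> (j, i j) = (\<Sum>l\<in>{j, f j}. E l (j, i j))"
          unfolding \<alpha>_def
        proof (rule sum.mono_neutral_right)
          show "\<forall>l\<in>T - {j, f j}. E l (j, i j) = 0"
            using only[OF True] i[OF True] unfolding edge_def by (metis DiffE bit_not_zero_iff insertCI)
        qed (use True f in auto)
        also have "\<dots> = 0" using ne i[OF True] E_diag[of "i j" j] by simp
        finally show ?thesis using True by simp
      next
        case False
        then show ?thesis by (auto simp: \<alpha>_def E intro!: sum.neutral)
      qed
    qed
    moreover obtain j where j: "j \<in> T" using less.prems by auto
    have "\<alpha> (j, 0) = 1"
      using j by (simp add: \<alpha>_def E of_bool_def sum.delta)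
    ultimately show False by simp
  qed
qed

lemma topological_order: "\<exists>\<rho> :: 'm \<Rightarrow> nat. inj \<rho> \<and> (\<forall>j l. edge j l \<longrightarrow> \<rho> l < \<rho> j)"
proof -
  have "\<exists>\<rho> :: 'm \<Rightarrow> nat. inj_on \<rho> T \<and> \<rho> ` T \<subseteq> {..<card T} \<and> (\<forall>j\<in>T. \<forall>l\<in>T. edge j l \<longrightarrow> \<rho> l < \<rho> j)" for T
  proof (induction "card T" arbitrary: T)
    case 0
    then show ?case by simp
  next
    case (Suc k)
    then have "T \<noteq> {}" by auto
    then obtain j where j: "j \<in> T" "\<forall>l\<in>T. \<not> edge j l" using sink_exists by blast
    have card: "k = card (T - {j})" using Suc.hyps(2) j by simp
    obtain \<rho> :: "'m \<Rightarrow> nat" where \<rho>: "inj_on \<rho> (T - {j})" "\<rho> ` (T - {j}) \<subseteq> {..<k}"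
        "\<forall>j'\<in>T - {j}. \<forall>l\<in>T - {j}. edge j' l \<longrightarrow> \<rho> l < \<rho> j'"
      using Suc.hyps(1)[OF card] card by metis
    define \<rho>' where "\<rho>' l = (if l = j then 0 else Suc (\<rho> l))" for l
    have "inj_on \<rho>' T" using \<rho>(1) by (auto simp: inj_on_def \<rho>'_def)
    moreover have "\<rho>' ` T \<subseteq> {..<card T}" using \<rho>(2) Suc.hyps(2) by (auto simp: \<rho>'_def)
    moreover have "\<forall>j'\<in>T. \<forall>l\<in>T. edge j' l \<longrightarrow> \<rho>' l < \<rho>' j'"
      using \<rho>(3) j by (auto simp: \<rho>'_def)
    ultimately show ?case by blast
  qed
  from this[of UNIV] show ?thesis by auto
qed

text \<open>In the basis \<open>E\<close> such an element involves, besides \<open>E j\<close>, only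
  elements \<open>E l\<close> without an edge from j to l. These vanish on block j, where
  \<open>E j\<close> is constantly 1.\<close>

lemma triangular_order:
  "\<exists>\<rho> :: 'm \<Rightarrow> nat. inj \<rho> \<and> (\<forall>\<alpha>\<in>K. \<forall>j. \<forall>i\<le>n j.
    (\<forall>j'. \<rho> j' < \<rho> j \<longrightarrow> \<alpha> (j', 0) = 0) \<longrightarrow> \<alpha> (j, i) = \<alpha> (j, 0))"
proof -
  obtain \<rho> :: "'m \<Rightarrow> nat" where \<rho>: "inj \<rho>" "\<And>j l. edge j l \<Longrightarrow> \<rho> l < \<rho> j"
    using topological_order by blast
  have "\<alpha> (j, i) = \<alpha> (j, 0)"
    if \<alpha>: "\<alpha> \<in> K" and i: "i \<le> n j" and 0: "\<And>j'. \<rho> j' < \<rho> j \<Longrightarrow> \<alpha> (j', 0) = 0" for \<alpha> j i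
  proof -
    define S where "S = {l. \<alpha> (l, 0) = 1}"
    have "\<alpha> = (\<lambda>p. \<Sum>l\<in>S. E l p)"
    proof (rule K_eqI[OF \<alpha> K_sum, of _ _ "\<lambda>j. 0"])
      show "\<alpha> (l, 0) = (\<Sum>l'\<in>S. E l' (l, 0))" for l
        by (cases "\<alpha> (l, 0)") (auto simp: E S_def of_bool_def sum.delta')
    qed (auto simp: E)
    then have "\<alpha> (j, i) = (\<Sum>l\<in>S. E l (j, i))" by metis
    also have "\<dots> = (\<Sum>l\<in>S. of_bool (l = j))"
    proof (rule sum.cong[OF refl])
      fix l assume l: "l \<in> S"
      show "E l (j, i) = of_bool (l = j)"
      proof (cases "l = j")
        case False
        have "\<not> edge j l" using 0[of l] \<rho>(2)[of j l] l by (auto simp: S_def)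
        then show ?thesis using False i by (auto simp: edge_def)
      qed (use E_diag i in auto)
    qed
    also have "\<dots> = \<alpha> (j, 0)"
      by (cases "\<alpha> (j, 0)") (auto simp: S_def of_bool_def sum.delta')
    finally show ?thesis .
  qed
  with \<rho>(1) show ?thesis by blast
qed

section \<open>Doubling the sign group\<close>

definition pair :: "('m \<times> nat \<Rightarrow> bit) \<Rightarrow> ('m \<times> nat \<Rightarrow> bit) \<Rightarrow> (bool \<times> 'm) \<times> nat \<Rightarrow> bit" where
  "pair \<alpha> \<beta> p = (if fst (fst p) then \<beta> else \<alpha>) (snd (fst p), snd p)"

abbreviation KK where "KK \<equiv> {pair \<alpha> \<beta> | \<alpha> \<beta>. \<alpha> \<in> K \<and> \<beta> \<in> K}"

lemma pair_simps [simp]: "pair \<alpha> \<beta> ((True, j), i) = \<beta> (j, i)" "pair \<alpha> \<beta> ((False, j), i) = \<alpha> (j, i)"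
  by (auto simp: pair_def)

text \<open>Dropping the last index from the \<open>False\<close> blocks, that is passing to an
  equator, keeps the dual property, since a choice of indices there is still a choice for K.\<close>

lemma paired_cube_spheres:
  assumes n_pos: "\<And>j. 0 < n j" and L: "even L" "0 < L"
  obtains \<rho> where "paired_cube_spheres n \<rho> KK L"
proof -
  obtain \<rho> :: "'m \<Rightarrow> nat" where \<rho>: "inj \<rho>"
    "\<And>\<alpha> j i. \<alpha> \<in> K \<Longrightarrow> i \<le> n j \<Longrightarrow> (\<And>j'. \<rho> j' < \<rho> j \<Longrightarrow> \<alpha> (j', 0) = 0) \<Longrightarrow> \<alpha> (j, i) = \<alpha> (j, 0)"
    using triangular_order by blast
  let ?d = "\<lambda>b. if fst b then n (snd b) else n (snd b) - 1"
  have "paired_cube_spheres n \<rho> KK L"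
  proof
    show "(\<lambda>p. \<gamma> p + \<delta> p) \<in> KK" if "\<gamma> \<in> KK" "\<delta> \<in> KK" for \<gamma> \<delta>
    proof -
      obtain \<alpha> \<beta> \<alpha>' \<beta>' where *: "\<gamma> = pair \<alpha> \<beta>" "\<delta> = pair \<alpha>' \<beta>'" "\<alpha> \<in> K" "\<beta> \<in> K" "\<alpha>' \<in> K" "\<beta>' \<in> K"
        using \<open>\<gamma> \<in> KK\<close> \<open>\<delta> \<in> KK\<close> by blast
      have "(\<lambda>p. \<gamma> p + \<delta> p) = pair (\<lambda>p. \<alpha> p + \<alpha>' p) (\<lambda>p. \<beta> p + \<beta>' p)"
        by (auto simp: * pair_def fun_eq_iff)
      then show ?thesis using K_add * by blast
    qed
    fix \<iota> :: "bool \<times> 'm \<Rightarrow> nat" and T :: "bool \<times> 'm \<Rightarrow> bit" assume \<iota>: "\<And>b. \<iota> b \<le> ?d b"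
    have le: "\<iota> (s, j) \<le> n j" for s j using \<iota>[of "(s, j)"] by (cases s) auto
    obtain \<alpha> where \<alpha>: "\<alpha> \<in> K" "\<And>j. \<alpha> (j, \<iota> (False, j)) = T (False, j)"
      using K_dual[of "\<lambda>j. \<iota> (False, j)" "\<lambda>j. T (False, j)"] le by auto
    obtain \<beta> where \<beta>: "\<beta> \<in> K" "\<And>j. \<beta> (j, \<iota> (True, j)) = T (True, j)"
      using K_dual[of "\<lambda>j. \<iota> (True, j)" "\<lambda>j. T (True, j)"] le by auto
    show "\<exists>!\<gamma>. \<gamma> \<in> KK \<and> (\<forall>b. \<gamma> (b, \<iota> b) = T b)"
    proof (rule ex1I[of _ "pair \<alpha> \<beta>"])
      show "pair \<alpha> \<beta> \<in> KK \<and> (\<forall>b. pair \<alpha> \<beta> (b, \<iota> b) = T b)"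
        using \<alpha> \<beta> by (auto simp: pair_def)
      fix \<gamma> assume \<gamma>: "\<gamma> \<in> KK \<and> (\<forall>b. \<gamma> (b, \<iota> b) = T b)"
      then obtain \<alpha>' \<beta>' where *: "\<gamma> = pair \<alpha>' \<beta>'" "\<alpha>' \<in> K" "\<beta>' \<in> K" by blast
      have "\<alpha>' = \<alpha>"
        by (rule K_eqI[OF *(2) \<alpha>(1) le[of False]]) (use \<gamma> * \<alpha> in \<open>metis pair_simps(2)\<close>)
      moreover have "\<beta>' = \<beta>"
        by (rule K_eqI[OF *(3) \<beta>(1) le[of True]]) (use \<gamma> * \<beta> in \<open>metis pair_simps(1)\<close>)
      ultimately show "\<gamma> = pair \<alpha> \<beta>" using * by simp
    qed
  next
    fix \<gamma> s j i assume \<gamma>: "\<gamma> \<in> KK" and i: "i \<le> ?d (s, j)"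
      and 0: "\<And>j'. \<rho> j' < \<rho> j \<Longrightarrow> \<gamma> ((s, j'), 0) = 0"
    obtain \<alpha> \<beta> where *: "\<gamma> = pair \<alpha> \<beta>" "\<alpha> \<in> K" "\<beta> \<in> K" using \<gamma> by blast
    have "i \<le> n j" using i by (cases s) auto
    then show "\<gamma> ((s, j), i) = \<gamma> ((s, j), 0)"
      using \<rho>(2)[OF *(2), of i j] \<rho>(2)[OF *(3), of i j] 0 by (cases s) (auto simp: *)
  qed (use L n_pos \<rho>(1) in auto)
  then show thesis by (rule that)
qed

end

section \<open>Relations among characteristic vectors\<close>

definition relations :: "('m::finite \<Rightarrow> nat) \<Rightarrow> ('m \<times> nat \<Rightarrow> bit ^ 'n) \<Rightarrow> ('m \<times> nat \<Rightarrow> bit) set" where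
  "relations n lm = {\<alpha>. (\<forall>p. p \<notin> block_idx n \<longrightarrow> \<alpha> p = 0) \<and> (\<Sum>p\<in>block_idx n. \<alpha> p *s lm p) = 0}"

lemma vec_bit_add_self [simp]: "v + v = (0 :: bit ^ 'n)"
  by (simp add: vec_eq_iff)

lemma vec_bit_add_eq_0_iff: "v + w = 0 \<longleftrightarrow> v = (w :: bit ^ 'n)"
  by (simp add: vec_eq_iff bit_add_eq_0_iff)

lemma card_punctured_blocks:
  fixes n :: "'m::finite \<Rightarrow> nat"
  assumes "\<And>j. \<iota> j \<le> n j"
  shows "finite {(j, i). i \<le> n j \<and> i \<noteq> \<iota> j}" "card {(j, i). i \<le> n j \<and> i \<noteq> \<iota> j} = (\<Sum>j\<in>UNIV. n j)"
proof -
  have A: "{(j, i). i \<le> n j \<and> i \<noteq> \<iota> j} = (SIGMA j:UNIV. {..n j} - {\<iota> j})" by auto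
  show "finite {(j, i). i \<le> n j \<and> i \<noteq> \<iota> j}" "card {(j, i). i \<le> n j \<and> i \<noteq> \<iota> j} = (\<Sum>j\<in>UNIV. n j)"
    unfolding A using assms by simp_all
qed

lemma basis_combination:
  fixes f :: "'i \<Rightarrow> bit ^ 'n::finite"
  assumes "finite A" "card A = CARD('n)" and inj: "inj_on f A" and ind: "vec.independent (f ` A)"
  obtains u where "t = (\<Sum>p\<in>A. u p *s f p)"
proof -
  have "card (f ` A) = CARD('n)" using assms by (simp add: card_image)
  then have "UNIV \<subseteq> vec.span (f ` A)"
    using ind by (intro vec.card_ge_dim_independent) (auto simp: card_cart_basis)
  then have "t \<in> range (\<lambda>u. \<Sum>v\<in>f ` A. u v *s v)" using vec.span_finite[of "f ` A"] assms(1) by auto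
  then obtain u where "t = (\<Sum>v\<in>f ` A. u v *s v)" by auto
  then have "t = (\<Sum>p\<in>A. u (f p) *s f p)" using inj by (simp add: sum.reindex)
  then show thesis by (rule that)
qed

text \<open>Omitting one facet from each block leaves as many facets as the dimension; their vectors
  form a basis, so the coefficients of the omitted facets can be prescribed and then determine the
  relation.\<close>

lemma sign_group_relations:
  fixes lm :: "'m::finite \<times> nat \<Rightarrow> bit ^ 'n::finite"
  assumes card: "CARD('n) = (\<Sum>j\<in>UNIV. n j)"
    and basis: "\<And>\<iota>. (\<And>j. \<iota> j \<le> n j) \<Longrightarrow> inj_on lm {(j, i). i \<le> n j \<and> i \<noteq> \<iota> j} \<and>
      vec.independent (lm ` {(j, i). i \<le> n j \<and> i \<noteq> \<iota> j})"
  shows "sign_group n (relations n lm)"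
proof
  fix \<alpha> \<beta> assume "\<alpha> \<in> relations n lm" "\<beta> \<in> relations n lm"
  then show "(\<lambda>p. \<alpha> p + \<beta> p) \<in> relations n lm"
    by (simp add: relations_def vec.scale_left_distrib sum.distrib)
next
  fix \<iota> :: "'m \<Rightarrow> nat" and T :: "'m \<Rightarrow> bit" assume \<iota>: "\<And>j. \<iota> j \<le> n j"
  define A where "A = {(j, i). i \<le> n j \<and> i \<noteq> \<iota> j}"
  have inj: "inj_on lm A" and ind: "vec.independent (lm ` A)" using basis[OF \<iota>] by (simp_all add: A_def)
  have finA: "finite A" and "card A = (\<Sum>j\<in>UNIV. n j)"
    unfolding A_def by (rule card_punctured_blocks[of \<iota> n], rule \<iota>)+
  then have cardA: "card A = CARD('n)" using card by simp
  have split: "block_idx n = A \<union> (\<lambda>j. (j, \<iota> j)) ` UNIV" "A \<inter> (\<lambda>j. (j, \<iota> j)) ` UNIV = {}"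
    using \<iota> by (auto simp: block_idx_def A_def)
  have sum_split: "(\<Sum>p\<in>block_idx n. \<alpha> p *s lm p) = (\<Sum>p\<in>A. \<alpha> p *s lm p) + (\<Sum>j\<in>UNIV. \<alpha> (j, \<iota> j) *s lm (j, \<iota> j))"
    for \<alpha>
    unfolding split(1) using split(2) finA
    by (subst sum.union_disjoint) (auto simp: sum.reindex inj_on_def)
  define t where "t = (\<Sum>j\<in>UNIV. T j *s lm (j, \<iota> j))"
  obtain u where u: "t = (\<Sum>p\<in>A. u p *s lm p)" by (rule basis_combination[OF finA cardA inj ind])
  define \<alpha> where "\<alpha> p = (if p \<in> A then u p else if p \<in> block_idx n then T (fst p) else 0)" for p
  have \<alpha>\<iota>: "\<alpha> (j, \<iota> j) = T j" for j using \<iota> by (simp add: \<alpha>_def A_def block_idx_def)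
  have "(\<Sum>p\<in>A. \<alpha> p *s lm p) = t" unfolding u by (intro sum.cong) (simp_all add: \<alpha>_def)
  then have "(\<Sum>p\<in>block_idx n. \<alpha> p *s lm p) = 0"
    unfolding sum_split by (simp add: \<alpha>\<iota> t_def[symmetric])
  then have \<alpha>: "\<alpha> \<in> relations n lm" using split by (auto simp: relations_def \<alpha>_def)
  show "\<exists>!\<alpha>. \<alpha> \<in> relations n lm \<and> (\<forall>j. \<alpha> (j, \<iota> j) = T j)"
  proof (rule ex1I[of _ \<alpha>])
    fix \<beta> assume \<beta>: "\<beta> \<in> relations n lm \<and> (\<forall>j. \<beta> (j, \<iota> j) = T j)"
    have "(\<Sum>p\<in>A. \<alpha> p *s lm p) = (\<Sum>p\<in>A. \<beta> p *s lm p)"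
      using \<alpha> \<beta> unfolding relations_def mem_Collect_eq sum_split
      by (simp add: \<alpha>\<iota> vec_bit_add_eq_0_iff)
    then have "(\<Sum>p\<in>A. (\<alpha> p + \<beta> p) *s lm p) = 0"
      by (simp add: vec.scale_left_distrib sum.distrib)
    then have "(\<Sum>v\<in>lm ` A. (\<alpha> (inv_into A lm v) + \<beta> (inv_into A lm v)) *s v) = 0"
      using inj by (simp add: sum.reindex inv_into_f_f)
    then have "\<alpha> (inv_into A lm v) + \<beta> (inv_into A lm v) = 0" if "v \<in> lm ` A" for v
      using vec.independentD[OF ind, of "lm ` A" "\<lambda>v. \<alpha> (inv_into A lm v) + \<beta> (inv_into A lm v)" v]
        finA that by auto
    then have "\<alpha> p + \<beta> p = 0" if "p \<in> A" for p
      using inj that by (metis imageI inv_into_f_f)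
    moreover have "\<alpha> p = \<beta> p" if pA: "p \<notin> A" for p
    proof (cases "p \<in> block_idx n")
      case True
      then obtain j where "p = (j, \<iota> j)" using split pA by auto
      then show ?thesis using \<alpha>\<iota> \<beta> by simp
    next
      case False
      then show ?thesis using \<alpha> \<beta> by (simp add: relations_def)
    qed
    ultimately show "\<beta> = \<alpha>" by (metis (no_types, lifting) bit_add_eq_0_iff ext)
  qed (use \<alpha> \<alpha>\<iota> in simp)
qed

section \<open>Facets of a product of simplices\<close>

locale simplex_product =
  fixes S :: "'m::finite \<Rightarrow> 'a::euclidean_space set" and n :: "'m \<Rightarrow> nat" and P :: "('a ^ 'm) set"
    and vtx :: "'m \<Rightarrow> nat \<Rightarrow> 'a"
  assumes inj_vtx: "inj_on (vtx j) {..n j}" and indep: "\<not> affine_dependent (vtx j ` {..n j})"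
    and S: "S j = convex hull (vtx j ` {..n j})" and P: "P = {x. \<forall>j. x $ j \<in> S j}"
    and n_pos: "0 < n j"
begin

definition point :: "('m \<times> nat \<Rightarrow> real) \<Rightarrow> 'a ^ 'm" where
  "point u = (\<chi> j. \<Sum>i\<le>n j. u (j, i) *\<^sub>R vtx j i)"

definition bary :: "('m \<times> nat \<Rightarrow> real) \<Rightarrow> bool" where
  "bary u \<longleftrightarrow> (\<forall>p\<in>block_idx n. 0 \<le> u p) \<and> (\<forall>j. (\<Sum>i\<le>n j. u (j, i)) = 1)"

text \<open>The facet opposite to vertex i of the j-th simplex, for p = (j, i); equivalently, the
  vanishing of that barycentric coordinate.\<close>

definition facet :: "'m \<times> nat \<Rightarrow> ('a ^ 'm) set" where
  "facet p = {x \<in> P. x $ fst p \<in> convex hull (vtx (fst p) ` ({..n (fst p)} - {snd p}))}"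

lemma hull_iff:
  assumes "I \<subseteq> {..n j}"
  shows "y \<in> convex hull (vtx j ` I) \<longleftrightarrow>
    (\<exists>u. (\<forall>i\<in>I. 0 \<le> u i) \<and> (\<Sum>i\<in>I. u i) = 1 \<and> (\<Sum>i\<in>I. u i *\<^sub>R vtx j i) = y)"
proof -
  have inj: "inj_on (vtx j) I" using inj_vtx assms by (rule inj_on_subset)
  have fin: "finite I" using assms by (rule finite_subset) simp
  have "y \<in> convex hull (vtx j ` I) \<longleftrightarrow>
    (\<exists>u. (\<forall>v\<in>vtx j ` I. 0 \<le> u v) \<and> sum u (vtx j ` I) = 1 \<and> (\<Sum>v\<in>vtx j ` I. u v *\<^sub>R v) = y)"
    using fin by (simp add: convex_hull_finite)
  also have "\<dots> \<longleftrightarrow> (\<exists>u. (\<forall>i\<in>I. 0 \<le> u i) \<and> (\<Sum>i\<in>I. u i) = 1 \<and> (\<Sum>i\<in>I. u i *\<^sub>R vtx j i) = y)"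
  proof (intro iffI; elim exE)
    fix u assume "(\<forall>v\<in>vtx j ` I. 0 \<le> u v) \<and> sum u (vtx j ` I) = 1 \<and> (\<Sum>v\<in>vtx j ` I. u v *\<^sub>R v) = y"
    then show "\<exists>u. (\<forall>i\<in>I. 0 \<le> u i) \<and> (\<Sum>i\<in>I. u i) = 1 \<and> (\<Sum>i\<in>I. u i *\<^sub>R vtx j i) = y"
      using inj by (intro exI[of _ "u \<circ> vtx j"]) (simp add: sum.reindex)
  next
    fix u assume "(\<forall>i\<in>I. 0 \<le> u i) \<and> (\<Sum>i\<in>I. u i) = 1 \<and> (\<Sum>i\<in>I. u i *\<^sub>R vtx j i) = y"
    then show "\<exists>u. (\<forall>v\<in>vtx j ` I. 0 \<le> u v) \<and> sum u (vtx j ` I) = 1 \<and> (\<Sum>v\<in>vtx j ` I. u v *\<^sub>R v) = y"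
      using inj by (intro exI[of _ "u \<circ> inv_into I (vtx j)"]) (simp add: sum.reindex inv_into_f_f)
  qed
  finally show ?thesis .
qed

lemma coords_unique:
  assumes "(\<Sum>i\<le>n j. u i) = (\<Sum>i\<le>n j. w i)"
    and "(\<Sum>i\<le>n j. u i *\<^sub>R vtx j i) = (\<Sum>i\<le>n j. w i *\<^sub>R vtx j i)" and "i \<le> n j"
  shows "u i = w i"
proof (rule ccontr)
  assume ne: "u i \<noteq> w i"
  define f where "f v = u (inv_into {..n j} (vtx j) v) - w (inv_into {..n j} (vtx j) v)" for v
  have f: "f (vtx j k) = u k - w k" if "k \<le> n j" for k
    using that inj_vtx by (simp add: f_def inv_into_f_f)
  have "sum f (vtx j ` {..n j}) = 0"
    using inj_vtx assms(1) by (simp add: sum.reindex f sum_subtractf)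
  moreover have "(\<Sum>v\<in>vtx j ` {..n j}. f v *\<^sub>R v) = 0"
    using inj_vtx assms(2) by (simp add: sum.reindex f sum_subtractf scaleR_diff_left)
  moreover have "f (vtx j i) \<noteq> 0" using f[OF assms(3)] ne by simp
  ultimately have "affine_dependent (vtx j ` {..n j})"
    using assms(3) by (subst affine_dependent_explicit_finite) auto
  then show False using indep by blast
qed

lemma P_eq: "P = point ` {u. bary u}"
proof (intro equalityI subsetI)
  fix x assume x: "x \<in> P"
  have "\<forall>j. \<exists>u. (\<forall>i\<in>{..n j}. 0 \<le> u i) \<and> (\<Sum>i\<le>n j. u i) = 1 \<and> (\<Sum>i\<le>n j. u i *\<^sub>R vtx j i) = x $ j"
    using x hull_iff[OF order_refl] by (auto simp: P S)
  then obtain u where u: "\<forall>j. (\<forall>i\<in>{..n j}. 0 \<le> u j i) \<and> (\<Sum>i\<le>n j. u j i) = 1 \<and>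
      (\<Sum>i\<le>n j. u j i *\<^sub>R vtx j i) = x $ j" by metis
  then have "x = point (case_prod u)" "bary (case_prod u)"
    by (auto simp: point_def vec_eq_iff bary_def block_idx_def)
  then show "x \<in> point ` {u. bary u}" by blast
next
  fix x assume "x \<in> point ` {u. bary u}"
  then obtain u where u: "bary u" "x = point u" by auto
  have "x $ j \<in> S j" for j
    unfolding S hull_iff[OF order_refl]
    by (rule exI[of _ "\<lambda>i. u (j, i)"]) (use u in \<open>auto simp: point_def bary_def block_idx_def\<close>)
  then show "x \<in> P" by (simp add: P)
qed

lemma bary_unique:
  assumes "bary u" "bary w" "point u = point w" "p \<in> block_idx n"
  shows "u p = w p"
proof -
  obtain j i where p: "p = (j, i)" "i \<le> n j" using assms(4) by (auto simp: block_idx_def)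
  show ?thesis unfolding p
    by (rule coords_unique[of "\<lambda>i. u (j, i)" j "\<lambda>i. w (j, i)"])
      (use assms p in \<open>auto simp: bary_def point_def vec_eq_iff\<close>)
qed

lemma point_in_facet_iff:
  assumes u: "bary u" and p: "p \<in> block_idx n"
  shows "point u \<in> facet p \<longleftrightarrow> u p = 0"
proof -
  obtain j i where ji: "p = (j, i)" "i \<le> n j" using p by (auto simp: block_idx_def)
  let ?I = "{..n j} - {i}"
  have uP: "point u \<in> P" using u P_eq by auto
  have split: "sum f {..n j} = f i + sum f ?I" for f :: "nat \<Rightarrow> 'c::comm_monoid_add"
    using ji by (intro sum.remove) auto
  show ?thesis
  proof
    assume "point u \<in> facet p"
    then have "point u $ j \<in> convex hull (vtx j ` ?I)" by (simp add: facet_def ji)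
    then obtain w where w: "(\<Sum>k\<in>?I. w k) = 1" "(\<Sum>k\<in>?I. w k *\<^sub>R vtx j k) = point u $ j"
      using hull_iff[of ?I j] by auto
    define w' where "w' k = (if k = i then 0 else w k)" for k
    have "u (j, i) = w' i"
    proof (rule coords_unique[of "\<lambda>i. u (j, i)" j w'])
      show "(\<Sum>i\<le>n j. u (j, i)) = (\<Sum>i\<le>n j. w' i)"
        unfolding split[of w'] using u w by (simp add: bary_def w'_def)
      show "(\<Sum>i\<le>n j. u (j, i) *\<^sub>R vtx j i) = (\<Sum>i\<le>n j. w' i *\<^sub>R vtx j i)"
        unfolding split[of "\<lambda>i. w' i *\<^sub>R vtx j i"] using w by (simp add: w'_def point_def)
    qed (rule ji)
    then show "u p = 0" by (simp add: w'_def ji)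
  next
    assume 0: "u p = 0"
    have "point u $ j \<in> convex hull (vtx j ` ?I)"
      unfolding hull_iff[of ?I j, OF Diff_subset]
    proof (intro exI[of _ "\<lambda>i. u (j, i)"] conjI)
      show "\<forall>i\<in>?I. 0 \<le> u (j, i)" using u by (auto simp: bary_def block_idx_def)
      show "(\<Sum>k\<in>?I. u (j, k)) = 1"
        using u split[of "\<lambda>i. u (j, i)"] 0 by (simp add: bary_def ji)
      show "(\<Sum>k\<in>?I. u (j, k) *\<^sub>R vtx j k) = point u $ j"
        using split[of "\<lambda>i. u (j, i) *\<^sub>R vtx j i"] 0 by (simp add: point_def ji)
    qed
    then show "point u \<in> facet p" using uP by (simp add: facet_def ji)
  qed
qed

lemma polyhedron_P: "polyhedron P"
proof -
  have "polyhedron {x :: 'a ^ 'm. x $ j \<in> S j}" for j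
  proof -
    have "polyhedron (S j)" unfolding S by (intro polytope_imp_polyhedron polytope_convex_hull) simp
    then obtain F where F: "finite F" "S j = \<Inter>F" "\<forall>h\<in>F. \<exists>a b. a \<noteq> 0 \<and> h = {x. a \<bullet> x \<le> b}"
      unfolding polyhedron_def by blast
    have "{x :: 'a ^ 'm. x $ j \<in> S j} = \<Inter>((\<lambda>h. {x. x $ j \<in> h}) ` F)" using F by auto
    moreover have "polyhedron {x :: 'a ^ 'm. x $ j \<in> h}" if h: "h \<in> F" for h
    proof -
      obtain a b where "h = {x. a \<bullet> x \<le> b}" using F h by blast
      then have "{x :: 'a ^ 'm. x $ j \<in> h} = {x. axis j a \<bullet> x \<le> b}" by (simp add: inner_axis' )
      then show ?thesis by (simp add: polyhedron_halfspace_le)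
    qed
    ultimately show ?thesis using F(1) by (auto intro: polyhedron_Inter)
  qed
  moreover have "P = \<Inter>(range (\<lambda>j. {x. x $ j \<in> S j}))" by (auto simp: P)
  ultimately show ?thesis by (auto intro: polyhedron_Inter)
qed

lemma facet_face_of: assumes p: "p \<in> block_idx n" shows "facet p face_of P"
proof -
  obtain j i where ji: "p = (j, i)" "i \<le> n j" using p by (auto simp: block_idx_def)
  have face: "convex hull (vtx j ` ({..n j} - {i})) face_of S j"
    unfolding S face_of_convex_hull_affine_independent[OF indep]
    by (rule exI[of _ "vtx j ` ({..n j} - {i})"]) auto
  let ?T = "convex hull (vtx j ` ({..n j} - {i}))"
  show ?thesis
    unfolding face_of_def
  proof (intro conjI ballI impI)
    show "facet p \<subseteq> P" by (auto simp: facet_def)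
    have "facet p = P \<inter> (\<lambda>x. x $ j) -` ?T" by (auto simp: facet_def ji)
    moreover have "convex ((\<lambda>x :: 'a ^ 'm. x $ j) -` ?T)"
      by (intro convex_linear_vimage bounded_linear.linear bounded_linear_vec_nth convex_convex_hull)
    ultimately show "convex (facet p)" using polyhedron_imp_convex[OF polyhedron_P] by (auto intro: convex_Int)
    fix a b x assume a: "a \<in> P" and b: "b \<in> P" and x: "x \<in> facet p" "x \<in> open_segment a b"
    obtain t where t: "0 < t" "t < 1" "x = (1 - t) *\<^sub>R a + t *\<^sub>R b"
      using x(2) by (auto simp: in_segment)
    have xj: "x $ j \<in> ?T" using x(1) by (simp add: facet_def ji)
    have xt: "x $ j = (1 - t) *\<^sub>R a $ j + t *\<^sub>R b $ j" using t by simp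
    have "a $ j \<in> ?T \<and> b $ j \<in> ?T"
    proof (cases "a $ j = b $ j")
      case True
      then have "x $ j = a $ j" using xt by (simp add: algebra_simps)
      then show ?thesis using xj True by simp
    next
      case False
      then have "x $ j \<in> open_segment (a $ j) (b $ j)" using t xt by (auto simp: in_segment)
      then show ?thesis using face_ofD[OF face _ _ _ xj] a b by (auto simp: P)
    qed
    then show "a \<in> facet p" "b \<in> facet p" using a b by (auto simp: facet_def ji)
  qed
qed

text \<open>A point with positive coordinates lies inside a segment from any given point of P to
  another point of P, so a face containing it contains everything.\<close>

lemma face_containing_positive_point:
  assumes F: "F face_of P" and u: "bary u" "point u \<in> F" and pos: "\<And>p. p \<in> block_idx n \<Longrightarrow> 0 < u p"
  shows "F = P"
proof
  show "F \<subseteq> P" using F by (rule face_of_imp_subset)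
  show "P \<subseteq> F"
  proof
    fix y assume y: "y \<in> P"
    then obtain w where w: "y = point w" "bary w" using P_eq by auto
    define e where "e = Min (u ` block_idx n)"
    have ne: "block_idx n \<noteq> {}" by (auto simp: block_idx_def)
    have e: "0 < e" "\<And>p. p \<in> block_idx n \<Longrightarrow> e \<le> u p"
      using pos ne by (auto simp: e_def)
    \<comment> \<open>The segment from w through u, prolonged beyond u. The smallest coordinate
      \<open>e\<close> of u is a safe amount because the coordinates of w are at most 1.\<close>
    define z where "z p = (1 + e) * u p - e * w p" for p
    have w1: "w p \<le> 1" if p: "p \<in> block_idx n" for p
    proof -
      obtain j i where ji: "p = (j, i)" "i \<le> n j" using p by (auto simp: block_idx_def)
      have "w (j, i) \<le> (\<Sum>i\<le>n j. w (j, i))"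
        using w(2) ji by (intro member_le_sum) (auto simp: bary_def block_idx_def)
      then show ?thesis using w(2) ji by (simp add: bary_def)
    qed
    have z: "bary z"
      unfolding bary_def
    proof (intro conjI ballI allI)
      fix p assume p: "p \<in> block_idx n"
      have "e * w p \<le> e * 1" using w1[OF p] e by (intro mult_left_mono) auto
      moreover have "0 \<le> e * u p" using e pos[OF p] by simp
      ultimately show "0 \<le> z p" using e(2)[OF p] by (simp add: z_def algebra_simps)
    next
      fix j show "(\<Sum>i\<le>n j. z (j, i)) = 1"
        using u(1) w(2) by (simp add: z_def bary_def sum_subtractf sum_distrib_left[symmetric])
    qed
    have pz: "point z = (1 + e) *\<^sub>R point u - e *\<^sub>R y"
      by (simp add: w vec_eq_iff point_def z_def scaleR_diff_left sum_subtractf scaleR_sum_right)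
    show "y \<in> F"
    proof (cases "y = point u")
      case False
      define t where "t = 1 / (1 + e)"
      have t: "0 < t" "t < 1" "t * (1 + e) = 1" "t * e = 1 - t" using e by (auto simp: t_def field_simps)
      have "point u = (1 - t) *\<^sub>R y + t *\<^sub>R point z"
        using t by (simp add: pz scaleR_diff_right)
      moreover have "y \<noteq> point z"
      proof
        assume "y = point z"
        then have "(1 + e) *\<^sub>R y = (1 + e) *\<^sub>R point u" using pz by (simp add: algebra_simps)
        then show False using False e by simp
      qed
      ultimately have "point u \<in> open_segment y (point z)" using t by (auto simp: in_segment)
      moreover have "point z \<in> P" using z P_eq by auto
      ultimately show ?thesis using face_ofD[OF F] y u by blast
    qed (use u in simp)
  qed
qed

lemma facet_barycentre:
  assumes p: "p \<in> block_idx n"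
  obtains u where "bary u" "u p = 0" "\<And>q. q \<in> block_idx n \<Longrightarrow> q \<noteq> p \<Longrightarrow> 0 < u q"
proof -
  obtain j i where ji: "p = (j, i)" "i \<le> n j" using p by (auto simp: block_idx_def)
  define u where "u q = (if q = p then 0 else if fst q = j then 1 / n j else 1 / (n (fst q) + 1))" for q :: "'m \<times> nat"
  have "(\<Sum>k\<le>n j'. u (j', k)) = 1" for j'
  proof (cases "j' = j")
    case True
    have "(\<Sum>k\<le>n j. u (j, k)) = u (j, i) + (\<Sum>k\<in>{..n j} - {i}. u (j, k))"
      using ji by (intro sum.remove) auto
    also have "(\<Sum>k\<in>{..n j} - {i}. u (j, k)) = (\<Sum>k\<in>{..n j} - {i}. 1 / n j)"
      by (intro sum.cong) (auto simp: u_def ji)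
    finally show ?thesis using True ji n_pos[of j] by (simp add: u_def)
  next
    case False
    then have "(\<Sum>k\<le>n j'. u (j', k)) = (\<Sum>k\<le>n j'. 1 / (n j' + 1))"
      by (intro sum.cong) (auto simp: u_def ji)
    then show ?thesis by simp
  qed
  then have "bary u" by (auto simp: bary_def u_def)
  moreover have "u p = 0" by (simp add: u_def)
  moreover have "0 < u q" if "q \<noteq> p" for q using that n_pos[of j] by (simp add: u_def)
  ultimately show thesis using that by blast
qed

lemma facet_subset_imp_eq:
  assumes "p \<in> block_idx n" "q \<in> block_idx n" "facet p \<subseteq> facet q"
  shows "p = q"
proof (rule ccontr)
  assume "p \<noteq> q"
  obtain u where u: "bary u" "u p = 0" "\<And>q. q \<in> block_idx n \<Longrightarrow> q \<noteq> p \<Longrightarrow> 0 < u q"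
    using facet_barycentre[OF assms(1)] by metis
  then have "point u \<in> facet p" using point_in_facet_iff assms(1) by blast
  then have "u q = 0" using point_in_facet_iff[OF u(1) assms(2)] assms(3) by auto
  then show False using u(3)[OF assms(2)] \<open>p \<noteq> q\<close> by auto
qed

section \<open>Identification of all facets\<close>

lemma facet_of_subset:
  assumes F: "F facet_of P"
  shows "\<exists>p\<in>block_idx n. F \<subseteq> facet p"
proof -
  have face: "F face_of P" and "F \<noteq> {}" and dim: "aff_dim F = aff_dim P - 1"
    using F by (auto simp: facet_of_def)
  have "convex F" using face by (rule face_of_imp_convex)
  \<comment> \<open>A relative interior point has a vanishing coordinate p, since F is proper; the
    face \<open>facet p\<close> meets the relative interior of F and therefore contains F.\<close>
  then obtain x where x: "x \<in> rel_interior F" using \<open>F \<noteq> {}\<close> rel_interior_eq_empty by blast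
  then have xF: "x \<in> F" using rel_interior_subset by blast
  then have "x \<in> P" using face face_of_imp_subset by blast
  then obtain u where u: "x = point u" "bary u" using P_eq by auto
  have "\<not> (\<forall>p\<in>block_idx n. 0 < u p)"
  proof
    assume "\<forall>p\<in>block_idx n. 0 < u p"
    then have "F = P" using face_containing_positive_point[OF face u(2)] xF u(1) by simp
    then show False using dim by simp
  qed
  then obtain p where p: "p \<in> block_idx n" "u p = 0" using u(2) by (fastforce simp: bary_def)
  have "F \<subseteq> facet p"
    by (rule subset_of_face_of[OF facet_face_of[OF p(1)] face_of_imp_subset[OF face]])
      (use x u p point_in_facet_iff[OF u(2) p(1)] in auto)
  then show ?thesis using p by blast
qed

text \<open>Instead of a dimension count, a sandwich: \<open>facet p\<close> lies in some facet,
  which lies in some \<open>facet q\<close>, and then p = q.\<close>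

lemma facet_facet_of:
  assumes p: "p \<in> block_idx n"
  shows "facet p facet_of P"
proof -
  obtain u where u: "bary u" "u p = 0" using facet_barycentre[OF p] by metis
  have "facet p \<noteq> {}" using point_in_facet_iff[OF u(1) p] u(2) by auto
  moreover have "facet p \<noteq> P"
  proof
    assume eq: "facet p = P"
    obtain j i where ji: "p = (j, i)" "i \<le> n j" using p by (auto simp: block_idx_def)
    obtain i' where i': "i' \<le> n j" "i' \<noteq> i"
      using n_pos[of j] by (metis le0 less_numeral_extra(3) order_refl)
    have "(j, i') \<in> block_idx n" using i' by (simp add: block_idx_def)
    moreover have "facet (j, i') \<subseteq> facet p" unfolding eq by (auto simp: facet_def)
    ultimately show False using facet_subset_imp_eq[OF _ p] i' ji by blast
  qed
  ultimately obtain F where F: "F facet_of P" "facet p \<subseteq> F"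
    using face_of_polyhedron_subset_facet[OF polyhedron_P facet_face_of[OF p]] by blast
  obtain q where q: "q \<in> block_idx n" "F \<subseteq> facet q" using facet_of_subset[OF F(1)] by blast
  then have "p = q" using F(2) facet_subset_imp_eq[OF p] by blast
  then have "F = facet p" using q F by blast
  then show ?thesis using F by simp
qed

lemma facets_P: "{F. F facet_of P} = facet ` block_idx n"
proof (intro equalityI subsetI)
  fix F assume "F \<in> {F. F facet_of P}"
  then have F: "F facet_of P" by simp
  then obtain p where p: "p \<in> block_idx n" "F \<subseteq> facet p" using facet_of_subset by blast
  have fp: "facet p facet_of P" using facet_facet_of p by blast
  have "F face_of facet p"
    using F p(2) by (meson facet_of_imp_face_of face_of_subset facet_of_imp_subset fp)
  then have "F = facet p"
    using F fp face_of_aff_dim_lt[of "facet p" F] face_of_imp_convex[OF facet_face_of[OF p(1)]]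
    by (auto simp: facet_of_def)
  then show "F \<in> facet ` block_idx n" using p by blast
qed (use facet_facet_of in auto)

lemma inj_on_facet: "inj_on facet (block_idx n)"
  by (rule inj_onI) (metis facet_subset_imp_eq order_refl)

lemma characteristic_basis:
  fixes lam :: "('a ^ 'm) set \<Rightarrow> bit ^ 'n::finite"
  assumes lam: "characteristic_function P lam" and \<iota>: "\<And>j. \<iota> j \<le> n j"
  shows "inj_on (lam \<circ> facet) {(j, i). i \<le> n j \<and> i \<noteq> \<iota> j}"
    and "vec.independent ((lam \<circ> facet) ` {(j, i). i \<le> n j \<and> i \<noteq> \<iota> j})"
proof -
  define A where "A = {(j, i). i \<le> n j \<and> i \<noteq> \<iota> j}"
  have A: "A \<subseteq> block_idx n" by (auto simp: A_def block_idx_def)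
  \<comment> \<open>The vertex of P given by \<open>\<iota>\<close>, at which all the selected
    facets meet.\<close>
  define u where "u p = (if snd p = \<iota> (fst p) then 1 else 0 :: real)" for p
  have u: "bary u" using \<iota> by (simp add: bary_def u_def)
  have "point u \<in> facet p" if "p \<in> A" for p
    using point_in_facet_iff[OF u subsetD[OF A that]] that by (auto simp: A_def u_def)
  then have "\<Inter>(facet ` A) \<noteq> {}" by blast
  moreover have "facet ` A \<subseteq> {F. F facet_of P}" using A facets_P by auto
  ultimately have "inj_on lam (facet ` A)" "vec.independent (lam ` facet ` A)"
    using lam unfolding characteristic_function_def by blast+
  moreover have "inj_on facet A" using inj_on_facet A by (rule inj_on_subset)
  ultimately show "inj_on (lam \<circ> facet) {(j, i). i \<le> n j \<and> i \<noteq> \<iota> j}"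
      "vec.independent ((lam \<circ> facet) ` {(j, i). i \<le> n j \<and> i \<noteq> \<iota> j})"
    by (auto simp: A_def image_comp intro: comp_inj_on)
qed

lemma sign_group_characteristic:
  fixes lam :: "('a ^ 'm) set \<Rightarrow> bit ^ 'n::finite"
  assumes "CARD('n) = (\<Sum>j\<in>UNIV. n j)" and "characteristic_function P lam"
  shows "sign_group n (relations n (lam \<circ> facet))"
  using sign_group_relations[OF assms(1)] characteristic_basis[OF assms(2)] by blast

end

section \<open>Coverings and motion planners\<close>

text \<open>A compact domain and a Hausdorff target make p a closed map, and with saturation an open
  map onto its image. Freeness separates the points of an orbit, which yields a neighbourhood with
  disjoint translates, the sheets.\<close>

lemma covering_space_orbit_map:
  fixes p :: "'a::metric_space \<Rightarrow> 'b::t2_space" and act :: "'k \<Rightarrow> 'a \<Rightarrow> 'a"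
  assumes X: "compact X" "continuous_on X p" and \<Gamma>: "finite \<Gamma>"
    and one: "e \<in> \<Gamma>" "\<And>x. x \<in> X \<Longrightarrow> act e x = x"
    and act: "\<And>\<gamma>. \<gamma> \<in> \<Gamma> \<Longrightarrow> continuous_on X (act \<gamma>)" "\<And>\<gamma> x. \<gamma> \<in> \<Gamma> \<Longrightarrow> x \<in> X \<Longrightarrow> act \<gamma> x \<in> X"
    and involutive: "\<And>\<gamma> x. \<gamma> \<in> \<Gamma> \<Longrightarrow> x \<in> X \<Longrightarrow> act \<gamma> (act \<gamma> x) = x"
    and fibre: "\<And>x y. x \<in> X \<Longrightarrow> y \<in> X \<Longrightarrow> p x = p y \<longleftrightarrow> (\<exists>\<gamma>\<in>\<Gamma>. y = act \<gamma> x)"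
    and free: "\<And>x \<gamma> \<delta>. x \<in> X \<Longrightarrow> \<gamma> \<in> \<Gamma> \<Longrightarrow> \<delta> \<in> \<Gamma> \<Longrightarrow> act \<gamma> x = act \<delta> x \<Longrightarrow> \<gamma> = \<delta>"
  shows "covering_space X p (p ` X)"
proof
  have act_image: "act \<gamma> ` W = X \<inter> act \<gamma> -` W" if "\<gamma> \<in> \<Gamma>" "W \<subseteq> X" for \<gamma> W
  proof (intro equalityI subsetI)
    fix y assume "y \<in> X \<inter> act \<gamma> -` W"
    then show "y \<in> act \<gamma> ` W" using involutive[OF that(1), of y] by (metis IntD1 IntD2 image_eqI vimageD)
  qed (use that involutive act(2) in auto)
  have act_open: "openin (top_of_set X) (act \<gamma> ` W)" if "\<gamma> \<in> \<Gamma>" "openin (top_of_set X) W" for \<gamma> W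
    unfolding act_image[OF that(1) openin_imp_subset[OF that(2)]]
    by (rule continuous_openin_preimage[OF act(1)]) (use that act(2) in auto)
  have p_act: "p (act \<gamma> x) = p x" if "\<gamma> \<in> \<Gamma>" "x \<in> X" for \<gamma> x
    using fibre[of x "act \<gamma> x"] that act(2) by metis
  have preimage: "X \<inter> p -` (p ` W) = (\<Union>\<gamma>\<in>\<Gamma>. act \<gamma> ` W)" if "W \<subseteq> X" for W
  proof (intro equalityI subsetI)
    fix y assume "y \<in> X \<inter> p -` (p ` W)"
    then obtain w where "y \<in> X" "w \<in> W" "p w = p y" by auto
    then show "y \<in> (\<Union>\<gamma>\<in>\<Gamma>. act \<gamma> ` W)" using fibre[of w y] that by auto
  next
    fix y assume "y \<in> (\<Union>\<gamma>\<in>\<Gamma>. act \<gamma> ` W)"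
    then obtain \<gamma> w where *: "\<gamma> \<in> \<Gamma>" "w \<in> W" "y = act \<gamma> w" by blast
    then show "y \<in> X \<inter> p -` (p ` W)" using act(2)[of \<gamma> w] p_act[of \<gamma> w] that by auto
  qed
  have p_open: "openin (top_of_set (p ` X)) (p ` W)" if W: "openin (top_of_set X) W" for W
  proof -
    have WX: "W \<subseteq> X" using W by (rule openin_imp_subset)
    have o: "openin (top_of_set X) (X \<inter> p -` (p ` W))"
      unfolding preimage[OF WX] using act_open W by blast
    then have "closedin (top_of_set X) (X - (X \<inter> p -` (p ` W)))"
      using closedin_diff[of "top_of_set X" X] by simp
    then have "compact (X - (X \<inter> p -` (p ` W)))" using X(1) closedin_compact by blast
    then have "compact (p ` (X - (X \<inter> p -` (p ` W))))"
      by (rule compact_continuous_image[OF continuous_on_subset[OF X(2)], rotated]) auto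
    then have "closed (p ` (X - (X \<inter> p -` (p ` W))))" by (rule compact_imp_closed)
    moreover have "T = p ` X - p ` (X - (X \<inter> p -` T))" if "T \<subseteq> p ` X" for T
      using that by blast
    then have "p ` W = p ` X - p ` (X - (X \<inter> p -` (p ` W)))" using WX by blast
    ultimately show ?thesis
      by (metis open_Compl openin_open Diff_eq)
  qed
  show "continuous_on X p" by fact
  show "p ` X = p ` X" ..
  fix y assume "y \<in> p ` X"
  then obtain x where x: "x \<in> X" "y = p x" by auto
  \<comment> \<open>Half the least distance within the orbit of x serves as radius; the entry 1
    keeps the set nonempty when \<open>\<Gamma>\<close> has one element.\<close>
  define D where "D = insert 1 ((\<lambda>z. dist (act (fst z) x) (act (snd z) x)) ` {z \<in> \<Gamma> \<times> \<Gamma>. fst z \<noteq> snd z})"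
  have finD: "finite D" using \<Gamma> by (simp add: D_def)
  have D0: "0 < r" if "r \<in> D" for r using that free[OF x(1)] by (auto simp: D_def)
  define A where "A \<gamma> = ball (act \<gamma> x) (Min D / 2)" for \<gamma>
  have "Min D \<in> D" using finD by (intro Min_in) (auto simp: D_def)
  then have A1: "open (A \<gamma>)" "act \<gamma> x \<in> A \<gamma>" for \<gamma> using D0 by (auto simp: A_def)
  have A2: "A \<gamma> \<inter> A \<delta> = {}" if "\<gamma> \<in> \<Gamma>" "\<delta> \<in> \<Gamma>" "\<gamma> \<noteq> \<delta>" for \<gamma> \<delta>
  proof -
    have "Min D \<le> dist (act \<gamma> x) (act \<delta> x)" 
      using finD that by (intro Min_le) (auto simp: D_def intro!: image_eqI[of _ _ "(\<gamma>, \<delta>)"])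
    then show ?thesis by (auto simp: A_def disjoint_ballI)
  qed
  define U where "U = (\<Inter>\<gamma>\<in>\<Gamma>. X \<inter> act \<gamma> -` A \<gamma>)"
  have U: "openin (top_of_set X) U" unfolding U_def
  proof (rule openin_INT2)
    show "finite \<Gamma>" "\<Gamma> \<noteq> {}" using \<Gamma> one by auto
    show "openin (top_of_set X) (X \<inter> act \<gamma> -` A \<gamma>)" if "\<gamma> \<in> \<Gamma>" for \<gamma>
      by (intro continuous_openin_preimage_gen act(1) that A1)
  qed
  then have UX: "U \<subseteq> X" by (rule openin_imp_subset)
  have xU: "x \<in> U" using x A1 one by (auto simp: U_def)
  have disj: "act \<gamma> ` U \<inter> act \<delta> ` U = {}" if "\<gamma> \<in> \<Gamma>" "\<delta> \<in> \<Gamma>" "\<gamma> \<noteq> \<delta>" for \<gamma> \<delta>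
  proof -
    have "act \<gamma> ` U \<subseteq> A \<gamma>" "act \<delta> ` U \<subseteq> A \<delta>" using that by (auto simp: U_def)
    then show ?thesis using A2[OF that] by blast
  qed
  have inj: "inj_on p U"
  proof (rule inj_onI)
    fix u u' assume u: "u \<in> U" "u' \<in> U" "p u = p u'"
    then obtain \<delta> where \<delta>: "\<delta> \<in> \<Gamma>" "u' = act \<delta> u" using fibre UX by blast
    have "u' = act e u'" using one u UX by auto
    then have "act \<delta> ` U \<inter> act e ` U \<noteq> {}" using \<delta> u by blast
    then have "\<delta> = e" using disj \<delta> one by blast
    then show "u = u'" using \<delta> one u UX by auto
  qed
  show "\<exists>T. y \<in> T \<and> openin (top_of_set (p ` X)) T \<and>
      (\<exists>v. \<Union> v = X \<inter> p -` T \<and> (\<forall>u\<in>v. openin (top_of_set X) u) \<and> pairwise disjnt v \<and>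
        (\<forall>u\<in>v. \<exists>q. homeomorphism u T p q))"
  proof (intro exI[of _ "p ` U"] conjI exI[of _ "(\<lambda>\<gamma>. act \<gamma> ` U) ` \<Gamma>"] ballI)
    show "y \<in> p ` U" using x xU by auto
    show "openin (top_of_set (p ` X)) (p ` U)" by (rule p_open[OF U])
    show "\<Union> ((\<lambda>\<gamma>. act \<gamma> ` U) ` \<Gamma>) = X \<inter> p -` (p ` U)" using preimage[OF UX] by simp
    show "openin (top_of_set X) V" if "V \<in> (\<lambda>\<gamma>. act \<gamma> ` U) ` \<Gamma>" for V using that act_open U by auto
    show "pairwise disjnt ((\<lambda>\<gamma>. act \<gamma> ` U) ` \<Gamma>)"
      using disj by (auto simp: pairwise_def disjnt_def)
    fix V assume "V \<in> (\<lambda>\<gamma>. act \<gamma> ` U) ` \<Gamma>"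
    then obtain \<gamma> where \<gamma>: "\<gamma> \<in> \<Gamma>" "V = act \<gamma> ` U" by auto
    have VX: "V \<subseteq> X" using \<gamma> UX act(2) by auto
    have V: "openin (top_of_set X) V" using act_open[OF \<gamma>(1) U] \<gamma> by simp
    show "\<exists>q. homeomorphism V (p ` U) p q"
    proof (rule homeomorphism_injective_open_map)
      show "continuous_on V p" using X(2) VX by (rule continuous_on_subset)
      show pV: "p ` V = p ` U" unfolding \<gamma>(2) image_image using p_act[OF \<gamma>(1)] UX by (intro image_cong) auto
      show "inj_on p V"
      proof (rule inj_onI)
        fix a b assume ab: "a \<in> V" "b \<in> V" "p a = p b"
        then obtain u u' where u: "u \<in> U" "u' \<in> U" "a = act \<gamma> u" "b = act \<gamma> u'"
          unfolding \<gamma>(2) by blast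
        have "p u = p u'"
          using p_act[OF \<gamma>(1) subsetD[OF UX u(1)]] p_act[OF \<gamma>(1) subsetD[OF UX u(2)]] ab(3) u by simp
        then show "a = b" using inj_onD[OF inj] u by blast
      qed
      show "openin (top_of_set (p ` U)) (p ` W)" if "openin (top_of_set V) W" for W
      proof -
        have "openin (top_of_set X) W" using that V by (rule openin_trans)
        then have "openin (top_of_set (p ` X)) (p ` W)" by (rule p_open)
        moreover have "p ` W \<subseteq> p ` U" using openin_imp_subset[OF that] pV by blast
        moreover have "p ` U \<subseteq> p ` X" using UX by blast
        ultimately show ?thesis by (rule openin_subset_trans)
      qed
    qed auto
  qed
qed

text \<open>One half of the exponential law, which holds because the unit interval is locally
  compact.\<close>

lemma continuous_map_path_evaluation:
  assumes "continuous_map Y (path_space M) s"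
  shows "continuous_map (prod_topology (top_of_set {0..1}) Y) M (\<lambda>(t, y). s y t)"
proof -
  have s: "s y \<in> topspace (path_space M)" if "y \<in> topspace Y" for y
    using assms that by (auto simp: continuous_map_def Pi_iff)
  have path: "continuous_map (top_of_set {0..1}) M (s y)" if "y \<in> topspace Y" for y
    using s[OF that] unfolding path_space_def compact_open_topology_def topology_generated_by_topspace
    by auto
  show ?thesis
    unfolding continuous_map_def
  proof (intro conjI allI impI)
    show "(\<lambda>(t, y). s y t) \<in> topspace (prod_topology (top_of_set {0..1}) Y) \<rightarrow> topspace M"
      using path by (force simp: continuous_map_def Pi_iff)
    fix W assume W: "openin M W"
    show "openin (prod_topology (top_of_set {0..1}) Y)
        {z \<in> topspace (prod_topology (top_of_set {0..1}) Y). (case z of (t, y) \<Rightarrow> s y t) \<in> W}"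
      unfolding openin_prod_topology_alt
    proof (intro allI impI)
      fix t y assume "(t, y) \<in> {z \<in> topspace (prod_topology (top_of_set {0..1}) Y). (case z of (t, y) \<Rightarrow> s y t) \<in> W}"
      then have t: "t \<in> {0..1}" and y: "y \<in> topspace Y" and "s y t \<in> W" by auto
      have "openin (top_of_set {0..1}) {t \<in> {0..1}. s y t \<in> W}"
        using path[OF y] W by (auto simp: continuous_map_def)
      then obtain e where e: "0 < e" "\<And>t'. t' \<in> {0..1} \<Longrightarrow> dist t' t < e \<Longrightarrow> s y t' \<in> W"
        using t \<open>s y t \<in> W\<close> unfolding openin_euclidean_subtopology_iff by blast
      \<comment> \<open>A compact neighbourhood of t on which the path stays in W; with half the
        radius it remains inside the ball of radius e.\<close>
      define C where "C = {0..1} \<inter> cball t (e / 2)"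
      have "compact C" unfolding C_def by (intro compact_Int compact_cball) auto
      then have cC: "compactin (top_of_set {0..1}) C"
        by (auto simp: compactin_subtopology C_def)
      define N where "N = {f \<in> extensional (topspace (top_of_set {0..1::real})).
          continuous_map (top_of_set {0..1}) M f \<and> f ` C \<subseteq> W}"
      have "openin (path_space M) N"
        unfolding path_space_def compact_open_topology_def N_def
        by (rule topology_generated_by_Basis) (use cC W in blast)
      then have "openin Y {y \<in> topspace Y. s y \<in> N}" using assms by (auto simp: continuous_map_def)
      moreover have "s y ` C \<subseteq> W" using e by (auto simp: C_def dist_commute)
      then have "y \<in> {y \<in> topspace Y. s y \<in> N}"
        using y path[OF y] s[OF y] unfolding N_def path_space_def compact_open_topology_def topology_generated_by_topspace
        by auto
      moreover have "openin (top_of_set {0..1}) ({0..1} \<inter> ball t (e / 2))" by (simp add: openin_open_Int)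
      moreover have "t \<in> {0..1} \<inter> ball t (e / 2)" using t e by auto
      moreover have "({0..1} \<inter> ball t (e / 2)) \<times> {y \<in> topspace Y. s y \<in> N} \<subseteq>
          {z \<in> topspace (prod_topology (top_of_set {0..1}) Y). (case z of (t, y) \<Rightarrow> s y t) \<in> W}"
      proof clarsimp
        fix t' y' assume *: "0 \<le> t'" "t' \<le> 1" "dist t t' * 2 < e" "y' \<in> topspace Y" "s y' \<in> N"
        then have "t' \<in> C" by (simp add: C_def)
        then show "s y' t' \<in> W" using *(5) by (auto simp: N_def)
      qed
      ultimately show "\<exists>U V. openin (top_of_set {0..1}) U \<and> openin Y V \<and> t \<in> U \<and> y \<in> V \<and> U \<times> V \<subseteq>
          {z \<in> topspace (prod_topology (top_of_set {0..1}) Y). (case z of (t, y) \<Rightarrow> s y t) \<in> W}"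
        by blast
    qed
  qed
qed

section \<open>The real moment-angle manifold\<close>

text \<open>Makes K finite and \<open>bit ^ 'n\<close> a finite index type, as in
  \<open>real ^ (bit ^ 'n)\<close>.\<close>

instance bit :: finite
proof
  have "(UNIV :: bit set) = {0, 1}" by (auto intro: bit_not_zero_iff[THEN iffD1])
  then show "finite (UNIV :: bit set)" by (metis finite.emptyI finite.insertI)
qed

lemma sum_sym_diff_bit:
  fixes f :: "'i \<Rightarrow> bit ^ 'n"
  assumes "finite B" "finite C"
  shows "sum f (sym_diff B C) = sum f B + sum f C"
proof -
  have "sum f B = sum f (B \<inter> C) + sum f (B - C)" "sum f C = sum f (C \<inter> B) + sum f (C - B)"
    by (rule sum.Int_Diff[OF assms(1)], rule sum.Int_Diff[OF assms(2)])
  then have "sum f B + sum f C = sum f (B - C) + sum f (C - B) + (sum f (B \<inter> C) + sum f (B \<inter> C))"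
    by (simp only: Int_commute[of C B] ac_simps)
  also have "\<dots> = sum f (B - C) + sum f (C - B)" by simp
  also have "\<dots> = sum f (sym_diff B C)"
    using assms by (intro sum.union_disjoint[symmetric]) auto
  finally show ?thesis by (rule sym)
qed

lemma uminus_bit_vec [simp]: "- v = (v :: bit ^ 'n)"
  by (simp add: vec_eq_iff)

lemma generated_subgroup_zero: "0 \<in> generated_subgroup A"
  and generated_subgroup_add: "x \<in> generated_subgroup A \<Longrightarrow> y \<in> generated_subgroup A \<Longrightarrow> x + y \<in> generated_subgroup A"
  and generated_subgroup_incl: "x \<in> A \<Longrightarrow> x \<in> generated_subgroup A"
  unfolding generated_subgroup_def by auto

text \<open>Modulo 2, the sums over subsets already form a group: addition corresponds to symmetric
  difference.\<close>

lemma generated_subgroup_bit_vec: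
  fixes f :: "'i \<Rightarrow> bit ^ 'n"
  assumes "finite A"
  shows "generated_subgroup (f ` A) = {sum f C | C. C \<subseteq> A}"
proof
  have fin: "finite C" if "C \<subseteq> A" for C using assms that by (rule finite_subset[rotated])
  let ?H = "{sum f C | C. C \<subseteq> A}"
  have "f ` A \<subseteq> ?H"
  proof
    fix x assume "x \<in> f ` A"
    then obtain a where "a \<in> A" "x = sum f {a}" by auto
    then show "x \<in> ?H" by blast
  qed
  moreover have "0 \<in> ?H" by (intro CollectI exI[of _ "{}"]) simp
  moreover have "x + y \<in> ?H" if xy: "x \<in> ?H" "y \<in> ?H" for x y
  proof -
    from xy obtain B C where "x = sum f B" "y = sum f C" "B \<subseteq> A" "C \<subseteq> A" by blast
    then show ?thesis
      using fin by (intro CollectI exI[of _ "sym_diff B C"]) (auto simp: sum_sym_diff_bit)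
  qed
  ultimately show "generated_subgroup (f ` A) \<subseteq> ?H"
    unfolding generated_subgroup_def by (intro Inter_lower) simp
  show "{sum f C | C. C \<subseteq> A} \<subseteq> generated_subgroup (f ` A)"
  proof clarify
    fix C assume "C \<subseteq> A"
    with fin[OF this] show "sum f C \<in> generated_subgroup (f ` A)"
      by (induction C rule: finite_induct)
        (auto intro: generated_subgroup_zero generated_subgroup_add generated_subgroup_incl)
  qed
qed

lemma card_block_idx_le: "(j, i) \<in> block_idx n \<Longrightarrow> i \<le> (\<Sum>j\<in>UNIV. n j)" for n :: "'m::finite \<Rightarrow> nat"
  by (auto simp: block_idx_def intro: order_trans[OF _ member_le_sum])

locale product_small_cover = simplex_product S n P vtx
  for S :: "'m::finite \<Rightarrow> 'a::euclidean_space set" and n :: "'m \<Rightarrow> nat" and P :: "('a ^ 'm) set"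
    and vtx :: "'m \<Rightarrow> nat \<Rightarrow> 'a" +
  fixes lam :: "('a ^ 'm) set \<Rightarrow> bit ^ 'n::finite"
  assumes card: "CARD('n) = (\<Sum>j\<in>UNIV. n j)" and lam: "characteristic_function P lam"
begin

definition lm :: "'m \<times> nat \<Rightarrow> bit ^ 'n" where "lm = lam \<circ> facet"

definition K :: "('m \<times> nat \<Rightarrow> bit) set" where "K = relations n lm"

sublocale sign_group n K
  unfolding K_def lm_def by (rule sign_group_characteristic[OF card lam])

text \<open>An index i satisfies \<open>i \<le> n j \<le> CARD('n)\<close>, so it fits into
  \<open>'n option\<close>. Thus one Euclidean space houses all blocks; surplus coordinates are set
  to 0.\<close>

definition enc :: "nat \<Rightarrow> 'n option" where "enc = (SOME f. inj_on f {..CARD('n)})"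

lemma inj_enc: "inj_on enc {..CARD('n)}"
proof -
  have "\<exists>f :: nat \<Rightarrow> 'n option. f ` {..CARD('n)} \<subseteq> UNIV \<and> inj_on f {..CARD('n)}"
    by (rule card_le_inj) simp_all
  then show ?thesis unfolding enc_def by (metis (mono_tags, lifting) someI_ex)
qed

definition code :: "'m \<times> nat \<Rightarrow> 'm \<times> 'n option" where "code p = (fst p, enc (snd p))"

lemma inj_code: "inj_on code (block_idx n)"
proof (rule inj_onI)
  fix p q assume pq: "p \<in> block_idx n" "q \<in> block_idx n" "code p = code q"
  have "snd p \<le> CARD('n)" "snd q \<le> CARD('n)"
    using pq card_block_idx_le[of "fst p" "snd p" n] card_block_idx_le[of "fst q" "snd q" n] card by auto
  then have "snd p = snd q" using pq inj_onD[OF inj_enc] by (auto simp: code_def)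
  then show "p = q" using pq by (simp add: code_def prod_eq_iff)
qed

type_synonym (in -) ('i, 'k) coords = "real ^ ('i \<times> 'k option)"

definition crd :: "('m, 'n) coords \<Rightarrow> 'm \<times> nat \<Rightarrow> real" where "crd x p = x $ code p"

definition emb :: "('m \<times> nat \<Rightarrow> real) \<Rightarrow> ('m, 'n) coords" where
  "emb u = (\<chi> q. if q \<in> code ` block_idx n then u (inv_into (block_idx n) code q) else 0)"

lemma crd_emb [simp]: "p \<in> block_idx n \<Longrightarrow> crd (emb u) p = u p"
  using inj_code by (simp add: crd_def emb_def inv_into_f_f)

lemma continuous_on_crd [continuous_intros]: "continuous_on A f \<Longrightarrow> continuous_on A (\<lambda>x. crd (f x) p)"
  unfolding crd_def by (intro continuous_intros)

lemma continuous_on_emb [continuous_intros]: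
  assumes "\<And>p. p \<in> block_idx n \<Longrightarrow> continuous_on A (\<lambda>x. f x p)"
  shows "continuous_on A (\<lambda>x. emb (f x))"
  unfolding emb_def
proof (rule continuous_on_vec_lambda)
  fix q show "continuous_on A (\<lambda>x. if q \<in> code ` block_idx n then f x (inv_into (block_idx n) code q) else 0)"
    using assms[OF inv_into_into, of q code] by (cases "q \<in> code ` block_idx n") auto
qed

definition flip :: "('m \<times> nat \<Rightarrow> bit) \<Rightarrow> ('m, 'n) coords \<Rightarrow> ('m, 'n) coords" where
  "flip \<alpha> x = emb (\<lambda>p. if \<alpha> p = 1 then - crd x p else crd x p)"

abbreviation l1 where "l1 x j \<equiv> \<Sum>i\<le>n j. \<bar>crd x (j, i)\<bar>"

text \<open>The real moment-angle manifold over \<open>P\<close>: a product of unit spheres for the \<open>1\<close>-norm, on which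
  \<open>K\<close> acts freely with quotient the small cover.\<close>

definition X :: "('m, 'n) coords set" where
  "X = {x. (\<forall>q. q \<notin> code ` block_idx n \<longrightarrow> x $ q = 0) \<and> (\<forall>j. l1 x j = 1)}"

lemma mem_block_idx: "(j, i) \<in> block_idx n \<longleftrightarrow> i \<le> n j"
  by (simp add: block_idx_def)

lemma crd_flip: "p \<in> block_idx n \<Longrightarrow> crd (flip \<alpha> x) p = (if \<alpha> p = 1 then - crd x p else crd x p)"
  by (simp add: flip_def)

lemma coords_eqI:
  assumes "\<And>q. q \<notin> code ` block_idx n \<Longrightarrow> x $ q = 0" "\<And>q. q \<notin> code ` block_idx n \<Longrightarrow> y $ q = 0"
    and "\<And>p. p \<in> block_idx n \<Longrightarrow> crd x p = crd y p"
  shows "x = y"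
  unfolding vec_eq_iff
proof
  fix q show "x $ q = y $ q"
    using assms(1,2)[of q] assms(3) by (cases "q \<in> code ` block_idx n") (auto simp: crd_def)
qed

lemma emb_outside: "q \<notin> code ` block_idx n \<Longrightarrow> emb u $ q = 0"
  by (simp add: emb_def)

lemma emb_in_X: "(\<And>j. (\<Sum>i\<le>n j. \<bar>u (j, i)\<bar>) = 1) \<Longrightarrow> emb u \<in> X"
  by (simp add: X_def emb_outside mem_block_idx)

lemma flip_in_X: "x \<in> X \<Longrightarrow> flip \<alpha> x \<in> X"
  unfolding flip_def by (rule emb_in_X) (simp add: X_def if_distrib cong: if_cong)

lemma X_eqI:
  assumes "x \<in> X" "y \<in> X" "\<And>p. p \<in> block_idx n \<Longrightarrow> crd x p = crd y p"
  shows "x = y"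
  using assms by (intro coords_eqI) (auto simp: X_def)

lemma flip_flip: "x \<in> X \<Longrightarrow> flip \<alpha> (flip \<beta> x) = flip (\<lambda>p. \<alpha> p + \<beta> p) x"
  by (intro X_eqI flip_in_X) (auto simp: crd_flip)

lemma flip_zero: "x \<in> X \<Longrightarrow> flip (\<lambda>p. 0) x = x"
  by (intro X_eqI flip_in_X) (auto simp: crd_flip)

lemma continuous_on_flip: "continuous_on A f \<Longrightarrow> continuous_on A (\<lambda>x. flip \<alpha> (f x))"
  unfolding flip_def
proof (rule continuous_on_emb)
  fix p assume "continuous_on A f"
  then show "continuous_on A (\<lambda>x. if \<alpha> p = 1 then - crd (f x) p else crd (f x) p)"
    by (cases "\<alpha> p = 1") (auto intro: continuous_intros)
qed

lemma K_outside: "\<alpha> \<in> K \<Longrightarrow> p \<notin> block_idx n \<Longrightarrow> \<alpha> p = 0"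
  by (auto simp: K_def relations_def)

lemma X_nonzero_coordinate:
  assumes "x \<in> X" shows "\<exists>i\<le>n j. crd x (j, i) \<noteq> 0"
proof (rule ccontr)
  assume "\<not> ?thesis"
  then have "l1 x j = 0" by (intro sum.neutral) auto
  then show False using assms by (simp add: X_def)
qed

lemma flip_free:
  assumes x: "x \<in> X" and \<alpha>: "\<alpha> \<in> K" and \<beta>: "\<beta> \<in> K" and eq: "flip \<alpha> x = flip \<beta> x"
  shows "\<alpha> = \<beta>"
proof -
  obtain \<iota> where \<iota>: "\<And>j. \<iota> j \<le> n j" "\<And>j. crd x (j, \<iota> j) \<noteq> 0" using X_nonzero_coordinate[OF x] by metis
  show ?thesis
  proof (rule K_eqI[OF \<alpha> \<beta> \<iota>(1)])
    fix j
    have "crd (flip \<alpha> x) (j, \<iota> j) = crd (flip \<beta> x) (j, \<iota> j)" using eq by simp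
    then show "\<alpha> (j, \<iota> j) = \<beta> (j, \<iota> j)"
      using \<iota> by (cases "\<alpha> (j, \<iota> j)"; cases "\<beta> (j, \<iota> j)") (auto simp: crd_flip mem_block_idx)
  qed
qed

lemma finite_K: "finite K"
proof (rule finite_subset)
  show "K \<subseteq> {\<alpha>. \<forall>p. (p \<in> block_idx n \<longrightarrow> \<alpha> p \<in> UNIV) \<and> (p \<notin> block_idx n \<longrightarrow> \<alpha> p = 0)}"
    by (simp add: K_outside subset_iff)
  show "finite \<dots>" by (intro finite_set_of_finite_funs) auto
qed

lemma compact_X: "compact X"
proof -
  have "X \<subseteq> cbox (\<chi> q. - 1) (\<chi> q. 1)"
  proof
    fix x assume x: "x \<in> X"
    have "\<bar>x $ q\<bar> \<le> 1" for q
    proof (cases "q \<in> code ` block_idx n")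
      case True
      then obtain j i where *: "q = code (j, i)" "i \<le> n j" by (auto simp: block_idx_def)
      have "\<bar>crd x (j, i)\<bar> \<le> l1 x j"
        by (rule member_le_sum) (use * in auto)
      then show ?thesis using x * by (simp add: X_def crd_def)
    qed (use x in \<open>simp add: X_def\<close>)
    then show "x \<in> cbox (\<chi> q. - 1) (\<chi> q. 1)" by (simp add: mem_box_cart abs_le_iff minus_le_iff)
  qed
  then have "bounded X" by (rule bounded_subset[OF bounded_cbox])
  moreover have "closed X"
    unfolding X_def Collect_conj_eq Collect_all_eq
    by (intro closed_Int closed_INT ballI closed_Collect_eq closed_Collect_imp continuous_intros) auto
  ultimately show ?thesis by (simp add: compact_eq_bounded_closed)
qed

section \<open>The orbit map onto the small cover\<close>

definition bc :: "('m, 'n) coords \<Rightarrow> 'm \<times> nat \<Rightarrow> real" where "bc x p = \<bar>crd x p\<bar>"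

text \<open>The reason for the 1-norm: absolute values become barycentric coordinates.\<close>

lemma bary_bc: "x \<in> X \<Longrightarrow> bary (bc x)"
  by (simp add: bary_def bc_def X_def)

lemma continuous_on_point_bc: "continuous_on A (\<lambda>x. point (bc x))"
  unfolding point_def bc_def by (intro continuous_on_vec_lambda continuous_intros continuous_on_id)

lemma point_bc_in_P: "x \<in> X \<Longrightarrow> point (bc x) \<in> P"
  using bary_bc P_eq by auto

text \<open>The group component of the image of x, read off from the negative coordinates. Counting
  zeros as positive is harmless, as their vectors generate the identifications at that point of
  P.\<close>

definition gs :: "('m, 'n) coords \<Rightarrow> bit ^ 'n" where
  "gs x = (\<Sum>p\<in>block_idx n. if crd x p < 0 then lm p else 0)"

abbreviation rel where "rel \<equiv> small_cover_rel P lam"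

definition stab :: "'a ^ 'm \<Rightarrow> ('m \<times> nat) set" where
  "stab z = {p \<in> block_idx n. z \<in> facet p}"

lemma finite_stab: "finite (stab z)" by (simp add: stab_def)

lemma stab_point: "x \<in> X \<Longrightarrow> stab (point (bc x)) = {p \<in> block_idx n. crd x p = 0}"
  using point_in_facet_iff[OF bary_bc] by (auto simp: stab_def bc_def)

lemma generators_eq: "{lam F | F. F facet_of P \<and> z \<in> F} = lm ` stab z"
proof -
  have "F facet_of P \<longleftrightarrow> (\<exists>p\<in>block_idx n. F = facet p)" for F using facets_P by blast
  then show ?thesis by (auto simp: stab_def lm_def)
qed

lemma rel_iff:
  "((z, g), (z', h)) \<in> rel \<longleftrightarrow>
    z \<in> P \<and> z = z' \<and> (\<exists>C\<subseteq>stab z. g + h = sum lm C)"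
  unfolding small_cover_rel_def generators_eq
  by (auto simp: generated_subgroup_bit_vec[OF finite_stab])

lemma equiv_rel: "equiv (P \<times> UNIV) (rel)"
proof (rule equivI)
  show "rel \<subseteq> (P \<times> UNIV) \<times> (P \<times> UNIV)" by (auto simp: small_cover_rel_def)
  show "refl_on (P \<times> UNIV) (rel)"
    by (auto simp: refl_on_def small_cover_rel_def generated_subgroup_zero)
  show "sym (rel)"
    by (rule symI) (auto simp: small_cover_rel_def add.commute)
  show "trans (rel)"
  proof (rule transI)
    fix a b c assume "(a, b) \<in> rel" "(b, c) \<in> rel"
    then obtain z g h k where *: "a = (z, g)" "b = (z, h)" "c = (z, k)" "z \<in> P"
      "- g + h \<in> generated_subgroup {lam F |F. F facet_of P \<and> z \<in> F}"
      "- h + k \<in> generated_subgroup {lam F |F. F facet_of P \<and> z \<in> F}"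
      by (auto simp: small_cover_rel_def)
    let ?H = "generated_subgroup {lam F |F. F facet_of P \<and> z \<in> F}"
    have "(- g + h) + (- h + k) \<in> ?H"
      by (rule generated_subgroup_add) (use * in auto)
    moreover have "(- g + h) + (- h + k) = - g + k" by (metis add.assoc add_minus_cancel)
    ultimately show "(a, c) \<in> rel" using * by (simp add: small_cover_rel_def)
  qed
qed

definition q :: "('m, 'n) coords \<Rightarrow> (('a ^ 'm) \<times> (bit ^ 'n)) set" where
  "q x = rel `` {(point (bc x), gs x)}"

abbreviation base where
  "base \<equiv> prod_topology (top_of_set P) (discrete_topology UNIV)"

lemma topspace_base: "topspace base = P \<times> UNIV"
  by simp

lemma topspace_small_cover: "topspace (small_cover P lam) = (P \<times> UNIV) // rel"
  by (simp add: small_cover_def topspace_quotient_topology)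

lemma q_in_topspace: "x \<in> X \<Longrightarrow> q x \<in> topspace (small_cover P lam)"
  unfolding topspace_small_cover q_def by (rule quotientI) (simp add: point_bc_in_P)

lemma gs_flip:
  assumes \<alpha>: "\<alpha> \<in> K"
  shows "gs x + gs (flip \<alpha> x) = sum lm {p \<in> block_idx n. \<alpha> p = 1 \<and> crd x p = 0}"
proof -
  have "gs x + gs (flip \<alpha> x) = (\<Sum>p\<in>block_idx n. if \<alpha> p = 1 \<and> crd x p \<noteq> 0 then lm p else 0)"
    unfolding gs_def sum.distrib[symmetric] by (intro sum.cong) (auto simp: crd_flip)
  moreover have "(\<Sum>p\<in>block_idx n. if \<alpha> p = 1 \<and> crd x p \<noteq> 0 then lm p else 0) +
      (\<Sum>p\<in>block_idx n. if \<alpha> p = 1 \<and> crd x p = 0 then lm p else 0) = (\<Sum>p\<in>block_idx n. \<alpha> p *s lm p)"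
    unfolding sum.distrib[symmetric]
  proof (intro sum.cong refl)
    fix p show "(if \<alpha> p = 1 \<and> crd x p \<noteq> 0 then lm p else 0) + (if \<alpha> p = 1 \<and> crd x p = 0 then lm p else 0)
        = \<alpha> p *s lm p" by (cases "\<alpha> p") auto
  qed
  moreover have "(\<Sum>p\<in>block_idx n. \<alpha> p *s lm p) = 0" using \<alpha> by (simp add: K_def relations_def)
  moreover have "(\<Sum>p\<in>block_idx n. if \<alpha> p = 1 \<and> crd x p = 0 then lm p else 0) =
      sum lm {p \<in> block_idx n. \<alpha> p = 1 \<and> crd x p = 0}"
    by (simp add: sum.inter_filter)
  ultimately show ?thesis by (simp only: vec_bit_add_eq_0_iff)
qed

lemma q_eq_iff:
  assumes x: "x \<in> X" and y: "y \<in> X"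
  shows "q x = q y \<longleftrightarrow> (\<exists>\<alpha>\<in>K. y = flip \<alpha> x)"
proof -
  have "q x = q y \<longleftrightarrow> ((point (bc x), gs x), (point (bc y), gs y)) \<in> rel"
    unfolding q_def by (rule eq_equiv_class_iff[OF equiv_rel]) (use x y point_bc_in_P in auto)
  also have "\<dots> \<longleftrightarrow> point (bc x) = point (bc y) \<and> (\<exists>C\<subseteq>stab (point (bc x)). gs x + gs y = sum lm C)"
    using point_bc_in_P[OF x] by (simp add: rel_iff)
  also have "\<dots> \<longleftrightarrow> (\<exists>\<alpha>\<in>K. y = flip \<alpha> x)"
  proof
    assume "\<exists>\<alpha>\<in>K. y = flip \<alpha> x"
    then obtain \<alpha> where \<alpha>: "\<alpha> \<in> K" "y = flip \<alpha> x" by blast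
    have "bc y p = bc x p" if "p \<in> block_idx n" for p using that by (simp add: bc_def \<alpha> crd_flip)
    then have "point (bc x) = point (bc y)" by (simp add: point_def vec_eq_iff mem_block_idx)
    moreover have "{p \<in> block_idx n. \<alpha> p = 1 \<and> crd x p = 0} \<subseteq> stab (point (bc x))"
      using stab_point[OF x] by auto
    ultimately show "point (bc x) = point (bc y) \<and> (\<exists>C\<subseteq>stab (point (bc x)). gs x + gs y = sum lm C)"
      using gs_flip[OF \<alpha>(1)] \<alpha>(2) by blast
  next
    assume "point (bc x) = point (bc y) \<and> (\<exists>C\<subseteq>stab (point (bc x)). gs x + gs y = sum lm C)"
    then obtain C where eq: "point (bc x) = point (bc y)" and C: "C \<subseteq> stab (point (bc x))"
      and sum: "gs x + gs y = sum lm C" by blast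
    have abs: "\<bar>crd x p\<bar> = \<bar>crd y p\<bar>" if "p \<in> block_idx n" for p
      using bary_unique[OF bary_bc[OF x] bary_bc[OF y] eq that] by (simp add: bc_def)
    \<comment> \<open>On nonzero coordinates the change of sign is forced. On zero coordinates
      \<open>\<alpha>\<close> is free, and taking it from C makes it a relation.\<close>
    define \<alpha> :: "'m \<times> nat \<Rightarrow> bit" where
      "\<alpha> p = (if p \<in> block_idx n then of_bool (crd x p < 0) + of_bool (crd y p < 0) + of_bool (p \<in> C) else 0)" for p
    have C0: "crd x p = 0" if "p \<in> C" for p using C that stab_point[OF x] by auto
    have "(\<Sum>p\<in>block_idx n. \<alpha> p *s lm p) = gs x + gs y + (\<Sum>p\<in>block_idx n. if p \<in> C then lm p else 0)"
      unfolding gs_def sum.distrib[symmetric] by (intro sum.cong refl) (auto simp: \<alpha>_def)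
    also have "(\<Sum>p\<in>block_idx n. if p \<in> C then lm p else 0) = sum lm C"
      using C by (subst sum.inter_restrict[symmetric]) (auto simp: stab_def Int_absorb1 intro: arg_cong2[of _ _ _ _ sum])
    finally have "\<alpha> \<in> K" using sum by (simp add: K_def relations_def \<alpha>_def)
    moreover have "y = flip \<alpha> x"
    proof (rule X_eqI[OF y flip_in_X[OF x]])
      fix p assume p: "p \<in> block_idx n"
      show "crd y p = crd (flip \<alpha> x) p"
        using abs[OF p] C0[of p] p
        by (cases "crd x p = 0"; cases "p \<in> C"; cases "crd x p < 0"; cases "crd y p < 0") (auto simp: crd_flip \<alpha>_def)
    qed
    ultimately show "\<exists>\<alpha>\<in>K. y = flip \<alpha> x" by blast
  qed
  finally show ?thesis .
qed

section \<open>The covering of the small cover\<close>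

lemma openin_base_iff:
  "openin base A \<longleftrightarrow>
    A \<subseteq> P \<times> UNIV \<and> (\<forall>g. openin (top_of_set P) {z \<in> P. (z, g) \<in> A})"
  for A :: "(('a ^ 'm) \<times> (bit ^ 'n)) set"
proof
  assume A: "openin base A"
  have "A \<subseteq> P \<times> UNIV" using openin_subset[OF A] by simp
  moreover have "openin (top_of_set P) {z \<in> P. (z, g) \<in> A}" for g
  proof -
    have "continuous_map (top_of_set P) base (\<lambda>z. (z, g))"
      by (intro continuous_map_pairedI) (auto simp: continuous_map_id[unfolded id_def])
    then show ?thesis using A by (auto simp: continuous_map_def)
  qed
  ultimately show "A \<subseteq> P \<times> UNIV \<and> (\<forall>g. openin (top_of_set P) {z \<in> P. (z, g) \<in> A})" by blast
next
  assume A: "A \<subseteq> P \<times> UNIV \<and> (\<forall>g. openin (top_of_set P) {z \<in> P. (z, g) \<in> A})"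
  then have "A = (\<Union>g. {z \<in> P. (z, g) \<in> A} \<times> {g})" by auto
  moreover have "openin base ({z \<in> P. (z, g) \<in> A} \<times> {g})" for g
    using A by (subst openin_prod_Times_iff) auto
  ultimately show "openin base A"
    by (metis (no_types, lifting) openin_Union imageE)
qed

lemma openin_small_cover_iff:
  "openin (small_cover P lam) U \<longleftrightarrow> U \<subseteq> topspace (small_cover P lam) \<and>
    (\<forall>g. openin (top_of_set P) {z \<in> P. rel `` {(z, g)} \<in> U})"
  unfolding topspace_small_cover unfolding small_cover_def openin_quotient_topology openin_base_iff
  by (auto simp: topspace_base)

lemma rel_class_eqI:
  "z \<in> P \<Longrightarrow> C \<subseteq> stab z \<Longrightarrow> g + h = sum lm C \<Longrightarrow>
    rel `` {(z, g)} = rel `` {(z, h)}"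
  by (rule equiv_class_eq[OF equiv_rel]) (auto simp: rel_iff)

text \<open>\<open>gs\<close> jumps where coordinates vanish, but near x only by
  \<open>sum lm C\<close> with \<open>C \<subseteq> stab (point (bc x))\<close>. So
  \<open>T1\<close> freezes the signs of the nonzero coordinates and \<open>T2\<close> treats the
  finitely many jumps C at once.\<close>

lemma continuous_map_q: "continuous_map (top_of_set X) (small_cover P lam) q"
  unfolding continuous_map_def
proof (intro conjI allI impI)
  show "q \<in> topspace (top_of_set X) \<rightarrow> topspace (small_cover P lam)" using q_in_topspace by auto
  fix U assume U: "openin (small_cover P lam) U"
  let ?W = "\<lambda>g. {z \<in> P. rel `` {(z, g)} \<in> U}"
  show "openin (top_of_set X) {x \<in> topspace (top_of_set X). q x \<in> U}"
  proof (subst openin_subopen, intro ballI)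
    fix x assume "x \<in> {x \<in> topspace (top_of_set X). q x \<in> U}"
    then have x: "x \<in> X" and qx: "q x \<in> U" by auto
    let ?s = "stab (point (bc x))"
    define T1 where "T1 = X \<inter> (\<Inter>p\<in>{p \<in> block_idx n. crd x p \<noteq> 0}. {y. 0 < crd x p * crd y p})"
    define T2 where "T2 = (\<Inter>C\<in>Pow ?s. X \<inter> (\<lambda>y. point (bc y)) -` ?W (gs x + sum lm C))"
    have "open (\<Inter>p\<in>{p \<in> block_idx n. crd x p \<noteq> 0}. {y. 0 < crd x p * crd y p})"
      by (intro open_INT ballI open_Collect_less continuous_intros) auto
    then have "openin (top_of_set X) T1" unfolding T1_def by (rule openin_open_Int)
    moreover have "openin (top_of_set X) T2" unfolding T2_def
    proof (rule openin_INT2)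
      fix C show "openin (top_of_set X) (X \<inter> (\<lambda>y. point (bc y)) -` ?W (gs x + sum lm C))"
        using U point_bc_in_P unfolding openin_small_cover_iff
        by (intro continuous_openin_preimage[OF continuous_on_point_bc, of _ P]) auto
    qed (auto simp: finite_stab)
    ultimately have "openin (top_of_set X) (T1 \<inter> T2)" by (rule openin_Int)
    moreover have "x \<in> T1 \<inter> T2"
    proof -
      have "x \<in> T1" using x by (auto simp: T1_def zero_less_mult_iff not_less less_le)
      moreover have "point (bc x) \<in> ?W (gs x + sum lm C)" if "C \<subseteq> ?s" for C
      proof -
        have "gs x + (gs x + sum lm C) = sum lm C" by (simp add: add.assoc[symmetric])
        then have "rel `` {(point (bc x), gs x + sum lm C)} = q x"
          using rel_class_eqI[OF point_bc_in_P[OF x] that] by (simp add: q_def)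
        then show ?thesis using qx point_bc_in_P[OF x] by simp
      qed
      then have "x \<in> T2" using x by (auto simp: T2_def)
      ultimately show ?thesis by blast
    qed
    moreover have "T1 \<inter> T2 \<subseteq> {x \<in> topspace (top_of_set X). q x \<in> U}"
    proof
      fix y assume y: "y \<in> T1 \<inter> T2"
      then have yX: "y \<in> X" by (simp add: T1_def)
      define C where "C = {p \<in> block_idx n. crd x p = 0 \<and> crd y p < 0}"
      have C: "C \<subseteq> ?s" by (auto simp: C_def stab_point[OF x])
      have sgn: "crd y p < 0 \<longleftrightarrow> crd x p < 0" if "p \<in> block_idx n" "crd x p \<noteq> 0" for p
      proof -
        have "0 < crd x p * crd y p" using y that by (auto simp: T1_def)
        then show ?thesis by (auto simp: zero_less_mult_iff)
      qed
      have "gs y = gs x + (\<Sum>p\<in>block_idx n. if crd x p = 0 \<and> crd y p < 0 then lm p else 0)"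
        unfolding gs_def sum.distrib[symmetric] by (intro sum.cong refl) (use sgn in force)
      then have "gs y = gs x + sum lm C" unfolding C_def by (simp add: sum.inter_filter)
      moreover have "point (bc y) \<in> ?W (gs x + sum lm C)" using y C unfolding T2_def by blast
      ultimately show "y \<in> {x \<in> topspace (top_of_set X). q x \<in> U}" using yX by (simp add: q_def)
    qed
    ultimately show "\<exists>T. openin (top_of_set X) T \<and> x \<in> T \<and> T \<subseteq> {x \<in> topspace (top_of_set X). q x \<in> U}"
      by blast
  qed
qed

lemma lm_combination: obtains B where "B \<subseteq> block_idx n" "g = sum lm B"
proof -
  let ?A = "{(j, i). i \<le> n j \<and> i \<noteq> (0::nat)}"
  have fin: "finite ?A" and "card ?A = (\<Sum>j\<in>UNIV. n j)"
    using card_punctured_blocks[of "\<lambda>j. 0" n] by auto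
  then have cardA: "card ?A = CARD('n)" using card by simp
  obtain u where u: "g = (\<Sum>p\<in>?A. u p *s lm p)"
    unfolding lm_def
    by (rule basis_combination[OF fin cardA characteristic_basis[OF lam, of "\<lambda>j. 0"]]) auto
  also have "\<dots> = (\<Sum>p\<in>?A. if u p = 1 then lm p else 0)"
    by (intro sum.cong refl) (metis bit_not_one_iff vec.scale_one vec.scale_zero_left)
  also have "\<dots> = sum lm {p \<in> ?A. u p = 1}" using fin by (simp only: sum.inter_filter)
  finally show thesis by (intro that[of "{p \<in> ?A. u p = 1}"]) (auto simp: block_idx_def)
qed

lemma q_surj: "q ` X = topspace (small_cover P lam)"
proof (intro equalityI subsetI)
  fix c assume "c \<in> topspace (small_cover P lam)"
  then obtain z g where z: "z \<in> P" "c = rel `` {(z, g)}"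
    unfolding topspace_small_cover by (auto elim: quotientE)
  then obtain u where u: "z = point u" "bary u" using P_eq by auto
  obtain B where B: "B \<subseteq> block_idx n" "g = sum lm B" by (rule lm_combination)
  define x where "x = emb (\<lambda>p. if p \<in> B then - u p else u p)"
  have u0: "0 \<le> u p" if "p \<in> block_idx n" for p using u(2) that by (simp add: bary_def)
  have bcx: "bc x p = u p" if "p \<in> block_idx n" for p using that u0[OF that] by (simp add: bc_def x_def)
  have x: "x \<in> X"
    unfolding x_def
  proof (rule emb_in_X)
    fix j have "(\<Sum>i\<le>n j. \<bar>if (j, i) \<in> B then - u (j, i) else u (j, i)\<bar>) = (\<Sum>i\<le>n j. u (j, i))"
      by (intro sum.cong) (use u0 in \<open>auto simp: mem_block_idx\<close>)
    then show "(\<Sum>i\<le>n j. \<bar>if (j, i) \<in> B then - u (j, i) else u (j, i)\<bar>) = 1" using u(2) by (simp add: bary_def)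
  qed
  have pz: "point (bc x) = z" using bcx by (simp add: u(1) point_def vec_eq_iff mem_block_idx)
  \<comment> \<open>Coordinates in B whose sign cannot be made negative; their vectors lie in the
    group of identifications at z.\<close>
  define C where "C = {p \<in> B. u p = 0}"
  have finB: "finite B" using B(1) by (rule finite_subset) simp
  have "C \<subseteq> stab z"
    using B(1) by (auto simp: C_def stab_def u(1) point_in_facet_iff[OF u(2)])
  moreover have "gs x + g = sum lm C"
  proof -
    have "gs x = (\<Sum>p\<in>block_idx n. if p \<in> B \<and> u p \<noteq> 0 then lm p else 0)"
      unfolding gs_def by (intro sum.cong refl) (use u0 in \<open>force simp: x_def\<close>)
    also have "\<dots> = sum lm {p \<in> block_idx n. p \<in> B \<and> u p \<noteq> 0}" by (simp add: sum.inter_filter)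
    also have "{p \<in> block_idx n. p \<in> B \<and> u p \<noteq> 0} = B - C" using B(1) by (auto simp: C_def)
    finally have "gs x + g = sum lm (B - C) + (sum lm (B \<inter> C) + sum lm (B - C))"
      unfolding B(2) using sum.Int_Diff[OF finB, of lm C] by simp
    then show ?thesis by (simp add: C_def ac_simps Int_def)
  qed
  ultimately have "q x = c" unfolding q_def pz z(2) by (intro rel_class_eqI z(1))
  then show "c \<in> q ` X" using x by blast
qed (use q_in_topspace in auto)

text \<open>An embedding of the small cover in a Euclidean space. The \<open>h\<close>-coordinate of \<open>[z, g]\<close> vanishes
  exactly if \<open>(z, g) \<sim> (z, h)\<close>.\<close>

definition e0 :: "('a ^ 'm) \<times> (bit ^ 'n) \<Rightarrow> ('a ^ 'm) \<times> (real ^ (bit ^ 'n))" where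
  "e0 y = (fst y, \<chi> h. \<Prod>B | B \<subseteq> block_idx n \<and> sum lm B = snd y + h. \<Sum>b\<in>B. infdist (fst y) (facet b))"

lemma finite_subsets: "finite {B. B \<subseteq> block_idx n \<and> Q B}"
  by (rule finite_subset[of _ "Pow (block_idx n)"]) auto

lemma infdist_facet_eq_0:
  assumes "b \<in> block_idx n" shows "infdist z (facet b) = 0 \<longleftrightarrow> z \<in> facet b"
proof -
  have "closed (facet b)"
    using face_of_imp_closed[OF polyhedron_imp_convex[OF polyhedron_P] polyhedron_imp_closed[OF polyhedron_P]
        facet_face_of[OF assms]] .
  moreover have "facet b \<noteq> {}" using facet_facet_of[OF assms] by (auto simp: facet_of_def)
  ultimately show ?thesis using in_closed_iff_infdist_zero by blast
qed

text \<open>At the coordinate h, the tuple of (z, h) is 0 because of the factor for the empty set,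
  so the tuple of (z, g) has a zero factor too. Conversely, symmetric difference with C permutes the
  factors and keeps their values, as z has distance 0 from the facets in C.\<close>

lemma e0_eq_iff:
  assumes z: "z \<in> P" "z' \<in> P"
  shows "e0 (z, g) = e0 (z', h) \<longleftrightarrow> ((z, g), (z', h)) \<in> rel"
proof
  assume eq: "e0 (z, g) = e0 (z', h)"
  have fin: "finite B" if "B \<subseteq> block_idx n" for B using that by (rule finite_subset) simp
  have zz: "z = z'" using eq by (simp add: e0_def)
  let ?f = "\<lambda>B. \<Sum>b\<in>B. infdist z (facet b)"
  have "(\<Prod>B | B \<subseteq> block_idx n \<and> sum lm B = h + h. ?f B) = 0"
    by (rule prod_zero[OF finite_subsets bexI[of _ "{}"]]) auto
  then have "(\<Prod>B | B \<subseteq> block_idx n \<and> sum lm B = g + h. ?f B) = 0"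
    using arg_cong[OF eq, of "\<lambda>y. snd y $ h"] zz by (simp add: e0_def)
  then obtain B where B: "B \<subseteq> block_idx n" "sum lm B = g + h" "?f B = 0"
    unfolding prod_zero_iff[OF finite_subsets] by blast
  then have "\<forall>b\<in>B. infdist z (facet b) = 0"
    using fin by (subst (asm) sum_nonneg_eq_0_iff) (auto simp: infdist_nonneg)
  then have "B \<subseteq> stab z" using B(1) infdist_facet_eq_0 unfolding stab_def by blast
  then show "((z, g), (z', h)) \<in> rel" using B z zz by (auto simp: rel_iff)
next
  assume "((z, g), (z', h)) \<in> rel"
  then obtain C where zz: "z' = z" and C: "C \<subseteq> stab z" "g + h = sum lm C" by (auto simp: rel_iff)
  have CI: "C \<subseteq> block_idx n" using C(1) by (auto simp: stab_def)
  have fin: "finite B" if "B \<subseteq> block_idx n" for B using that by (rule finite_subset) simp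
  let ?f = "\<lambda>B. \<Sum>b\<in>B. infdist z (facet b)"
  have C0: "infdist z (facet b) = 0" if "b \<in> C" for b
    using that C(1) infdist_facet_eq_0[of b z] by (auto simp: stab_def)
  have f: "?f (sym_diff B C) = ?f B" if B: "B \<subseteq> block_idx n" for B
  proof -
    have "?f (sym_diff B C) = ?f (B - C)"
      using fin[OF B] fin[OF CI] C0 by (intro sum.mono_neutral_right) auto
    also have "\<dots> = ?f B" using fin[OF B] C0 by (intro sum.mono_neutral_left) auto
    finally show ?thesis .
  qed
  have sd: "sum lm (sym_diff B C) = sum lm B + (g + h)" if "B \<subseteq> block_idx n" for B
    using fin[OF that] fin[OF CI] by (simp add: sum_sym_diff_bit C(2))
  have cancel: "g + k + (g + h) = h + k" "h + k + (g + h) = g + k" for k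
  proof -
    have "g + k + (g + h) = (g + g) + (h + k)" "h + k + (g + h) = (h + h) + (g + k)" by (simp_all only: ac_simps)
    then show "g + k + (g + h) = h + k" "h + k + (g + h) = g + k" by simp_all
  qed
  have "(\<Prod>B | B \<subseteq> block_idx n \<and> sum lm B = g + k. ?f B) = (\<Prod>B | B \<subseteq> block_idx n \<and> sum lm B = h + k. ?f B)" for k
    by (rule prod.reindex_bij_witness[of _ "\<lambda>B. sym_diff B C" "\<lambda>B. sym_diff B C"])
      (use CI in \<open>auto simp: sd cancel f\<close>)
  then show "e0 (z, g) = e0 (z', h)" by (simp add: e0_def zz)
qed

definition emb_cover :: "(('a ^ 'm) \<times> (bit ^ 'n)) set \<Rightarrow> ('a ^ 'm) \<times> (real ^ (bit ^ 'n))" where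
  "emb_cover c = e0 (SOME y. y \<in> c)"

lemma emb_cover_class:
  assumes "z \<in> P" shows "emb_cover (rel `` {(z, g)}) = e0 (z, g)"
proof -
  let ?c = "rel `` {(z, g)}"
  have "(z, g) \<in> ?c" using equiv_class_self[OF equiv_rel] assms by auto
  then have some: "(SOME y. y \<in> ?c) \<in> ?c" by (rule someI)
  obtain z' g' where y: "(SOME y. y \<in> ?c) = (z', g')" by (rule prod.exhaust)
  then have "((z, g), (z', g')) \<in> rel" using some by simp
  moreover from this have "z' \<in> P" by (auto simp: rel_iff)
  ultimately have "e0 (z, g) = e0 (z', g')" using e0_eq_iff[OF assms] by blast
  then show ?thesis by (simp only: emb_cover_def y)
qed

lemma inj_on_emb_cover: "inj_on emb_cover (topspace (small_cover P lam))"
proof (rule inj_onI)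
  fix c c' assume "c \<in> topspace (small_cover P lam)" "c' \<in> topspace (small_cover P lam)"
  then obtain z g z' g' where *: "z \<in> P" "c = rel `` {(z, g)}"
      "z' \<in> P" "c' = rel `` {(z', g')}"
    unfolding topspace_small_cover by (auto elim!: quotientE)
  assume "emb_cover c = emb_cover c'"
  then have "((z, g), (z', g')) \<in> rel"
    using * by (simp add: emb_cover_class e0_eq_iff)
  then show "c = c'" unfolding * by (rule equiv_class_eq[OF equiv_rel])
qed

lemma continuous_map_emb_cover: "continuous_map (small_cover P lam) euclidean emb_cover"
  unfolding continuous_map_def
proof (intro conjI allI impI)
  fix W :: "(('a ^ 'm) \<times> (real ^ (bit ^ 'n))) set" assume W: "openin euclidean W"
  show "openin (small_cover P lam) {c \<in> topspace (small_cover P lam). emb_cover c \<in> W}"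
    unfolding openin_small_cover_iff
  proof (intro conjI allI)
    fix g :: "bit ^ 'n"
    have "continuous_on P (\<lambda>z. e0 (z, g))"
      unfolding e0_def fst_conv snd_conv
      by (intro continuous_on_Pair continuous_on_vec_lambda continuous_on_prod continuous_on_sum
          continuous_on_infdist continuous_on_id)
    then have "openin (top_of_set P) (P \<inter> (\<lambda>z. e0 (z, g)) -` W)"
      using W by (intro continuous_openin_preimage_gen) auto
    moreover have "{z \<in> P. rel `` {(z, g)} \<in> {c \<in> topspace (small_cover P lam). emb_cover c \<in> W}}
        = P \<inter> (\<lambda>z. e0 (z, g)) -` W"
      unfolding topspace_small_cover using emb_cover_class by (auto intro!: quotientI)
    ultimately show "openin (top_of_set P)
        {z \<in> P. rel `` {(z, g)} \<in> {c \<in> topspace (small_cover P lam). emb_cover c \<in> W}}"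
      by simp
  qed auto
qed simp

text \<open>The orbit map read in the Euclidean image of the small cover; the target is Hausdorff
  there, so the covering criterion for compact X applies.\<close>

definition proj :: "('m, 'n) coords \<Rightarrow> ('a ^ 'm) \<times> (real ^ (bit ^ 'n))" where
  "proj x = emb_cover (q x)"

lemma proj_eq_iff: "x \<in> X \<Longrightarrow> y \<in> X \<Longrightarrow> proj x = proj y \<longleftrightarrow> (\<exists>\<alpha>\<in>K. y = flip \<alpha> x)"
  unfolding proj_def using q_eq_iff inj_on_eq_iff[OF inj_on_emb_cover q_in_topspace q_in_topspace] by metis

lemma continuous_on_proj: "continuous_on X proj"
  using continuous_map_compose[OF continuous_map_q continuous_map_emb_cover]
  by (simp add: proj_def[abs_def] comp_def)

lemma covering_space_proj: "covering_space X proj (proj ` X)"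
proof (rule covering_space_orbit_map[OF compact_X continuous_on_proj finite_K zero_in_K, where act = flip])
  show "flip \<alpha> (flip \<alpha> x) = x" if "x \<in> X" for \<alpha> x using that by (simp add: flip_flip flip_zero)
qed (auto simp: flip_zero continuous_on_flip continuous_on_id flip_in_X proj_eq_iff intro: flip_free)

section \<open>Lifting motion planners\<close>

text \<open>An open set retracting onto X by \<open>nrm\<close>. Pulled back to
  \<open>Z \<times> Z\<close>, the domains of the planners are open in Euclidean space, where small
  balls are connected.\<close>

definition Z :: "('m, 'n) coords set" where
  "Z = {x. \<forall>j. l1 x j \<noteq> 0}"

definition nrm :: "('m, 'n) coords \<Rightarrow> ('m, 'n) coords" where
  "nrm x = emb (\<lambda>p. crd x p / l1 x (fst p))"

lemma open_Z: "open Z"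
  unfolding Z_def Collect_all_eq
  by (intro open_INT ballI open_Collect_neq continuous_intros continuous_on_id) auto

lemma nrm_in_X: assumes "x \<in> Z" shows "nrm x \<in> X"
  unfolding nrm_def
proof (rule emb_in_X)
  fix j :: 'm
  let ?s = "l1 x j"
  have s: "0 < ?s" using assms by (simp add: Z_def order.not_eq_order_implies_strict sum_nonneg)
  have "(\<Sum>i\<le>n j. \<bar>crd x (j, i) / ?s\<bar>) = (\<Sum>i\<le>n j. \<bar>crd x (j, i)\<bar> / ?s)"
    using s by (intro sum.cong) (simp_all add: abs_divide)
  also have "\<dots> = ?s / ?s" by (simp only: sum_divide_distrib)
  finally show "(\<Sum>i\<le>n j. \<bar>crd x (j, i) / (\<Sum>k\<le>n (fst (j, i)). \<bar>crd x (fst (j, i), k)\<bar>)\<bar>) = 1"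
    using s by simp
qed

lemma continuous_on_nrm: "continuous_on Z nrm"
  unfolding nrm_def
proof (intro continuous_on_emb continuous_on_divide ballI)
  fix p x assume "x \<in> Z"
  then show "l1 x (fst p) \<noteq> 0" by (simp add: Z_def)
qed (intro continuous_intros continuous_on_id)+

lemma sum_crd_flip: "l1 (flip \<alpha> x) j = l1 x j"
  by (intro sum.cong) (auto simp: crd_flip mem_block_idx)

lemma flip_in_Z: "x \<in> Z \<Longrightarrow> flip \<alpha> x \<in> Z"
  by (simp add: Z_def sum_crd_flip)

lemma nrm_flip: "x \<in> Z \<Longrightarrow> nrm (flip \<alpha> x) = flip \<alpha> (nrm x)"
proof (rule X_eqI)
  fix p assume p: "p \<in> block_idx n"
  show "crd (nrm (flip \<alpha> x)) p = crd (flip \<alpha> (nrm x)) p"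
    using p by (simp add: crd_flip nrm_def sum_crd_flip)
qed (simp_all add: nrm_in_X flip_in_Z flip_in_X)

definition M :: "(('a ^ 'm) \<times> (bit ^ 'n)) set topology" where "M = small_cover P lam"

definition Q :: "('m, 'n) coords \<Rightarrow> (('a ^ 'm) \<times> (bit ^ 'n)) set" where "Q x = q (nrm x)"

definition QQ :: "('m, 'n) coords \<times> ('m, 'n) coords \<Rightarrow>
    (('a ^ 'm) \<times> (bit ^ 'n)) set \<times> (('a ^ 'm) \<times> (bit ^ 'n)) set" where
  "QQ z = (Q (fst z), Q (snd z))"

lemma continuous_map_Q: "continuous_map (top_of_set Z) M Q"
proof -
  have "continuous_map (top_of_set Z) (top_of_set X) nrm"
    using continuous_on_nrm nrm_in_X by (auto simp: continuous_map_in_subtopology)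
  from continuous_map_compose[OF this continuous_map_q] show ?thesis
    by (simp add: M_def Q_def[abs_def] comp_def)
qed

lemma continuous_map_QQ: "continuous_map (top_of_set (Z \<times> Z)) (prod_topology M M) QQ"
proof -
  have "continuous_map (top_of_set (Z \<times> Z)) (top_of_set Z) fst"
    "continuous_map (top_of_set (Z \<times> Z)) (top_of_set Z) snd"
    by (auto simp: continuous_map_in_subtopology intro: continuous_on_fst continuous_on_snd continuous_on_id)
  from continuous_map_compose[OF this(1) continuous_map_Q] continuous_map_compose[OF this(2) continuous_map_Q]
  show ?thesis
    unfolding QQ_def[abs_def] by (intro continuous_map_pairedI) (simp_all add: comp_def)
qed

lemma Q_flip: "x \<in> Z \<Longrightarrow> \<alpha> \<in> K \<Longrightarrow> Q (flip \<alpha> x) = Q x"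
  using q_eq_iff[of "nrm x" "flip \<alpha> (nrm x)"] by (auto simp: Q_def nrm_flip nrm_in_X flip_in_X)

text \<open>The lift starting at \<open>x\<close> of the planned path from \<open>[x]\<close> to \<open>[y]\<close> ends at \<open>\<kappa>(x, y) y\<close>.\<close>

lemma motion_planner_twist:
  assumes U: "has_motion_planner M U"
  defines "A \<equiv> {z \<in> Z \<times> Z. QQ z \<in> U}"
  obtains \<kappa> where "\<And>z. z \<in> A \<Longrightarrow> \<kappa> z \<in> K"
    "\<And>x y \<alpha> \<beta>. (x, y) \<in> A \<Longrightarrow> \<alpha> \<in> K \<Longrightarrow> \<beta> \<in> K \<Longrightarrow>
      \<kappa> (flip \<alpha> x, flip \<beta> y) = (\<lambda>p. \<kappa> (x, y) p + \<alpha> p + \<beta> p)"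
    "\<And>B z z'. B \<subseteq> A \<Longrightarrow> connected B \<Longrightarrow> z \<in> B \<Longrightarrow> z' \<in> B \<Longrightarrow> \<kappa> z = \<kappa> z'"
proof -
  obtain s where s: "continuous_map (subtopology (prod_topology M M) U) (path_space M) s"
      and sU: "\<And>z. z \<in> U \<Longrightarrow> path_fibration (s z) = z"
    using U unfolding has_motion_planner_def by blast
  have AZ: "fst z \<in> Z" "snd z \<in> Z" "QQ z \<in> U" if "z \<in> A" for z using that by (auto simp: A_def)
  have "continuous_map (top_of_set A) (prod_topology M M) QQ"
    using continuous_map_QQ by (rule continuous_map_from_subtopology_mono) (auto simp: A_def)
  then have "continuous_map (top_of_set A) (subtopology (prod_topology M M) U) QQ"
    using AZ by (auto simp: continuous_map_in_subtopology)
  from continuous_map_path_evaluation[OF continuous_map_compose[OF this s]]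
  have eval: "continuous_map (top_of_set ({0..1} \<times> A)) M (\<lambda>(t, z). s (QQ z) t)"
    by simp
  define h where "h w = emb_cover (s (QQ (snd w)) (fst w))" for w
  have "continuous_map (top_of_set ({0..1} \<times> A)) euclidean h"
    using continuous_map_compose[OF eval[unfolded M_def] continuous_map_emb_cover]
    by (simp add: h_def[abs_def] comp_def case_prod_beta)
  then have conth: "continuous_on ({0..1} \<times> A) h" by simp
  have hX: "h w \<in> proj ` X" if "w \<in> {0..1} \<times> A" for w
  proof -
    have "s (QQ (snd w)) (fst w) \<in> topspace M"
      using eval that unfolding continuous_map_def by (cases w) force
    then have "s (QQ (snd w)) (fst w) \<in> q ` X" using q_surj by (simp add: M_def)
    then show ?thesis by (auto simp: h_def proj_def)
  qed
  have h0: "h (0, z) = proj (nrm (fst z))" and h1: "h (1, z) = proj (nrm (snd z))" if "z \<in> A" for z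
    using sU[OF AZ(3)[OF that]] by (simp_all add: path_fibration_def h_def proj_def QQ_def Q_def)
  have contf: "continuous_on A (\<lambda>z. nrm (fst z))" "continuous_on A (\<lambda>z. nrm (snd z))"
    by (rule continuous_on_compose2[OF continuous_on_nrm], use AZ in \<open>auto intro!: continuous_intros\<close>)+
  have "(\<lambda>z. nrm (fst z)) \<in> A \<rightarrow> X" using AZ nrm_in_X by auto
  then obtain k where k: "continuous_on ({0..1} \<times> A) k" "k \<in> ({0..1} \<times> A) \<rightarrow> X"
      "\<And>z. z \<in> A \<Longrightarrow> k (0, z) = nrm (fst z)" "\<And>w. w \<in> {0..1} \<times> A \<Longrightarrow> h w = proj (k w)"
    using covering_space_lift_homotopy[OF covering_space_proj conth _ h0 contf(1)] hX by blast
  have kX: "k (t, z) \<in> X" if "z \<in> A" "0 \<le> t" "t \<le> 1" for t z using k(2) that by auto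
  have "\<exists>\<alpha>\<in>K. k (1, z) = flip \<alpha> (nrm (snd z))" if z: "z \<in> A" for z
  proof -
    have "proj (nrm (snd z)) = proj (k (1, z))" using h1[OF z] k(4)[of "(1, z)"] z by simp
    then show ?thesis using proj_eq_iff[OF nrm_in_X[OF AZ(2)[OF z]] kX[OF z]] by auto
  qed
  then obtain \<kappa> where \<kappa>: "\<And>z. z \<in> A \<Longrightarrow> \<kappa> z \<in> K" "\<And>z. z \<in> A \<Longrightarrow> k (1, z) = flip (\<kappa> z) (nrm (snd z))"
    by metis
  show thesis
  proof (rule that[of \<kappa>])
    fix x y \<alpha> \<beta> assume z: "(x, y) \<in> A" and \<alpha>: "\<alpha> \<in> K" and \<beta>: "\<beta> \<in> K"
    let ?z' = "(flip \<alpha> x, flip \<beta> y)"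
    have xy: "x \<in> Z" "y \<in> Z" using AZ[OF z] by auto
    have QQ: "QQ ?z' = QQ (x, y)" using xy \<alpha> \<beta> by (simp add: QQ_def Q_flip)
    have z': "?z' \<in> A" using z xy QQ by (simp add: A_def flip_in_Z)
    have heq: "h (t, ?z') = h (t, (x, y))" for t by (simp add: h_def QQ)
    \<comment> \<open>Both sides end lifts of one and the same planned path, and the two lifts start
      at the same point.\<close>
    have "k (1, ?z') = flip \<alpha> (k (1, (x, y)))"
    proof (rule covering_space_lift_unique[OF covering_space_proj, where T = "{0..1}" and a = 0
          and f = "\<lambda>t. h (t, (x, y))" and ?g1.0 = "\<lambda>t. k (t, ?z')" and ?g2.0 = "\<lambda>t. flip \<alpha> (k (t, (x, y)))"])
      show "k (0, ?z') = flip \<alpha> (k (0, (x, y)))" using k(3)[OF z] k(3)[OF z'] xy by (simp add: nrm_flip)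
      show "continuous_on {0..1} (\<lambda>t. h (t, (x, y)))"
        by (rule continuous_on_compose2[OF conth]) (use z in \<open>auto intro!: continuous_intros\<close>)
      show "continuous_on {0..1} (\<lambda>t. k (t, ?z'))"
        by (rule continuous_on_compose2[OF k(1)]) (use z' in \<open>auto intro!: continuous_intros\<close>)
      show "continuous_on {0..1} (\<lambda>t. flip \<alpha> (k (t, (x, y))))"
        by (intro continuous_on_flip, rule continuous_on_compose2[OF k(1)]) (use z in \<open>auto intro!: continuous_intros\<close>)
      show "h (t, (x, y)) = proj (k (t, ?z'))" if "t \<in> {0..1}" for t
        using k(4)[of "(t, ?z')"] that z' heq by simp
      show "h (t, (x, y)) = proj (flip \<alpha> (k (t, (x, y))))" if "t \<in> {0..1}" for t
      proof -
        have "h (t, (x, y)) = proj (k (t, (x, y)))" using k(4)[of "(t, (x, y))"] that z by simp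
        then show ?thesis
          using proj_eq_iff[OF kX[OF z] flip_in_X[OF kX[OF z]]] that \<alpha> by fastforce
      qed
    qed (use z z' hX kX flip_in_X in auto)
    then have "flip (\<lambda>p. \<kappa> ?z' p + \<beta> p) (nrm y) = flip (\<lambda>p. \<alpha> p + \<kappa> (x, y) p) (nrm y)"
      using \<kappa>(2)[OF z] \<kappa>(2)[OF z'] xy by (simp add: nrm_flip flip_flip nrm_in_X)
    then have "(\<lambda>p. \<kappa> ?z' p + \<beta> p) = (\<lambda>p. \<alpha> p + \<kappa> (x, y) p)"
      by (rule flip_free[OF nrm_in_X[OF xy(2)] K_add[OF \<kappa>(1)[OF z'] \<beta>] K_add[OF \<alpha> \<kappa>(1)[OF z]]])
    then have "\<kappa> ?z' p + \<beta> p = \<alpha> p + \<kappa> (x, y) p" for p by metis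
    then have "\<kappa> ?z' p = \<kappa> (x, y) p + \<alpha> p + \<beta> p" for p
      by (cases "\<beta> p"; cases "\<alpha> p"; cases "\<kappa> (x, y) p"; cases "\<kappa> ?z' p") (metis add_0 add.commute bit_add_self zero_neq_one)+
    then show "\<kappa> ?z' = (\<lambda>p. \<kappa> (x, y) p + \<alpha> p + \<beta> p)" by blast
  next
    fix B z z' assume B: "B \<subseteq> A" "connected B" and z: "z \<in> B" "z' \<in> B"
    have zA: "z \<in> A" "z' \<in> A" using B z by auto
    \<comment> \<open>The endpoints of the lifts and the translates of \<open>nrm (snd w)\<close> by
      the fixed element \<open>\<kappa> z\<close> lift the same map on the connected set B, and they
      agree at z.\<close>
    have "k (1, z') = flip (\<kappa> z) (nrm (snd z'))"
    proof (rule covering_space_lift_unique[OF covering_space_proj, where T = B and a = z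
          and f = "\<lambda>w. h (1, w)" and ?g1.0 = "\<lambda>w. k (1, w)" and ?g2.0 = "\<lambda>w. flip (\<kappa> z) (nrm (snd w))"])
      show "k (1, z) = flip (\<kappa> z) (nrm (snd z))" by (rule \<kappa>(2)[OF zA(1)])
      show "continuous_on B (\<lambda>w. h (1, w))"
        by (rule continuous_on_compose2[OF conth]) (use B in \<open>auto intro!: continuous_intros\<close>)
      show "continuous_on B (\<lambda>w. k (1, w))"
        by (rule continuous_on_compose2[OF k(1)]) (use B in \<open>auto intro!: continuous_intros\<close>)
      show "continuous_on B (\<lambda>w. flip (\<kappa> z) (nrm (snd w)))"
        by (rule continuous_on_flip[OF continuous_on_subset[OF contf(2) B(1)]])
      show "h (1, w) = proj (k (1, w))" if "w \<in> B" for w using k(4)[of "(1, w)"] that B by auto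
      show "h (1, w) = proj (flip (\<kappa> z) (nrm (snd w)))" if w: "w \<in> B" for w
      proof -
        have wA: "w \<in> A" using w B by auto
        show ?thesis
          using h1[OF wA] proj_eq_iff[OF nrm_in_X[OF AZ(2)[OF wA]] flip_in_X[OF nrm_in_X[OF AZ(2)[OF wA]]]] \<kappa>(1)[OF zA(1)]
          by metis
      qed
      show "(\<lambda>w. h (1, w)) \<in> B \<rightarrow> proj ` X" using hX B by auto
      show "(\<lambda>w. k (1, w)) \<in> B \<rightarrow> X" using kX B by auto
      show "(\<lambda>w. flip (\<kappa> z) (nrm (snd w))) \<in> B \<rightarrow> X" using AZ B by (auto intro!: flip_in_X nrm_in_X)
    qed (use B z in auto)
    then have "flip (\<kappa> z') (nrm (snd z')) = flip (\<kappa> z) (nrm (snd z'))" using \<kappa>(2)[OF zA(2)] by simp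
    then show "\<kappa> z = \<kappa> z'"
      using flip_free[OF nrm_in_X[OF AZ(2)[OF zA(2)]] \<kappa>(1)[OF zA(2)] \<kappa>(1)[OF zA(1)]] by simp
  qed (rule \<kappa>(1))
qed

section \<open>The lower bound\<close>

text \<open>Grid points vanish outside their index range, so the coordinate \<open>n j\<close> of
  the first factor is 0: the smaller sphere sits as an equator.\<close>

definition coords_of :: "int \<Rightarrow> (bool \<times> 'm) grid \<Rightarrow> ('m, 'n) coords \<times> ('m, 'n) coords" where
  "coords_of L v = (emb (\<lambda>(j, i). v ((False, j), i) / L), emb (\<lambda>(j, i). v ((True, j), i) / L))"

text \<open>A compact part of Z that contains the scaled cube boundaries, which lie on the sphere of
  the maximum norm rather than on X.\<close>

definition Y1 :: "('m, 'n) coords set" where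
  "Y1 = {x. (\<forall>q. \<bar>x $ q\<bar> \<le> 1) \<and> (\<forall>j. 1 \<le> l1 x j)}"

lemma compact_Y1: "compact Y1"
proof -
  have "Y1 \<subseteq> cbox (\<chi> q. - 1) (\<chi> q. 1)"
    by (auto simp: Y1_def mem_box_cart abs_le_iff minus_le_iff)
  then have "bounded Y1" by (rule bounded_subset[OF bounded_cbox])
  moreover have "closed Y1"
    unfolding Y1_def Collect_conj_eq Collect_all_eq
    by (intro closed_Int closed_INT ballI closed_Collect_le continuous_intros continuous_on_id)
  ultimately show ?thesis by (simp add: compact_eq_bounded_closed)
qed

lemma Y1_subset_Z: "Y1 \<subseteq> Z"
proof
  fix x assume "x \<in> Y1"
  then have "1 \<le> l1 x j" for j by (simp add: Y1_def)
  then have "l1 x j \<noteq> 0" for j by (metis not_one_le_zero)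
  then show "x \<in> Z" by (simp add: Z_def)
qed

lemma emb_in_Y1:
  assumes "\<And>p. \<bar>u p\<bar> \<le> 1" "\<And>j. \<exists>i\<le>n j. \<bar>u (j, i)\<bar> = 1"
  shows "emb u \<in> Y1"
  unfolding Y1_def
proof (intro CollectI conjI allI)
  show "\<bar>emb u $ q\<bar> \<le> 1" for q using assms(1) by (simp add: emb_def)
  fix j
  obtain i where i: "i \<le> n j" "\<bar>u (j, i)\<bar> = 1" using assms(2) by blast
  have "\<bar>crd (emb u) (j, i)\<bar> \<le> l1 (emb u) j"
    by (rule member_le_sum) (use i in auto)
  then show "1 \<le> l1 (emb u) j" using i by (simp add: mem_block_idx)
qed

lemma dist_emb_le:
  fixes r :: real
  assumes "\<And>p. \<bar>u p - w p\<bar> \<le> r"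
  shows "dist (emb u) (emb w) \<le> CARD('m \<times> 'n option) * r"
proof -
  have r: "0 \<le> r" using assms[of undefined] by linarith
  have "dist (emb u) (emb w) \<le> (\<Sum>q\<in>UNIV. \<bar>(emb u - emb w) $ q\<bar>)"
    unfolding dist_norm by (rule norm_le_l1_cart)
  also have "\<dots> \<le> (\<Sum>q\<in>(UNIV :: ('m \<times> 'n option) set). r)"
    by (intro sum_mono) (use assms r in \<open>simp add: emb_def\<close>)
  finally show ?thesis by (simp del: card_prod)
qed

lemma dist_coords_of_le:
  fixes r :: int
  assumes L: "0 < L" and vw: "\<And>p. \<bar>v p - w p\<bar> \<le> r"
  shows "dist (coords_of L v) (coords_of L w) \<le> 2 * CARD('m \<times> 'n option) * r / L"
proof -
  have *: "\<bar>real_of_int (v p) / L - w p / L\<bar> \<le> r / L" for p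
  proof -
    have "\<bar>real_of_int (v p) - w p\<bar> \<le> r" using vw[of p] by linarith
    then show ?thesis using L by (simp add: diff_divide_distrib[symmetric] abs_divide divide_right_mono)
  qed
  have "dist (coords_of L v) (coords_of L w) \<le>
      dist (fst (coords_of L v)) (fst (coords_of L w)) + dist (snd (coords_of L v)) (snd (coords_of L w))"
    by (cases "coords_of L v"; cases "coords_of L w") (simp add: dist_Pair_Pair sqrt_sum_squares_le_sum)
  also have "\<dots> \<le> CARD('m \<times> 'n option) * (r / L) + CARD('m \<times> 'n option) * (r / L)"
    unfolding coords_of_def fst_conv snd_conv
    by (intro add_mono dist_emb_le) (use * in \<open>auto simp: case_prod_beta simp del: card_prod\<close>)
  finally show ?thesis by (simp add: ac_simps del: card_prod)
qed

text \<open>With at most as many domains as factors, the i-th factor can be represented by the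
  locally constant function of the i-th planner. A flag inside the i-th domain then kills the i-th
  factor.\<close>

theorem motion_planners_bound:
  fixes U :: "nat \<Rightarrow> ((('a ^ 'm) \<times> (bit ^ 'n)) set \<times> (('a ^ 'm) \<times> (bit ^ 'n)) set) set"
  assumes odd_choose: "\<And>j. odd ((2 * n j - 1) choose n j)"
    and U: "\<And>i. i < k \<Longrightarrow> openin (prod_topology M M) (U i) \<and> has_motion_planner M (U i)"
    and cover: "(\<Union>i<k. U i) = topspace (prod_topology M M)"
  shows "(\<Sum>j\<in>UNIV. 2 * n j - 1) < k"
proof (rule ccontr)
  assume "\<not> ?thesis"
  then have k: "k \<le> (\<Sum>j\<in>UNIV. 2 * n j - 1)" by simp
  define A where "A i = {z \<in> Z \<times> Z. QQ z \<in> U i}" for i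
  define twist where "twist i \<kappa> \<longleftrightarrow>
      (\<forall>x y. \<forall>\<alpha>\<in>K. \<forall>\<beta>\<in>K. (x, y) \<in> A i \<longrightarrow> \<kappa> (flip \<alpha> x, flip \<beta> y) = (\<lambda>p. \<kappa> (x, y) p + \<alpha> p + \<beta> p)) \<and>
      (\<forall>B z z'. B \<subseteq> A i \<longrightarrow> connected B \<longrightarrow> z \<in> B \<longrightarrow> z' \<in> B \<longrightarrow> \<kappa> z = \<kappa> z')"
    for i and \<kappa> :: "('m, 'n) coords \<times> ('m, 'n) coords \<Rightarrow> 'm \<times> nat \<Rightarrow> bit"
  have "\<exists>\<kappa>. twist i \<kappa>" if "i < k" for i
    using U[OF that] unfolding A_def twist_def by (rule motion_planner_twist[OF conjunct2]) blast
  then obtain \<kappa> where twist: "\<And>i. i < k \<Longrightarrow> twist i (\<kappa> i)" by metis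
  have \<kappa>: "\<kappa> i (flip \<alpha> x, flip \<beta> y) = (\<lambda>p. \<kappa> i (x, y) p + \<alpha> p + \<beta> p)"
    if "i < k" "\<alpha> \<in> K" "\<beta> \<in> K" "(x, y) \<in> A i" for i x y \<alpha> \<beta>
    using twist[OF that(1)] that unfolding twist_def by blast
  have \<kappa>_const: "\<kappa> i z = \<kappa> i z'"
    if "i < k" "B \<subseteq> A i" "connected B" "z \<in> B" "z' \<in> B" for i B z z'
    using twist[OF that(1)] that unfolding twist_def by blast
  have openA: "open (A i)" if "i < k" for i
  proof -
    have "openin (top_of_set (Z \<times> Z)) (A i)"
      using continuous_map_QQ U[OF that] unfolding continuous_map_def A_def by simp
    then show ?thesis using openin_open_trans open_Times[OF open_Z open_Z] by blast
  qed
  have ZA: "Z \<times> Z \<subseteq> (\<Union>i<k. A i)"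
  proof
    fix z assume z: "z \<in> Z \<times> Z"
    then have "QQ z \<in> topspace (prod_topology M M)"
      using continuous_map_QQ by (auto simp: continuous_map_def)
    then obtain i where "i < k" "QQ z \<in> U i" using cover by blast
    then show "z \<in> (\<Union>i<k. A i)" using z by (auto simp: A_def)
  qed
  have "compact (Y1 \<times> Y1)" by (intro compact_Times compact_Y1)
  moreover have "Y1 \<times> Y1 \<subseteq> \<Union>(A ` {..<k})" using ZA Y1_subset_Z by blast
  moreover have "open B" if "B \<in> A ` {..<k}" for B using openA that by auto
  ultimately obtain \<epsilon> where \<epsilon>: "0 < \<epsilon>" "\<And>z. z \<in> Y1 \<times> Y1 \<Longrightarrow> \<exists>B\<in>A ` {..<k}. ball z \<epsilon> \<subseteq> B"
    using Heine_Borel_lemma[of "Y1 \<times> Y1" "A ` {..<k}"] by metis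

  define N' where "N' = (\<Sum>j\<in>UNIV. 2 * n j - 1)"
  \<comment> \<open>Along a flag each coordinate changes by at most \<open>N'\<close>; the grid is
    chosen so fine that this stays below the Lebesgue number \<open>\<epsilon>\<close> after
    scaling. Any even L of this size would do, and the summand 2 keeps it positive.\<close>
  obtain l :: nat where l: "2 * CARD('m \<times> 'n option) * N' / \<epsilon> < l" using reals_Archimedean2 by blast
  define L where "L = 2 * int l + 2"
  have L: "even L" "0 < L" by (auto simp: L_def)
  have Lr: "real_of_int L = 2 * real l + 2" by (simp add: L_def)
  have mesh: "2 * CARD('m \<times> 'n option) * N' / L < \<epsilon>"
  proof -
    have "2 * CARD('m \<times> 'n option) * N' < l * \<epsilon>" using l \<epsilon>(1) by (simp add: divide_less_eq del: card_prod)
    also have "\<dots> \<le> L * \<epsilon>" using \<epsilon>(1) by (intro mult_right_mono) (auto simp: Lr)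
    finally show ?thesis using L by (simp add: divide_less_eq mult.commute del: card_prod)
  qed

  obtain \<rho> where "paired_cube_spheres n \<rho> KK L"
    by (rule paired_cube_spheres[OF n_pos L])
  then interpret C: paired_cube_spheres n \<rho> KK L
    "\<lambda>b. if fst b then n (snd b) else n (snd b) - 1" .
  have N': "C.N = N'"
    unfolding C.N_def C.sum_bool_times N'_def using n_pos by (intro sum.cong) auto
  have Npos: "0 < C.N"
  proof -
    have "0 < 2 * n j - 1" for j using n_pos[of j] by linarith
    then show ?thesis unfolding N' N'_def by (intro sum_pos) auto
  qed
  obtain lab where lab: "C.cup (\<lambda>i. C.cbar (lab i)) = 1"
    using C.cup_cbar_ne_0[OF odd_choose] by blast
  have coords_Y1: "coords_of L v \<in> Y1 \<times> Y1" if v: "v \<in> C.V" for v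
  proof -
    have b: "\<bar>real_of_int (v p) / L\<bar> \<le> 1" for p
      using C.V_bound[OF v, of p] L by (simp add: abs_divide flip: of_int_abs)
    have m: "\<exists>i\<le>n j. \<bar>real_of_int (v ((s, j), i)) / L\<bar> = 1" for s j
    proof -
      obtain i where i: "i \<le> (if s then n j else n j - 1)" "\<bar>v ((s, j), i)\<bar> = L"
        using C.V_max[OF v, of "(s, j)", unfolded fst_conv snd_conv] by blast
      have "\<bar>real_of_int (v ((s, j), i))\<bar> = L" using i(2) by linarith
      then show ?thesis using i(1) L by (intro exI[of _ i]) (auto simp: abs_divide split: if_splits)
    qed
    show ?thesis
      unfolding coords_of_def mem_Times_iff fst_conv snd_conv
      by (intro conjI emb_in_Y1) (use b m in auto)
  qed
  have coords_act: "coords_of L (act (pair \<alpha> \<beta>) v) =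
      (flip \<alpha> (fst (coords_of L v)), flip \<beta> (snd (coords_of L v)))" for \<alpha> \<beta> v
    unfolding coords_of_def fst_conv snd_conv flip_def prod.inject
    by (intro conjI coords_eqI emb_outside) (auto simp: act_def)
  \<comment> \<open>Outside the domain the leading-sign cochain of the same character takes over. As
    \<open>A i\<close> is invariant under sign changes from K, the mixture is still
    equivariant.\<close>
  define c' where "c' i v = (if i < k \<and> coords_of L v \<in> A i then \<kappa> i (coords_of L v) (lab i, 0) else C.cbar (lab i) v)"
    for i v
  define \<xi> where "\<xi> i \<gamma> = \<gamma> ((False, lab i), 0) + \<gamma> ((True, lab i), 0)" for i and \<gamma> :: "(bool \<times> 'm) \<times> nat \<Rightarrow> bit"
  have eq_cbar: "C.equivariant (\<xi> i) (C.cbar (lab i))" for i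
    unfolding \<xi>_def by (rule C.equivariant_cbar)
  have "C.equivariant (\<xi> i) (c' i)" for i
    unfolding C.equivariant_def
  proof (intro ballI)
    fix \<gamma> v assume \<gamma>: "\<gamma> \<in> KK" and v: "v \<in> C.V"
    obtain \<alpha> \<beta> where ab: "\<gamma> = pair \<alpha> \<beta>" "\<alpha> \<in> K" "\<beta> \<in> K" using \<gamma> by blast
    obtain x y where xy: "coords_of L v = (x, y)" by fastforce
    have Z: "x \<in> Z" "y \<in> Z" using coords_Y1[OF v] xy Y1_subset_Z by auto
    have act: "coords_of L (act \<gamma> v) = (flip \<alpha> x, flip \<beta> y)" using coords_act[of \<alpha> \<beta> v] by (simp add: ab xy)
    have mem: "coords_of L (act \<gamma> v) \<in> A i \<longleftrightarrow> coords_of L v \<in> A i"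
      unfolding act xy A_def using Z ab by (simp add: QQ_def Q_flip flip_in_Z)
    show "c' i (act \<gamma> v) = c' i v + \<xi> i \<gamma>"
    proof (cases "i < k \<and> coords_of L v \<in> A i")
      case True
      then have "\<kappa> i (coords_of L (act \<gamma> v)) = (\<lambda>p. \<kappa> i (x, y) p + \<alpha> p + \<beta> p)"
        unfolding act using ab xy by (intro \<kappa>) auto
      then show ?thesis using True mem xy by (simp add: c'_def \<xi>_def ab add.assoc)
    next
      case False
      then have "c' i (act \<gamma> v) = C.cbar (lab i) (act \<gamma> v)" "c' i v = C.cbar (lab i) v"
        using mem by (auto simp: c'_def)
      then show ?thesis using eq_cbar[of i] \<gamma> v unfolding C.equivariant_def by simp
    qed
  qed
  moreover have "\<exists>i<C.N. c' i (fs ! i) = c' i (fs ! Suc i)" if fs: "C.flag fs" for fs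
  proof -
    have near: "\<bar>(fs ! m) p - (fs ! 0) p\<bar> \<le> int m" if "m \<le> C.N" for m p
      using that
    proof (induction m)
      case (Suc m)
      have "C.step (fs ! m) (fs ! Suc m)" using fs Suc.prems by (simp add: C.flag_def)
      then have "\<bar>(fs ! Suc m) p - (fs ! m) p\<bar> \<le> 1" by (auto elim!: C.stepE)
      then show ?case using Suc.IH Suc.prems by linarith
    qed simp
    have ball: "coords_of L (fs ! m) \<in> ball (coords_of L (fs ! 0)) \<epsilon>" if m: "m \<le> C.N" for m
    proof -
      have "\<bar>(fs ! 0) p - (fs ! m) p\<bar> \<le> int N'" for p using near[OF m, of p] m N' by linarith
      then have "dist (coords_of L (fs ! 0)) (coords_of L (fs ! m)) \<le> 2 * CARD('m \<times> 'n option) * int N' / L"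
        by (intro dist_coords_of_le L)
      then show ?thesis using mesh by simp
    qed
    \<comment> \<open>The same i serves as number of the domain containing the flag and as position
      of the vanishing factor; it is a valid position because \<open>k \<le> N'\<close>.\<close>
    obtain i where i: "i < k" "ball (coords_of L (fs ! 0)) \<epsilon> \<subseteq> A i"
      using \<epsilon>(2)[OF coords_Y1[OF C.flag_nth[OF fs, of 0]]] by auto
    have iN: "i < C.N" using i(1) k N' by (simp add: N'_def)
    have "\<kappa> i (coords_of L (fs ! i)) = \<kappa> i (coords_of L (fs ! Suc i))"
      by (rule \<kappa>_const[OF i(1,2) connected_ball]) (use ball iN in auto)
    moreover have "coords_of L (fs ! i) \<in> A i" "coords_of L (fs ! Suc i) \<in> A i"
      using ball[of i] ball[of "Suc i"] iN i(2) by auto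
    ultimately have "c' i (fs ! i) = c' i (fs ! Suc i)" using i(1) by (simp add: c'_def)
    then show ?thesis using iN by blast
  qed
  ultimately have "C.cup (\<lambda>i. C.cbar (lab i)) = 0"
    by (intro C.cup_eq_0[OF Npos, of \<xi> _ c'] eq_cbar)
  then show False using lab by simp
qed

end

theorem corollary2p13:
  fixes S :: "'m::finite \<Rightarrow> 'a::euclidean_space set"
    and n r :: "'m \<Rightarrow> nat"
    and P :: "('a ^ 'm) set"
    and lam :: "('a ^ 'm) set \<Rightarrow> bit ^ 'n::finite"
  assumes "\<And>j. int (n j) simplex S j"
    and "P = {x. \<forall>j. x $ j \<in> S j}"
    and "CARD('n) = (\<Sum>j\<in>UNIV. n j)"
    and "characteristic_function P lam"
    and "\<And>j. r j > 0"
    and "\<And>j. n j = 2 ^ (r j - 1)"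
  shows "TC (small_cover P lam) \<ge> enat (2 * (\<Sum>j\<in>UNIV. n j) - CARD('m) + 1)"
proof -
  have "\<exists>f. inj_on f {..n j} \<and> \<not> affine_dependent (f ` {..n j}) \<and> S j = convex hull (f ` {..n j})" for j
  proof -
    obtain W where W: "\<not> affine_dependent W" "int (card W) = int (n j) + 1" "S j = convex hull W"
      using assms(1)[of j] unfolding simplex_def by blast
    have "finite W" using W(1) by (rule aff_independent_finite)
    then obtain f where "bij_betw f {0..<card W} W" using ex_bij_betw_nat_finite by blast
    moreover have "{0..<card W} = {..n j}" using W(2) by auto
    ultimately show ?thesis using W by (intro exI[of _ f]) (auto simp: bij_betw_def)
  qed
  then obtain vtx where vtx: "\<And>j. inj_on (vtx j) {..n j}" "\<And>j. \<not> affine_dependent (vtx j ` {..n j})"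
      "\<And>j. S j = convex hull (vtx j ` {..n j})" by metis
  have n_pos: "0 < n j" for j using assms(6) by simp
  interpret product_small_cover S n P vtx lam
    by unfold_locales (use vtx assms n_pos in auto)
  have odd_choose: "odd ((2 * n j - 1) choose n j)" for j
  proof -
    have "2 * n j = 2 ^ r j" using assms(5,6)[of j] by (metis Suc_diff_1 power_Suc)
    then show ?thesis using odd_choose_pow2_minus_1[of "n j" "r j"] n_pos[of j] by simp
  qed
  \<comment> \<open>Each \<open>n j\<close> is positive, so the truncated subtractions are
    exact.\<close>
  have sum: "(\<Sum>j\<in>UNIV. 2 * n j - 1) = 2 * (\<Sum>j\<in>UNIV. n j) - CARD('m)"
  proof -
    have "(\<Sum>j\<in>UNIV. 2 * n j - 1) + CARD('m) = (\<Sum>j\<in>UNIV. (2 * n j - 1) + 1)" by (simp only: sum.distrib) simp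
    also have "\<dots> = (\<Sum>j\<in>UNIV. 2 * n j)" using n_pos by (intro sum.cong) (auto simp: Suc_le_eq)
    finally show ?thesis by (simp add: sum_distrib_left)
  qed
  show ?thesis
    unfolding TC_def
  proof (rule Inf_greatest, clarify)
    fix k and U :: "nat \<Rightarrow> ((('a ^ 'm) \<times> (bit ^ 'n)) set \<times> (('a ^ 'm) \<times> (bit ^ 'n)) set) set"
    assume "\<forall>i<k. openin (prod_topology (small_cover P lam) (small_cover P lam)) (U i) \<and>
          has_motion_planner (small_cover P lam) (U i)"
      and "(\<Union>i<k. U i) = topspace (prod_topology (small_cover P lam) (small_cover P lam))"
    then have "(\<Sum>j\<in>UNIV. 2 * n j - 1) < k"
      by (intro motion_planners_bound[OF odd_choose]) (auto simp: M_def)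
    then show "enat (2 * (\<Sum>j\<in>UNIV. n j) - CARD('m) + 1) \<le> enat k" unfolding sum by simp
  qed
qed

end
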